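(* Let $R$ be a commutative noetherian integral domain in which $2$ is invertible. Let $A$ be a finite, locally free $R$-Hopf algebra (with antipode of square the identity) such that $A^D$ satisfies hypothesis $\mathbf{H}_1$, let $\theta^D$ be an $R$-basis of $I(A^D)$, and let $(M,q)$ be a projective $A$-equivariant symmetric bundle over $R$. Then $(M^A,q^A)$ is a symmetric $R$-bundle.
   Context: $A^D=\mathrm{Hom}_R(A,R)$ is the dual Hopf algebra, with comultiplication $\Delta^D$, counit $\varepsilon^D$ ($\varepsilon^D(g)=g(1_A)$) and antipode $S^D$. Its module of left integrals is $I(A^D)=\{f\in A^D: uf=\varepsilon^D(u)f\ \forall u\in A^D\}$. A Hopf algebra is unimodular if its modules of left and right integrals coincide. A Hopf algebra satisfies $\mathbf{H}_1$ when it is unimodular, its module of integrals is a free $R$-module, and the restriction of its antipode to the module of integrals is the identity map. A right $A$-comodule is a finitely generated locally free $R$-module $M$ with structure map $\alpha_M: M\to M\otimes_R A$, $m\mapsto\sum m_{(0)}\otimes m_{(1)}$; it is a left $A^D$-module via $gm=\sum\langle g,m_{(1)}\rangle m_{(0)}$. Put $M^A=\{m\in M:\alpha_M(m)=m\otimes 1\}$. A symmetric bundle over $R$ is a finitely generated locally free $R$-module $M$ with a non-degenerate symmetric bilinear form $q: M\times M\to R$ (non-degenerate means that the adjoint map $M\to\mathrm{Hom}_R(M,R)$ is an isomorphism). It is $A$-equivariant if $M$ is an $A$-comodule and $q(gm,n)=q(m,S^D(g)n)$ for all $m,n\in M$, $g\in A^D$; it is projective $A$-equivariant if moreover $M$ is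 a projective $A^D$-module. For $(M,q)$ and $A$ as in the claim one has $M^A=\theta^D M$, and $q^A: M^A\times M^A\to R$ is the (well defined) symmetric bilinear form given by $q^A(x,y)=q(m,y)=q(x,n)$ for any $m,n\in M$ with $x=\theta^D m$, $y=\theta^D n$. *)

theory Defs
  imports
    "HOL-Algebra.Ring_Divisibility"
    "HOL-Algebra.AbelCoset"
    "Jordan_Normal_Form.Missing_VectorSpace"
begin

text \<open>
  Rings and modules are those of HOL-Algebra; linear maps (\<open>module_hom\<close>), \<open>module.span\<close> and
  \<open>module.lin_dep\<close> are those of the AFP entry VectorSpace. A record of type \<open>('r, 'a) module\<close>
  also has the ring fields \<open>mult\<close> and \<open>one\<close>: they carry the multiplication of an algebra and are
  ignored for a plain module.
\<close>

section \<open>Modules over a commutative ring\<close>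

definition regular :: "('r, 'c) ring_scheme \<Rightarrow> ('r, 'r) module" where
  "regular R = \<lparr>carrier = carrier R, monoid.mult = monoid.mult R, one = one R,
     zero = zero R, add = add R, smult = monoid.mult R\<rparr>"

definition linear_forms :: "('r, 'c) ring_scheme \<Rightarrow> ('r, 'm, 'd) module_scheme \<Rightarrow> ('m \<Rightarrow> 'r) set" where
  "linear_forms R M = module_hom R M (regular R) \<inter> extensional (carrier M)"

definition finitely_generated :: "('r, 'c) ring_scheme \<Rightarrow> ('r, 'm, 'd) module_scheme \<Rightarrow> bool" where
  "finitely_generated R M \<longleftrightarrow>
     (\<exists>G. finite G \<and> G \<subseteq> carrier M \<and> module.span R M G = carrier M)"

definition is_basis :: "('r, 'c) ring_scheme \<Rightarrow> ('r, 'm, 'd) module_scheme \<Rightarrow> 'm set \<Rightarrow> bool" where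
  "is_basis R M B \<longleftrightarrow>
     B \<subseteq> carrier M \<and> \<not> module.lin_dep R M B \<and> module.span R M B = carrier M"

definition free_module :: "('r, 'c) ring_scheme \<Rightarrow> ('r, 'm, 'd) module_scheme \<Rightarrow> bool" where
  "free_module R M \<longleftrightarrow> module R M \<and> (\<exists>B. is_basis R M B)"

text \<open>
  \<open>frac R S M m s\<close> is the fraction \<open>m/s\<close>, as an equivalence class of pairs. The operations of the
  localisation are unions over representatives; all the classes united are equal. The localised
  ring is \<open>localisation R S (regular R)\<close>.
\<close>

definition frac ::
  "('r, 'c) ring_scheme \<Rightarrow> 'r set \<Rightarrow> ('r, 'm, 'd) module_scheme \<Rightarrow> 'm \<Rightarrow> 'r \<Rightarrow> ('m \<times> 'r) set" where
  "frac R S M m s = {(n, t). n \<in> carrier M \<and> t \<in> S \<and>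
     (\<exists>u\<in>S. u \<odot>\<^bsub>M\<^esub> (t \<odot>\<^bsub>M\<^esub> m) = u \<odot>\<^bsub>M\<^esub> (s \<odot>\<^bsub>M\<^esub> n))}"

definition localisation ::
  "('r, 'c) ring_scheme \<Rightarrow> 'r set \<Rightarrow> ('r, 'm, 'd) module_scheme
     \<Rightarrow> (('r \<times> 'r) set, ('m \<times> 'r) set) module" where
  "localisation R S M =
     \<lparr>carrier = {frac R S M m s | m s. m \<in> carrier M \<and> s \<in> S},
      monoid.mult = (\<lambda>X Y. \<Union>(m, s)\<in>X. \<Union>(n, t)\<in>Y. frac R S M (m \<otimes>\<^bsub>M\<^esub> n) (s \<otimes>\<^bsub>R\<^esub> t)),
      one = frac R S M \<one>\<^bsub>M\<^esub> \<one>\<^bsub>R\<^esub>,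
      zero = frac R S M \<zero>\<^bsub>M\<^esub> \<one>\<^bsub>R\<^esub>,
      add = (\<lambda>X Y. \<Union>(m, s)\<in>X. \<Union>(n, t)\<in>Y.
               frac R S M ((t \<odot>\<^bsub>M\<^esub> m) \<oplus>\<^bsub>M\<^esub> (s \<odot>\<^bsub>M\<^esub> n)) (s \<otimes>\<^bsub>R\<^esub> t)),
      smult = (\<lambda>X Y. \<Union>(r, s)\<in>X. \<Union>(m, t)\<in>Y. frac R S M (r \<odot>\<^bsub>M\<^esub> m) (s \<otimes>\<^bsub>R\<^esub> t))\<rparr>"

definition locally_free :: "('r, 'c) ring_scheme \<Rightarrow> ('r, 'm, 'd) module_scheme \<Rightarrow> bool" where
  "locally_free R M \<longleftrightarrow>
     (\<forall>P. primeideal P R \<longrightarrow>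
        free_module (localisation R (carrier R - P) (regular R)) (localisation R (carrier R - P) M))"

definition fg_locally_free :: "('r, 'c) ring_scheme \<Rightarrow> ('r, 'm, 'd) module_scheme \<Rightarrow> bool" where
  "fg_locally_free R M \<longleftrightarrow> module R M \<and> finitely_generated R M \<and> locally_free R M"

section \<open>Projective modules over a possibly noncommutative ring\<close>

text \<open>The locale \<open>module\<close> of HOL-Algebra requires a commutative ring of scalars.\<close>

locale left_module = B?: ring B + M?: abelian_group M
  for B :: "('b, 'c) ring_scheme" and M :: "('b, 'm, 'd) module_scheme" (structure) +
  assumes smult_closed: "\<lbrakk>b \<in> carrier B; x \<in> carrier M\<rbrakk> \<Longrightarrow> b \<odot>\<^bsub>M\<^esub> x \<in> carrier M"
    and smult_l_distr: "\<lbrakk>b \<in> carrier B; c \<in> carrier B; x \<in> carrier M\<rbrakk>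
      \<Longrightarrow> (b \<oplus>\<^bsub>B\<^esub> c) \<odot>\<^bsub>M\<^esub> x = (b \<odot>\<^bsub>M\<^esub> x) \<oplus>\<^bsub>M\<^esub> (c \<odot>\<^bsub>M\<^esub> x)"
    and smult_r_distr: "\<lbrakk>b \<in> carrier B; x \<in> carrier M; y \<in> carrier M\<rbrakk>
      \<Longrightarrow> b \<odot>\<^bsub>M\<^esub> (x \<oplus>\<^bsub>M\<^esub> y) = (b \<odot>\<^bsub>M\<^esub> x) \<oplus>\<^bsub>M\<^esub> (b \<odot>\<^bsub>M\<^esub> y)"
    and smult_assoc1: "\<lbrakk>b \<in> carrier B; c \<in> carrier B; x \<in> carrier M\<rbrakk>
      \<Longrightarrow> (b \<otimes>\<^bsub>B\<^esub> c) \<odot>\<^bsub>M\<^esub> x = b \<odot>\<^bsub>M\<^esub> (c \<odot>\<^bsub>M\<^esub> x)"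
    and smult_one: "x \<in> carrier M \<Longrightarrow> \<one>\<^bsub>B\<^esub> \<odot>\<^bsub>M\<^esub> x = x"

definition free_on :: "('b, 'c) ring_scheme \<Rightarrow> 'i set \<Rightarrow> ('b, 'i \<Rightarrow> 'b) module" where
  "free_on B I =
     \<lparr>carrier = {f. (\<forall>i\<in>I. f i \<in> carrier B) \<and> (\<forall>i. i \<notin> I \<longrightarrow> f i = \<zero>\<^bsub>B\<^esub>) \<and> finite {i. f i \<noteq> \<zero>\<^bsub>B\<^esub>}},
      monoid.mult = undefined, one = undefined,
      zero = (\<lambda>i. \<zero>\<^bsub>B\<^esub>), add = (\<lambda>f g i. f i \<oplus>\<^bsub>B\<^esub> g i), smult = (\<lambda>b f i. b \<otimes>\<^bsub>B\<^esub> f i)\<rparr>"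

text \<open>
  Projective means: isomorphic to a direct summand of a free module. The index set may be taken
  inside the type of \<open>M\<close>, since \<open>M\<close> is a quotient of the free module on \<open>carrier M\<close> and a
  projective \<open>M\<close> splits off from it.
\<close>

definition projective_module ::
  "('b, 'c) ring_scheme \<Rightarrow> ('b, 'm, 'd) module_scheme \<Rightarrow> bool" where
  "projective_module B M \<longleftrightarrow> left_module B M \<and>
     (\<exists>(I :: 'm set) i p. i \<in> module_hom B M (free_on B I) \<and> p \<in> module_hom B (free_on B I) M \<and>
        (\<forall>x\<in>carrier M. p (i x) = x))"

section \<open>Tensor products\<close>

definition point :: "('r, 'c) ring_scheme \<Rightarrow> 'i \<Rightarrow> 'i \<Rightarrow> 'r" where
  "point R i = (\<lambda>j. if j = i then \<one>\<^bsub>R\<^esub> else \<zero>\<^bsub>R\<^esub>)"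

definition tensor_free ::
  "('r, 'c) ring_scheme \<Rightarrow> ('r, 'm, 'd) module_scheme \<Rightarrow> ('r, 'n, 'e) module_scheme
     \<Rightarrow> ('r, 'm \<times> 'n \<Rightarrow> 'r) module" where
  "tensor_free R M N = free_on R (carrier M \<times> carrier N)"

definition tensor_relations ::
  "('r, 'c) ring_scheme \<Rightarrow> ('r, 'm, 'd) module_scheme \<Rightarrow> ('r, 'n, 'e) module_scheme
     \<Rightarrow> ('m \<times> 'n \<Rightarrow> 'r) set" where
  "tensor_relations R M N = (let F = tensor_free R M N; \<delta> = (\<lambda>x y. point R (x, y)) in
     {\<delta> (x \<oplus>\<^bsub>M\<^esub> x') y \<ominus>\<^bsub>F\<^esub> (\<delta> x y \<oplus>\<^bsub>F\<^esub> \<delta> x' y) | x x' y.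
        x \<in> carrier M \<and> x' \<in> carrier M \<and> y \<in> carrier N} \<union>
     {\<delta> x (y \<oplus>\<^bsub>N\<^esub> y') \<ominus>\<^bsub>F\<^esub> (\<delta> x y \<oplus>\<^bsub>F\<^esub> \<delta> x y') | x y y'.
        x \<in> carrier M \<and> y \<in> carrier N \<and> y' \<in> carrier N} \<union>
     {\<delta> (r \<odot>\<^bsub>M\<^esub> x) y \<ominus>\<^bsub>F\<^esub> (r \<odot>\<^bsub>F\<^esub> \<delta> x y) | r x y.
        r \<in> carrier R \<and> x \<in> carrier M \<and> y \<in> carrier N} \<union>
     {\<delta> x (r \<odot>\<^bsub>N\<^esub> y) \<ominus>\<^bsub>F\<^esub> (r \<odot>\<^bsub>F\<^esub> \<delta> x y) | r x y.
        r \<in> carrier R \<and> x \<in> carrier M \<and> y \<in> carrier N})"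

definition tensor_kernel ::
  "('r, 'c) ring_scheme \<Rightarrow> ('r, 'm, 'd) module_scheme \<Rightarrow> ('r, 'n, 'e) module_scheme
     \<Rightarrow> ('m \<times> 'n \<Rightarrow> 'r) set" where
  "tensor_kernel R M N = module.span R (tensor_free R M N) (tensor_relations R M N)"

definition tens ::
  "('r, 'c) ring_scheme \<Rightarrow> ('r, 'm, 'd) module_scheme \<Rightarrow> ('r, 'n, 'e) module_scheme
     \<Rightarrow> 'm \<Rightarrow> 'n \<Rightarrow> ('m \<times> 'n \<Rightarrow> 'r) set" where
  "tens R M N x y = tensor_kernel R M N +>\<^bsub>tensor_free R M N\<^esub> point R (x, y)"

text \<open>
  The linear map out of the tensor product induced by \<open>\<beta>\<close>: it sends the class of a formal sum
  \<open>\<Sum> c (x, y) (x, y)\<close> to \<open>\<Sum> c (x, y) \<beta> x y\<close>. For bilinear \<open>\<beta>\<close> the chosen representative is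
  irrelevant.
\<close>

definition tensor_lift ::
  "('r, 'c) ring_scheme \<Rightarrow> ('r, 'p, 'd) module_scheme \<Rightarrow> ('m \<Rightarrow> 'n \<Rightarrow> 'p) \<Rightarrow> ('m \<times> 'n \<Rightarrow> 'r) set \<Rightarrow> 'p"
  where
  "tensor_lift R P \<beta> t = (let c = (SOME c. c \<in> t) in
     \<Oplus>\<^bsub>P\<^esub>z\<in>{z. c z \<noteq> \<zero>\<^bsub>R\<^esub>}. c z \<odot>\<^bsub>P\<^esub> \<beta> (fst z) (snd z))"

definition tensor_module ::
  "('r, 'c) ring_scheme \<Rightarrow> ('r, 'm, 'd) module_scheme \<Rightarrow> ('r, 'n, 'e) module_scheme
     \<Rightarrow> ('r, ('m \<times> 'n \<Rightarrow> 'r) set) module" where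
  "tensor_module R M N = (let F = tensor_free R M N; K = tensor_kernel R M N in
     \<lparr>carrier = a_rcosets\<^bsub>F\<^esub> K, monoid.mult = undefined, one = undefined,
      zero = K, add = set_add F, smult = (\<lambda>r X. \<Union>x\<in>X. K +>\<^bsub>F\<^esub> (r \<odot>\<^bsub>F\<^esub> x))\<rparr>)"

text \<open>For algebras, the product is determined by \<open>(a \<otimes> b) (a' \<otimes> b') = a a' \<otimes> b b'\<close>.\<close>

definition tensor_algebra ::
  "('r, 'c) ring_scheme \<Rightarrow> ('r, 'm, 'd) module_scheme \<Rightarrow> ('r, 'n, 'e) module_scheme
     \<Rightarrow> ('r, ('m \<times> 'n \<Rightarrow> 'r) set) module" where
  "tensor_algebra R M N = (let T = tensor_module R M N in T
     \<lparr>monoid.mult := (\<lambda>s t. tensor_lift R T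
                 (\<lambda>a b. tensor_lift R T (\<lambda>a' b'. tens R M N (a \<otimes>\<^bsub>M\<^esub> a') (b \<otimes>\<^bsub>N\<^esub> b')) t) s),
      one := tens R M N \<one>\<^bsub>M\<^esub> \<one>\<^bsub>N\<^esub>\<rparr>)"

definition tensor_map ::
  "('r, 'c) ring_scheme \<Rightarrow> ('r, 'm, 'd) module_scheme \<Rightarrow> ('r, 'n, 'e) module_scheme
     \<Rightarrow> ('m' \<Rightarrow> 'm) \<Rightarrow> ('n' \<Rightarrow> 'n) \<Rightarrow> ('m' \<times> 'n' \<Rightarrow> 'r) set \<Rightarrow> ('m \<times> 'n \<Rightarrow> 'r) set" where
  "tensor_map R M N f g = tensor_lift R (tensor_module R M N) (\<lambda>x y. tens R M N (f x) (g y))"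

text \<open>The associativity isomorphism from \<open>(L \<otimes> M) \<otimes> N\<close> to \<open>L \<otimes> (M \<otimes> N)\<close>.\<close>

definition tensor_assoc ::
  "('r, 'c) ring_scheme \<Rightarrow> ('r, 'l, 'd) module_scheme \<Rightarrow> ('r, 'm, 'e) module_scheme
     \<Rightarrow> ('r, 'n, 'f) module_scheme
     \<Rightarrow> (('l \<times> 'm \<Rightarrow> 'r) set \<times> 'n \<Rightarrow> 'r) set \<Rightarrow> ('l \<times> ('m \<times> 'n \<Rightarrow> 'r) set \<Rightarrow> 'r) set" where
  "tensor_assoc R L M N = (let MN = tensor_module R M N; T = tensor_module R L MN in
     tensor_lift R T (\<lambda>t z. tensor_lift R T (\<lambda>x y. tens R L MN x (tens R M N y z)) t))"

section \<open>Hopf algebras\<close>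

record ('r, 'a) hopf = "('r, 'a) module" +
  comult :: "'a \<Rightarrow> ('a \<times> 'a \<Rightarrow> 'r) set"
  counit :: "'a \<Rightarrow> 'r"
  antipode :: "'a \<Rightarrow> 'a"

text \<open>Neither commutativity nor cocommutativity is assumed.\<close>

locale hopf_algebra = R?: cring R + module R A + A: ring A
  for R :: "('r, 'c) ring_scheme" and A :: "('r, 'a, 'd) hopf_scheme" +
  assumes smult_mult_left: "\<lbrakk>r \<in> carrier R; a \<in> carrier A; b \<in> carrier A\<rbrakk>
      \<Longrightarrow> (r \<odot>\<^bsub>A\<^esub> a) \<otimes>\<^bsub>A\<^esub> b = r \<odot>\<^bsub>A\<^esub> (a \<otimes>\<^bsub>A\<^esub> b)"
    and smult_mult_right: "\<lbrakk>r \<in> carrier R; a \<in> carrier A; b \<in> carrier A\<rbrakk>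
      \<Longrightarrow> a \<otimes>\<^bsub>A\<^esub> (r \<odot>\<^bsub>A\<^esub> b) = r \<odot>\<^bsub>A\<^esub> (a \<otimes>\<^bsub>A\<^esub> b)"
    and comult_linear: "comult A \<in> module_hom R A (tensor_algebra R A A)"
    and comult_ring_hom: "comult A \<in> ring_hom A (tensor_algebra R A A)"
    and counit_linear: "counit A \<in> module_hom R A (regular R)"
    and counit_ring_hom: "counit A \<in> ring_hom A R"
    and coassociative: "a \<in> carrier A \<Longrightarrow>
      tensor_assoc R A A A (tensor_map R (tensor_module R A A) A (comult A) id (comult A a))
        = tensor_map R A (tensor_module R A A) id (comult A) (comult A a)"
    and counit_left: "a \<in> carrier A \<Longrightarrow>
      tensor_lift R A (\<lambda>x y. counit A x \<odot>\<^bsub>A\<^esub> y) (comult A a) = a"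
    and counit_right: "a \<in> carrier A \<Longrightarrow>
      tensor_lift R A (\<lambda>x y. counit A y \<odot>\<^bsub>A\<^esub> x) (comult A a) = a"
    and antipode_linear: "antipode A \<in> module_hom R A A"
    and antipode_left: "a \<in> carrier A \<Longrightarrow>
      tensor_lift R A (\<lambda>x y. antipode A x \<otimes>\<^bsub>A\<^esub> y) (comult A a) = counit A a \<odot>\<^bsub>A\<^esub> \<one>\<^bsub>A\<^esub>"
    and antipode_right: "a \<in> carrier A \<Longrightarrow>
      tensor_lift R A (\<lambda>x y. x \<otimes>\<^bsub>A\<^esub> antipode A y) (comult A a) = counit A a \<odot>\<^bsub>A\<^esub> \<one>\<^bsub>A\<^esub>"

definition finite_locally_free_hopf_algebra ::
  "('r, 'c) ring_scheme \<Rightarrow> ('r, 'a, 'd) hopf_scheme \<Rightarrow> bool" where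
  "finite_locally_free_hopf_algebra R A \<longleftrightarrow> hopf_algebra R A \<and> fg_locally_free R A"

text \<open>
  The dual Hopf algebra, on the linear forms of \<open>A\<close>. Its product is convolution,
  \<open>(f h)(a) = \<Sum> f(a\<^sub>1) h(a\<^sub>2)\<close>. Its comultiplication is the transpose of the multiplication of \<open>A\<close>,
  under the identification of the tensor square of the dual with the dual of the tensor square.
\<close>

definition dual_algebra ::
  "('r, 'c) ring_scheme \<Rightarrow> ('r, 'a, 'd) hopf_scheme \<Rightarrow> ('r, 'a \<Rightarrow> 'r) module" where
  "dual_algebra R A =
     \<lparr>carrier = linear_forms R A,
      monoid.mult = (\<lambda>f h. \<lambda>a\<in>carrier A.
                tensor_lift R (regular R) (\<lambda>x y. f x \<otimes>\<^bsub>R\<^esub> h y) (comult A a)),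
      one = (\<lambda>a\<in>carrier A. counit A a),
      zero = (\<lambda>a\<in>carrier A. \<zero>\<^bsub>R\<^esub>),
      add = (\<lambda>f h. \<lambda>a\<in>carrier A. f a \<oplus>\<^bsub>R\<^esub> h a),
      smult = (\<lambda>r f. \<lambda>a\<in>carrier A. r \<otimes>\<^bsub>R\<^esub> f a)\<rparr>"

definition dual_comult ::
  "('r, 'c) ring_scheme \<Rightarrow> ('r, 'a, 'd) hopf_scheme
     \<Rightarrow> ('a \<Rightarrow> 'r) \<Rightarrow> (('a \<Rightarrow> 'r) \<times> ('a \<Rightarrow> 'r) \<Rightarrow> 'r) set" where
  "dual_comult R A g =
     (THE t. t \<in> carrier (tensor_module R (dual_algebra R A) (dual_algebra R A)) \<and>
        (\<forall>a\<in>carrier A. \<forall>b\<in>carrier A.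
           tensor_lift R (regular R) (\<lambda>f h. f a \<otimes>\<^bsub>R\<^esub> h b) t = g (a \<otimes>\<^bsub>A\<^esub> b)))"

definition dual_hopf ::
  "('r, 'c) ring_scheme \<Rightarrow> ('r, 'a, 'd) hopf_scheme \<Rightarrow> ('r, 'a \<Rightarrow> 'r) hopf" where
  "dual_hopf R A = module.extend (dual_algebra R A)
     (hopf.fields (dual_comult R A) (\<lambda>g. g \<one>\<^bsub>A\<^esub>) (\<lambda>g. \<lambda>a\<in>carrier A. g (antipode A a)))"

definition left_integrals :: "('r, 'a, 'd) hopf_scheme \<Rightarrow> 'a set" where
  "left_integrals H = {f \<in> carrier H. \<forall>u\<in>carrier H. u \<otimes>\<^bsub>H\<^esub> f = counit H u \<odot>\<^bsub>H\<^esub> f}"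

definition right_integrals :: "('r, 'a, 'd) hopf_scheme \<Rightarrow> 'a set" where
  "right_integrals H = {f \<in> carrier H. \<forall>u\<in>carrier H. f \<otimes>\<^bsub>H\<^esub> u = counit H u \<odot>\<^bsub>H\<^esub> f}"

definition unimodular :: "('r, 'a, 'd) hopf_scheme \<Rightarrow> bool" where
  "unimodular H \<longleftrightarrow> left_integrals H = right_integrals H"

definition integral_module :: "('r, 'a, 'd) hopf_scheme \<Rightarrow> ('r, 'a, 'd) hopf_scheme" where
  "integral_module H = H\<lparr>carrier := left_integrals H\<rparr>"

definition H1 :: "('r, 'c) ring_scheme \<Rightarrow> ('r, 'a, 'd) hopf_scheme \<Rightarrow> bool" where
  "H1 R H \<longleftrightarrow> unimodular H \<and> free_module R (integral_module H) \<and>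
     (\<forall>t\<in>left_integrals H. antipode H t = t)"

section \<open>Comodules and symmetric bundles\<close>

locale comodule = module R M
  for R :: "('r, 'c) ring_scheme" and A :: "('r, 'a, 'd) hopf_scheme"
    and M :: "('r, 'm, 'e) module_scheme" and \<alpha> :: "'m \<Rightarrow> ('m \<times> 'a \<Rightarrow> 'r) set" +
  assumes fg_locally_free: "fg_locally_free R M"
    and coaction_linear: "\<alpha> \<in> module_hom R M (tensor_module R M A)"
    and coaction_coassociative: "m \<in> carrier M \<Longrightarrow>
      tensor_assoc R M A A (tensor_map R (tensor_module R M A) A \<alpha> id (\<alpha> m))
        = tensor_map R M (tensor_module R A A) id (comult A) (\<alpha> m)"
    and coaction_counit: "m \<in> carrier M \<Longrightarrow>
      tensor_lift R M (\<lambda>x a. counit A a \<odot>\<^bsub>M\<^esub> x) (\<alpha> m) = m"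

definition dual_action ::
  "('r, 'c) ring_scheme \<Rightarrow> ('r, 'm, 'e) module_scheme \<Rightarrow> ('m \<Rightarrow> ('m \<times> 'a \<Rightarrow> 'r) set)
     \<Rightarrow> ('a \<Rightarrow> 'r) \<Rightarrow> 'm \<Rightarrow> 'm" where
  "dual_action R M \<alpha> g m = tensor_lift R M (\<lambda>x a. g a \<odot>\<^bsub>M\<^esub> x) (\<alpha> m)"

definition as_dual_module ::
  "('r, 'c) ring_scheme \<Rightarrow> ('r, 'm, 'e) module_scheme \<Rightarrow> ('m \<Rightarrow> ('m \<times> 'a \<Rightarrow> 'r) set)
     \<Rightarrow> ('a \<Rightarrow> 'r, 'm) module" where
  "as_dual_module R M \<alpha> =
     \<lparr>carrier = carrier M, monoid.mult = monoid.mult M, one = one M,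
      zero = zero M, add = add M, smult = dual_action R M \<alpha>\<rparr>"

definition coinvariants ::
  "('r, 'c) ring_scheme \<Rightarrow> ('r, 'a, 'd) hopf_scheme \<Rightarrow> ('r, 'm, 'e) module_scheme
     \<Rightarrow> ('m \<Rightarrow> ('m \<times> 'a \<Rightarrow> 'r) set) \<Rightarrow> 'm set" where
  "coinvariants R A M \<alpha> = {m \<in> carrier M. \<alpha> m = tens R M A m \<one>\<^bsub>A\<^esub>}"

locale bilinear_form = module R M
  for R :: "('r, 'c) ring_scheme" and M :: "('r, 'm, 'd) module_scheme" and q :: "'m \<Rightarrow> 'm \<Rightarrow> 'r" +
  assumes linear_right: "x \<in> carrier M \<Longrightarrow> q x \<in> module_hom R M (regular R)"
    and linear_left: "y \<in> carrier M \<Longrightarrow> (\<lambda>x. q x y) \<in> module_hom R M (regular R)"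

definition symmetric_bundle ::
  "('r, 'c) ring_scheme \<Rightarrow> ('r, 'm, 'd) module_scheme \<Rightarrow> ('m \<Rightarrow> 'm \<Rightarrow> 'r) \<Rightarrow> bool" where
  "symmetric_bundle R M q \<longleftrightarrow> fg_locally_free R M \<and> bilinear_form R M q \<and>
     (\<forall>x\<in>carrier M. \<forall>y\<in>carrier M. q x y = q y x) \<and>
     bij_betw (\<lambda>x. restrict (q x) (carrier M)) (carrier M) (linear_forms R M)"

definition equivariant_symmetric_bundle ::
  "('r, 'c) ring_scheme \<Rightarrow> ('r, 'a, 'd) hopf_scheme \<Rightarrow> ('r, 'm, 'e) module_scheme
     \<Rightarrow> ('m \<Rightarrow> ('m \<times> 'a \<Rightarrow> 'r) set) \<Rightarrow> ('m \<Rightarrow> 'm \<Rightarrow> 'r) \<Rightarrow> bool" where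
  "equivariant_symmetric_bundle R A M \<alpha> q \<longleftrightarrow> symmetric_bundle R M q \<and> comodule R A M \<alpha> \<and>
     (\<forall>g\<in>carrier (dual_hopf R A). \<forall>m\<in>carrier M. \<forall>n\<in>carrier M.
        q (dual_action R M \<alpha> g m) n = q m (dual_action R M \<alpha> (antipode (dual_hopf R A) g) n))"

definition projective_equivariant_symmetric_bundle ::
  "('r, 'c) ring_scheme \<Rightarrow> ('r, 'a, 'd) hopf_scheme \<Rightarrow> ('r, 'm, 'e) module_scheme
     \<Rightarrow> ('m \<Rightarrow> ('m \<times> 'a \<Rightarrow> 'r) set) \<Rightarrow> ('m \<Rightarrow> 'm \<Rightarrow> 'r) \<Rightarrow> bool" where
  "projective_equivariant_symmetric_bundle R A M \<alpha> q \<longleftrightarrow>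
     equivariant_symmetric_bundle R A M \<alpha> q \<and>
     projective_module (dual_hopf R A) (as_dual_module R M \<alpha>)"

text \<open>
  \<open>q\<^sup>A(x, y) = q(m, y) = q(x, n)\<close> for any \<open>m, n\<close> with \<open>x = \<theta> m\<close> and \<open>y = \<theta> n\<close>; the description
  picks out a value only if it is independent of the choice of \<open>m\<close> and \<open>n\<close>.
\<close>

definition coinvariant_form ::
  "('r, 'c) ring_scheme \<Rightarrow> ('r, 'm, 'e) module_scheme \<Rightarrow> ('m \<Rightarrow> ('m \<times> 'a \<Rightarrow> 'r) set)
     \<Rightarrow> ('a \<Rightarrow> 'r) \<Rightarrow> ('m \<Rightarrow> 'm \<Rightarrow> 'r) \<Rightarrow> 'm \<Rightarrow> 'm \<Rightarrow> 'r" where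
  "coinvariant_form R M \<alpha> \<theta> q x y =
     (THE r. \<forall>m\<in>carrier M. \<forall>n\<in>carrier M.
        x = dual_action R M \<alpha> \<theta> m \<and> y = dual_action R M \<alpha> \<theta> n \<longrightarrow> r = q m y \<and> r = q x n)"

end

theory Submission
  imports Defs
begin

text \<open>
  Write \<open>B\<close> for the dual algebra. A finitely generated locally free module over a noetherian domain
  has a finite dual basis, and conversely. For \<open>A\<close> this shows that an element of \<open>M \<otimes> A\<close> is
  determined by its contractions with the elements of \<open>B\<close>, so \<open>m\<close> is coinvariant iff
  \<open>g m = g(1) m\<close> for all \<open>g\<close> in \<open>B\<close>. In a free \<open>B\<close>-module the elements with this property have
  coordinates in \<open>I(B) = R \<theta>\<close>; splitting \<open>M\<close> off a free module gives \<open>M\<^sup>A = \<theta> M\<close> together with a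
  finite dual basis of \<open>M\<^sup>A\<close> over \<open>R\<close>. As the antipode fixes \<open>\<theta>\<close>, the action of \<open>\<theta>\<close> is self-adjoint
  for \<open>q\<close>, which makes \<open>q\<^sup>A\<close> well defined and symmetric. A linear form \<open>f\<close> on \<open>\<theta> M\<close> pulls back to
  \<open>n \<mapsto> f(\<theta> n) = q(x, n)\<close> for a unique \<open>x\<close>, and \<open>\<theta> u = u(1) \<theta>\<close> (unimodularity) makes \<open>x\<close>
  coinvariant; this inverts the adjoint of \<open>q\<^sup>A\<close>.
\<close>

section \<open>Localisation\<close>

text \<open>Local freeness passes neither directly from \<open>M\<close> to its coinvariants nor
  into a criterion for equality of tensors. A finite dual basis does both, which is why it is the
  working notion and why the comparison with local freeness is made in both directions. From local
  to global, the noetherian hypothesis supplies a maximal ideal above a proper ideal, and the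
  absence of zero divisors ensures that a coefficient vanishing in a localisation vanishes in
  \<open>R\<close>. In the other direction a basis at a prime comes from a spanning set of least
  size. The equality of the coinvariants with the image of \<open>\<theta>\<close> rests on reading
  an integral \<open>r \<theta>\<close> as the product of \<open>\<theta>\<close> with the scalar
  \<open>r 1\<close>. The family of these scalars is a preimage under \<open>\<theta>\<close>, and
  the coefficients \<open>r\<close> are the linear forms of the dual basis of the coinvariants.
  Coinvariance itself is an equation between cosets of formal sums, whereas integrals and
  equivariance speak of the action of the dual algebra; separating tensors by contractions bridges
  the two.\<close>

lemma regular_simps [simp]:
  "carrier (regular R) = carrier R" "monoid.mult (regular R) = monoid.mult R"
  "one (regular R) = one R" "zero (regular R) = zero R" "add (regular R) = add R"
  "smult (regular R) = monoid.mult R"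
  by (simp_all add: regular_def)

lemma (in cring) regular_module: "module R (regular R)"
  by (intro moduleI abelian_groupI)
    (auto intro: is_cring simp: a_ac l_distr r_distr m_assoc
      intro!: bexI[of _ "\<ominus> _"] l_neg)

locale multiplicative_subset = cring R for R :: "('r, 'c) ring_scheme" (structure) +
  fixes S :: "'r set"
  assumes subset_carrier: "S \<subseteq> carrier R"
    and one_in: "\<one> \<in> S"
    and mult_in: "\<lbrakk>s \<in> S; t \<in> S\<rbrakk> \<Longrightarrow> s \<otimes> t \<in> S"
begin

lemma in_carrier: "s \<in> S \<Longrightarrow> s \<in> carrier R"
  using subset_carrier by auto

text \<open>The product of the \<open>s i\<close> serves as \<open>t\<close>. The cofactors lie in
  \<open>S\<close>, not merely in \<open>R\<close>, so that fractions over the \<open>s i\<close>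
  can be expanded to the denominator \<open>t\<close> by \<open>frac_expand\<close>.\<close>

lemma common_multiple:
  assumes "finite I" "\<And>i. i \<in> I \<Longrightarrow> s i \<in> S"
  shows "\<exists>t\<in>S. \<forall>i\<in>I. \<exists>u\<in>S. t = u \<otimes> s i"
  using assms
proof (induction I rule: finite_induct)
  case empty
  then show ?case using one_in by auto
next
  case (insert i I)
  then obtain t where t: "t \<in> S" "\<forall>j\<in>I. \<exists>u\<in>S. t = u \<otimes> s j" by auto
  have "\<exists>u\<in>S. t \<otimes> s i = u \<otimes> s j" if j: "j \<in> insert i I" for j
  proof (cases "j = i")
    case True
    then show ?thesis using t by auto
  next
    case False
    then obtain u where u: "u \<in> S" "t = u \<otimes> s j" using t j by auto
    have "t \<otimes> s i = (u \<otimes> s i) \<otimes> s j"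
      using u insert.prems[of i] insert.prems[of j] that in_carrier by (simp add: m_ac)
    then show ?thesis using u insert.prems[of i] mult_in by auto
  qed
  then show ?case using t insert.prems[of i] mult_in by (intro bexI[of _ "t \<otimes> s i"]) auto
qed

end

text \<open>The operations of \<open>localisation\<close> are unions over all pairs of
  representatives. Such a union collapses to one class as soon as independence of the
  representatives is known; \<open>x\<close> and \<open>y\<close> witness that it is not
  empty.\<close>

lemma UN_pairs_const:
  assumes "x \<in> X" "y \<in> Y" "\<And>a b c d. (a, b) \<in> X \<Longrightarrow> (c, d) \<in> Y \<Longrightarrow> F a b c d = Z"
  shows "(\<Union>(a, b)\<in>X. \<Union>(c, d)\<in>Y. F a b c d) = Z"
  using assms by (cases x, cases y) fastforce

locale fraction_module = multiplicative_subset R S + module R M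
  for R :: "('r, 'c) ring_scheme" (structure) and S and M :: "('r, 'm, 'd) module_scheme"
begin

abbreviation fr :: "'m \<Rightarrow> 'r \<Rightarrow> ('m \<times> 'r) set" where
  "fr \<equiv> frac R S M"

abbreviation L :: "(('r \<times> 'r) set, ('m \<times> 'r) set) module" where
  "L \<equiv> localisation R S M"

lemma mem_frac:
  assumes "m \<in> carrier M" "s \<in> S"
  shows "(n, t) \<in> fr m s \<longleftrightarrow> n \<in> carrier M \<and> t \<in> S \<and>
    (\<exists>u\<in>S. (u \<otimes> t) \<odot>\<^bsub>M\<^esub> m = (u \<otimes> s) \<odot>\<^bsub>M\<^esub> n)"
  using assms in_carrier by (auto simp: frac_def smult_assoc1)

lemma frac_refl: "\<lbrakk>m \<in> carrier M; s \<in> S\<rbrakk> \<Longrightarrow> (m, s) \<in> fr m s"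
  using one_in by (auto simp: mem_frac)

text \<open>Without cancellation in \<open>M\<close>, the two equations combine only after
  multiplication by the middle denominator, so the witness for the composite is
  \<open>u \<otimes> w \<otimes> t\<close>.\<close>

lemma frac_trans:
  assumes m: "m \<in> carrier M" "s \<in> S" and n: "n \<in> carrier M" "t \<in> S" and l: "l \<in> carrier M" "v \<in> S"
    and u: "u \<in> S" "(u \<otimes> t) \<odot>\<^bsub>M\<^esub> m = (u \<otimes> s) \<odot>\<^bsub>M\<^esub> n"
    and w: "w \<in> S" "(w \<otimes> v) \<odot>\<^bsub>M\<^esub> n = (w \<otimes> t) \<odot>\<^bsub>M\<^esub> l"
  shows "((u \<otimes> w \<otimes> t) \<otimes> v) \<odot>\<^bsub>M\<^esub> m = ((u \<otimes> w \<otimes> t) \<otimes> s) \<odot>\<^bsub>M\<^esub> l"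
proof -
  note c = assms(1,3,5) assms(2,4,6)[THEN in_carrier] u(1)[THEN in_carrier] w(1)[THEN in_carrier]
  have "((u \<otimes> w \<otimes> t) \<otimes> v) \<odot>\<^bsub>M\<^esub> m = (w \<otimes> v) \<odot>\<^bsub>M\<^esub> ((u \<otimes> t) \<odot>\<^bsub>M\<^esub> m)"
    using c by (simp add: smult_assoc1[symmetric] m_ac)
  also have "\<dots> = (u \<otimes> s) \<odot>\<^bsub>M\<^esub> ((w \<otimes> v) \<odot>\<^bsub>M\<^esub> n)"
    unfolding u(2) using c by (simp add: smult_assoc1[symmetric] m_ac)
  also have "\<dots> = ((u \<otimes> w \<otimes> t) \<otimes> s) \<odot>\<^bsub>M\<^esub> l"
    unfolding w(2) using c by (simp add: smult_assoc1[symmetric] m_ac)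
  finally show ?thesis .
qed

lemma frac_eqI:
  assumes m: "m \<in> carrier M" "s \<in> S" and n: "n \<in> carrier M" "t \<in> S"
    and u: "u \<in> S" "(u \<otimes> t) \<odot>\<^bsub>M\<^esub> m = (u \<otimes> s) \<odot>\<^bsub>M\<^esub> n"
  shows "fr m s = fr n t"
proof -
  have "fr m' s' \<subseteq> fr n' t'"
    if c: "m' \<in> carrier M" "s' \<in> S" "n' \<in> carrier M" "t' \<in> S"
      "(u \<otimes> s') \<odot>\<^bsub>M\<^esub> n' = (u \<otimes> t') \<odot>\<^bsub>M\<^esub> m'" for m' s' n' t'
  proof
    fix z assume "z \<in> fr m' s'"
    moreover obtain l v where z: "z = (l, v)" by (cases z)
    ultimately obtain w where w: "w \<in> S" "(w \<otimes> v) \<odot>\<^bsub>M\<^esub> m' = (w \<otimes> s') \<odot>\<^bsub>M\<^esub> l"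
      and l: "l \<in> carrier M" "v \<in> S"
      using mem_frac[OF c(1,2)] by auto
    have "((u \<otimes> w \<otimes> s') \<otimes> v) \<odot>\<^bsub>M\<^esub> n' = ((u \<otimes> w \<otimes> s') \<otimes> t') \<odot>\<^bsub>M\<^esub> l"
      by (rule frac_trans[where n = m']) (use c l w u in auto)
    moreover have "u \<otimes> w \<otimes> s' \<in> S" using c w u mult_in by auto
    ultimately show "z \<in> fr n' t'" using c l z mem_frac[OF c(3,4)] by auto
  qed
  from this[of m s n t] this[of n t m s] show ?thesis using assms by auto
qed

lemma frac_eqI':
  assumes "m \<in> carrier M" "s \<in> S" "n \<in> carrier M" "t \<in> S" "t \<odot>\<^bsub>M\<^esub> m = s \<odot>\<^bsub>M\<^esub> n"
  shows "fr m s = fr n t"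
  by (rule frac_eqI[where u = \<one>]) (use assms in_carrier one_in in auto)

lemma frac_eqD:
  assumes "m \<in> carrier M" "s \<in> S" "n \<in> carrier M" "t \<in> S" "fr m s = fr n t"
  shows "\<exists>u\<in>S. (u \<otimes> t) \<odot>\<^bsub>M\<^esub> m = (u \<otimes> s) \<odot>\<^bsub>M\<^esub> n"
  using frac_refl[OF assms(3,4)] unfolding assms(5)[symmetric]
  by (simp add: mem_frac[OF assms(1,2)])

lemma frac_expand:
  assumes "m \<in> carrier M" "s \<in> S" "t \<in> S"
  shows "fr (t \<odot>\<^bsub>M\<^esub> m) (t \<otimes> s) = fr m s"
  by (rule frac_eqI') (use assms in_carrier mult_in in \<open>auto simp: smult_assoc1[symmetric] m_ac\<close>)

lemma frac_in: "\<lbrakk>m \<in> carrier M; s \<in> S\<rbrakk> \<Longrightarrow> fr m s \<in> carrier L"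
  by (auto simp: localisation_def)

lemma fracE:
  assumes "X \<in> carrier L"
  obtains m s where "m \<in> carrier M" "s \<in> S" "X = fr m s"
  using assms by (auto simp: localisation_def)

text \<open>Independence of the representatives: if \<open>u\<close> and \<open>v\<close> witness
  the two equivalences, then \<open>u \<otimes> v\<close> witnesses that of the sums, and the union
  defining the addition collapses.\<close>

lemma frac_add_gen:
  assumes m: "m \<in> carrier M" "s \<in> S" and n: "n \<in> carrier M" "t \<in> S"
  shows "fr m s \<oplus>\<^bsub>L\<^esub> fr n t = fr (t \<odot>\<^bsub>M\<^esub> m \<oplus>\<^bsub>M\<^esub> s \<odot>\<^bsub>M\<^esub> n) (s \<otimes> t)"
proof -
  have eq: "fr (t' \<odot>\<^bsub>M\<^esub> m' \<oplus>\<^bsub>M\<^esub> s' \<odot>\<^bsub>M\<^esub> n') (s' \<otimes> t') = fr (t \<odot>\<^bsub>M\<^esub> m \<oplus>\<^bsub>M\<^esub> s \<odot>\<^bsub>M\<^esub> n) (s \<otimes> t)"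
    if "(m', s') \<in> fr m s" "(n', t') \<in> fr n t" for m' s' n' t'
  proof -
    from that assms obtain u v where
      m': "m' \<in> carrier M" "s' \<in> S" and u: "u \<in> S" "(u \<otimes> s') \<odot>\<^bsub>M\<^esub> m = (u \<otimes> s) \<odot>\<^bsub>M\<^esub> m'" and
      n': "n' \<in> carrier M" "t' \<in> S" and v: "v \<in> S" "(v \<otimes> t') \<odot>\<^bsub>M\<^esub> n = (v \<otimes> t) \<odot>\<^bsub>M\<^esub> n'"
      by (auto simp: mem_frac)
    note c = m(1) n(1) m'(1) n'(1) in_carrier[OF m(2)] in_carrier[OF n(2)] in_carrier[OF m'(2)]
      in_carrier[OF n'(2)] in_carrier[OF u(1)] in_carrier[OF v(1)]
    show ?thesis
    proof (rule frac_eqI[where u = "u \<otimes> v"])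
      have "((u \<otimes> v) \<otimes> (s \<otimes> t)) \<odot>\<^bsub>M\<^esub> (t' \<odot>\<^bsub>M\<^esub> m' \<oplus>\<^bsub>M\<^esub> s' \<odot>\<^bsub>M\<^esub> n') =
         (v \<otimes> t \<otimes> t') \<odot>\<^bsub>M\<^esub> ((u \<otimes> s) \<odot>\<^bsub>M\<^esub> m') \<oplus>\<^bsub>M\<^esub> (u \<otimes> s \<otimes> s') \<odot>\<^bsub>M\<^esub> ((v \<otimes> t) \<odot>\<^bsub>M\<^esub> n')"
        using c by (simp add: smult_assoc1[symmetric] m_ac smult_r_distr)
      also have "\<dots> = ((u \<otimes> v) \<otimes> (s' \<otimes> t')) \<odot>\<^bsub>M\<^esub> (t \<odot>\<^bsub>M\<^esub> m \<oplus>\<^bsub>M\<^esub> s \<odot>\<^bsub>M\<^esub> n)"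
        unfolding u(2)[symmetric] v(2)[symmetric]
        using c by (simp add: smult_assoc1[symmetric] m_ac smult_r_distr)
      finally show "((u \<otimes> v) \<otimes> (s \<otimes> t)) \<odot>\<^bsub>M\<^esub> (t' \<odot>\<^bsub>M\<^esub> m' \<oplus>\<^bsub>M\<^esub> s' \<odot>\<^bsub>M\<^esub> n') = \<dots>" .
    qed (use c m(2) n(2) m'(2) n'(2) u(1) v(1) mult_in in auto)
  qed
  show ?thesis
    unfolding localisation_def by (simp, rule UN_pairs_const[OF frac_refl[OF m] frac_refl[OF n] eq])
qed

lemma frac_add:
  assumes m: "m \<in> carrier M" and n: "n \<in> carrier M" and s: "s \<in> S"
  shows "fr m s \<oplus>\<^bsub>L\<^esub> fr n s = fr (m \<oplus>\<^bsub>M\<^esub> n) s"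
  using frac_add_gen[OF m s n s] frac_expand[OF _ s s, of "m \<oplus>\<^bsub>M\<^esub> n"] assms in_carrier[OF s]
  by (simp add: smult_r_distr)

lemma frac_zero:
  assumes "s \<in> S"
  shows "\<zero>\<^bsub>L\<^esub> = fr \<zero>\<^bsub>M\<^esub> s"
proof -
  have "fr \<zero>\<^bsub>M\<^esub> \<one> = fr \<zero>\<^bsub>M\<^esub> s"
    by (rule frac_eqI') (use assms one_in in_carrier in auto)
  then show ?thesis by (simp add: localisation_def)
qed

text \<open>Over a common denominator, addition of fractions is addition of numerators, which
  reduces the axioms of the localisation to those of \<open>M\<close>.\<close>

lemma common_denominator:
  assumes "X \<in> carrier L" "Y \<in> carrier L"
  obtains m n s where "m \<in> carrier M" "n \<in> carrier M" "s \<in> S" "X = fr m s" "Y = fr n s"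
proof -
  obtain m s where X: "m \<in> carrier M" "s \<in> S" "X = fr m s" using assms(1) by (rule fracE)
  obtain n t where Y: "n \<in> carrier M" "t \<in> S" "Y = fr n t" using assms(2) by (rule fracE)
  show thesis
  proof (rule that)
    show "X = fr (t \<odot>\<^bsub>M\<^esub> m) (t \<otimes> s)" using X Y frac_expand by auto
    have "Y = fr (s \<odot>\<^bsub>M\<^esub> n) (s \<otimes> t)" using X Y frac_expand by auto
    then show "Y = fr (s \<odot>\<^bsub>M\<^esub> n) (t \<otimes> s)" using X Y in_carrier by (simp add: m_comm)
  qed (use X Y in_carrier mult_in in auto)
qed

lemma common_denominator3:
  assumes "X \<in> carrier L" "Y \<in> carrier L" "Z \<in> carrier L"
  obtains m n l s where "m \<in> carrier M" "n \<in> carrier M" "l \<in> carrier M" "s \<in> S"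
    "X = fr m s" "Y = fr n s" "Z = fr l s"
proof -
  obtain m n s where XY: "m \<in> carrier M" "n \<in> carrier M" "s \<in> S" "X = fr m s" "Y = fr n s"
    using assms(1,2) by (rule common_denominator)
  obtain l t where Z: "l \<in> carrier M" "t \<in> S" "Z = fr l t" using assms(3) by (rule fracE)
  show thesis
  proof (rule that)
    show "X = fr (t \<odot>\<^bsub>M\<^esub> m) (t \<otimes> s)" "Y = fr (t \<odot>\<^bsub>M\<^esub> n) (t \<otimes> s)" using XY Z frac_expand by auto
    have "Z = fr (s \<odot>\<^bsub>M\<^esub> l) (s \<otimes> t)" using XY Z frac_expand by auto
    then show "Z = fr (s \<odot>\<^bsub>M\<^esub> l) (t \<otimes> s)" using XY Z in_carrier by (simp add: m_comm)
  qed (use XY Z in_carrier mult_in in auto)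
qed

lemma localisation_abelian_group: "abelian_group L"
proof (rule abelian_groupI)
  fix X Y assume "X \<in> carrier L" "Y \<in> carrier L"
  then obtain m n s where XY: "m \<in> carrier M" "n \<in> carrier M" "s \<in> S" "X = fr m s" "Y = fr n s"
    by (rule common_denominator)
  then show "X \<oplus>\<^bsub>L\<^esub> Y \<in> carrier L" by (simp add: frac_add frac_in)
  show "X \<oplus>\<^bsub>L\<^esub> Y = Y \<oplus>\<^bsub>L\<^esub> X" using XY by (simp add: frac_add M.a_comm)
next
  fix X Y Z assume "X \<in> carrier L" "Y \<in> carrier L" "Z \<in> carrier L"
  then obtain m n l s where "m \<in> carrier M" "n \<in> carrier M" "l \<in> carrier M" "s \<in> S"
    "X = fr m s" "Y = fr n s" "Z = fr l s" by (rule common_denominator3)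
  then show "X \<oplus>\<^bsub>L\<^esub> Y \<oplus>\<^bsub>L\<^esub> Z = X \<oplus>\<^bsub>L\<^esub> (Y \<oplus>\<^bsub>L\<^esub> Z)" by (simp add: frac_add M.a_assoc)
next
  show "\<zero>\<^bsub>L\<^esub> \<in> carrier L" using frac_zero[OF one_in] frac_in[OF _ one_in] by auto
next
  fix X assume "X \<in> carrier L"
  then obtain m s where X: "m \<in> carrier M" "s \<in> S" "X = fr m s" by (rule fracE)
  then show "\<zero>\<^bsub>L\<^esub> \<oplus>\<^bsub>L\<^esub> X = X" by (simp add: frac_zero[OF X(2)] frac_add)
  have "fr (\<ominus>\<^bsub>M\<^esub> m) s \<oplus>\<^bsub>L\<^esub> X = \<zero>\<^bsub>L\<^esub>"
    using X by (simp add: frac_zero[OF X(2)] frac_add M.l_neg)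
  then show "\<exists>Y\<in>carrier L. Y \<oplus>\<^bsub>L\<^esub> X = \<zero>\<^bsub>L\<^esub>"
    using X by (intro bexI[of _ "fr (\<ominus>\<^bsub>M\<^esub> m) s"]) (auto simp: frac_in)
qed

lemma frac_smult:
  assumes r: "r \<in> carrier R" "s \<in> S" and m: "m \<in> carrier M" "t \<in> S"
  shows "frac R S (regular R) r s \<odot>\<^bsub>L\<^esub> fr m t = fr (r \<odot>\<^bsub>M\<^esub> m) (s \<otimes> t)"
proof -
  interpret RR: fraction_module R S "regular R"
    by (intro fraction_module.intro multiplicative_subset_axioms regular_module)
  have eq: "fr (r' \<odot>\<^bsub>M\<^esub> m') (s' \<otimes> t') = fr (r \<odot>\<^bsub>M\<^esub> m) (s \<otimes> t)"
    if "(r', s') \<in> RR.fr r s" "(m', t') \<in> fr m t" for r' s' m' t'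
  proof -
    from that assms obtain u v where
      r': "r' \<in> carrier R" "s' \<in> S" and u: "u \<in> S" "u \<otimes> s' \<otimes> r = u \<otimes> s \<otimes> r'" and
      m': "m' \<in> carrier M" "t' \<in> S" and v: "v \<in> S" "(v \<otimes> t') \<odot>\<^bsub>M\<^esub> m = (v \<otimes> t) \<odot>\<^bsub>M\<^esub> m'"
      by (auto simp: mem_frac RR.mem_frac)
    note c = r(1) m(1) r'(1) m'(1) in_carrier[OF r(2)] in_carrier[OF m(2)] in_carrier[OF r'(2)]
      in_carrier[OF m'(2)] in_carrier[OF u(1)] in_carrier[OF v(1)]
    show ?thesis
    proof (rule frac_eqI[where u = "u \<otimes> v"])
      have "((u \<otimes> v) \<otimes> (s \<otimes> t)) \<odot>\<^bsub>M\<^esub> (r' \<odot>\<^bsub>M\<^esub> m') = (u \<otimes> s \<otimes> r') \<odot>\<^bsub>M\<^esub> ((v \<otimes> t) \<odot>\<^bsub>M\<^esub> m')"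
        using c by (simp add: smult_assoc1[symmetric] m_ac)
      also have "\<dots> = ((u \<otimes> v) \<otimes> (s' \<otimes> t')) \<odot>\<^bsub>M\<^esub> (r \<odot>\<^bsub>M\<^esub> m)"
        unfolding u(2)[symmetric] v(2)[symmetric]
        using c by (simp add: smult_assoc1[symmetric] m_ac)
      finally show "((u \<otimes> v) \<otimes> (s \<otimes> t)) \<odot>\<^bsub>M\<^esub> (r' \<odot>\<^bsub>M\<^esub> m') = \<dots>" .
    qed (use c r(2) m(2) r'(2) m'(2) u(1) v(1) mult_in in auto)
  qed
  show ?thesis
    unfolding localisation_def
    by (simp, rule UN_pairs_const[OF RR.frac_refl[of r s] frac_refl[OF m] eq]) (use r in auto)
qed

end

text \<open>The scalars of the localised module are themselves fractions, of the regular module.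
  What holds for fractions in \<open>M\<close> is thereby available for scalars under the prefix
  \<open>RR\<close>.\<close>

sublocale multiplicative_subset \<subseteq> RR: fraction_module R S "regular R"
  by (intro fraction_module.intro multiplicative_subset_axioms regular_module)

context multiplicative_subset
begin

lemma localised_ring_mult:
  "X \<otimes>\<^bsub>localisation R S (regular R)\<^esub> Y = X \<odot>\<^bsub>localisation R S (regular R)\<^esub> Y"
  by (simp add: localisation_def)

lemma frac_mult:
  assumes "r \<in> carrier R" "s \<in> S" "m \<in> carrier R" "t \<in> S"
  shows "frac R S (regular R) r s \<otimes>\<^bsub>localisation R S (regular R)\<^esub> frac R S (regular R) m t =
    frac R S (regular R) (r \<otimes> m) (s \<otimes> t)"
  unfolding localised_ring_mult using RR.frac_smult[of r s m t] assms by simp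

lemma frac_one: "\<one>\<^bsub>localisation R S (regular R)\<^esub> = frac R S (regular R) \<one> \<one>"
  by (simp add: localisation_def)

lemma localised_cring: "cring (localisation R S (regular R))"
proof (rule cringI)
  show "abelian_group RR.L" by (rule RR.localisation_abelian_group)
  show "comm_monoid RR.L"
  proof (rule comm_monoidI)
    fix X Y assume "X \<in> carrier RR.L" "Y \<in> carrier RR.L"
    then obtain a b s where XY: "a \<in> carrier R" "b \<in> carrier R" "s \<in> S" "X = RR.fr a s" "Y = RR.fr b s"
      by (auto elim: RR.common_denominator)
    then show "X \<otimes>\<^bsub>RR.L\<^esub> Y \<in> carrier RR.L"
      using RR.frac_in mult_in by (simp add: frac_mult)
    show "X \<otimes>\<^bsub>RR.L\<^esub> Y = Y \<otimes>\<^bsub>RR.L\<^esub> X" using XY by (simp add: frac_mult m_comm)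
  next
    show "\<one>\<^bsub>RR.L\<^esub> \<in> carrier RR.L" using RR.frac_in[of \<one> \<one>] one_in by (simp add: frac_one)
  next
    fix X Y Z assume "X \<in> carrier RR.L" "Y \<in> carrier RR.L" "Z \<in> carrier RR.L"
    then obtain a b c s where "a \<in> carrier R" "b \<in> carrier R" "c \<in> carrier R" "s \<in> S"
      "X = RR.fr a s" "Y = RR.fr b s" "Z = RR.fr c s" by (auto elim: RR.common_denominator3)
    then show "X \<otimes>\<^bsub>RR.L\<^esub> Y \<otimes>\<^bsub>RR.L\<^esub> Z = X \<otimes>\<^bsub>RR.L\<^esub> (Y \<otimes>\<^bsub>RR.L\<^esub> Z)"
      using in_carrier mult_in by (simp add: frac_mult m_assoc)
  next
    fix X assume "X \<in> carrier RR.L"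
    then obtain a s where "a \<in> carrier R" "s \<in> S" "X = RR.fr a s" by (auto elim: RR.fracE)
    then show "\<one>\<^bsub>RR.L\<^esub> \<otimes>\<^bsub>RR.L\<^esub> X = X"
      using in_carrier one_in by (simp add: frac_mult frac_one)
  qed
next
  fix X Y Z assume "X \<in> carrier RR.L" "Y \<in> carrier RR.L" "Z \<in> carrier RR.L"
  then obtain a b c s where "a \<in> carrier R" "b \<in> carrier R" "c \<in> carrier R" "s \<in> S"
    "X = RR.fr a s" "Y = RR.fr b s" "Z = RR.fr c s" by (auto elim: RR.common_denominator3)
  then show "(X \<oplus>\<^bsub>RR.L\<^esub> Y) \<otimes>\<^bsub>RR.L\<^esub> Z = X \<otimes>\<^bsub>RR.L\<^esub> Z \<oplus>\<^bsub>RR.L\<^esub> Y \<otimes>\<^bsub>RR.L\<^esub> Z"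
    using in_carrier mult_in RR.frac_add by (simp add: frac_mult l_distr)
qed

end

lemma (in fraction_module) localised_module: "module (localisation R S (regular R)) L"
proof (rule moduleI)
  show "cring RR.L" by (rule localised_cring)
  show "abelian_group L" by (rule localisation_abelian_group)
next
  fix X Y assume "X \<in> carrier RR.L" "Y \<in> carrier L"
  then obtain a s m t where "a \<in> carrier R" "s \<in> S" "X = RR.fr a s" "m \<in> carrier M" "t \<in> S" "Y = fr m t"
    by (auto elim!: fracE RR.fracE)
  then show "X \<odot>\<^bsub>L\<^esub> Y \<in> carrier L"
    using mult_in by (auto simp: frac_smult intro!: frac_in)
next
  fix X X' Y assume "X \<in> carrier RR.L" "X' \<in> carrier RR.L" "Y \<in> carrier L"
  then obtain a b s m t where "a \<in> carrier R" "b \<in> carrier R" "s \<in> S" "X = RR.fr a s" "X' = RR.fr b s"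
    "m \<in> carrier M" "t \<in> S" "Y = fr m t"
    by (auto elim!: fracE elim: RR.common_denominator)
  then show "(X \<oplus>\<^bsub>RR.L\<^esub> X') \<odot>\<^bsub>L\<^esub> Y = X \<odot>\<^bsub>L\<^esub> Y \<oplus>\<^bsub>L\<^esub> X' \<odot>\<^bsub>L\<^esub> Y"
    using mult_in RR.frac_add by (auto simp: frac_smult frac_add smult_l_distr)
next
  fix X Y Y' assume "X \<in> carrier RR.L" "Y \<in> carrier L" "Y' \<in> carrier L"
  then obtain a s m n t where "a \<in> carrier R" "s \<in> S" "X = RR.fr a s"
    "m \<in> carrier M" "n \<in> carrier M" "t \<in> S" "Y = fr m t" "Y' = fr n t"
    by (auto elim!: RR.fracE elim: common_denominator)
  then show "X \<odot>\<^bsub>L\<^esub> (Y \<oplus>\<^bsub>L\<^esub> Y') = X \<odot>\<^bsub>L\<^esub> Y \<oplus>\<^bsub>L\<^esub> X \<odot>\<^bsub>L\<^esub> Y'"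
    using mult_in by (auto simp: frac_smult frac_add smult_r_distr)
next
  fix X X' Y assume "X \<in> carrier RR.L" "X' \<in> carrier RR.L" "Y \<in> carrier L"
  then obtain a b s m t where "a \<in> carrier R" "b \<in> carrier R" "s \<in> S" "X = RR.fr a s" "X' = RR.fr b s"
    "m \<in> carrier M" "t \<in> S" "Y = fr m t"
    by (auto elim!: fracE elim: RR.common_denominator)
  then show "(X \<otimes>\<^bsub>RR.L\<^esub> X') \<odot>\<^bsub>L\<^esub> Y = X \<odot>\<^bsub>L\<^esub> (X' \<odot>\<^bsub>L\<^esub> Y)"
    using mult_in in_carrier by (auto simp: frac_smult frac_mult smult_assoc1 m_assoc)
next
  fix Y assume "Y \<in> carrier L"
  then obtain m t where "m \<in> carrier M" "t \<in> S" "Y = fr m t" by (auto elim!: fracE)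
  then show "\<one>\<^bsub>RR.L\<^esub> \<odot>\<^bsub>L\<^esub> Y = Y"
    using one_in in_carrier by (auto simp: frac_smult frac_one)
qed

section \<open>Maps of finite rank\<close>

text \<open>The identity of \<open>M\<close> has finite rank iff \<open>M\<close> is finitely generated projective (dual basis lemma).\<close>

inductive finite_rank :: "('r, 'c) ring_scheme \<Rightarrow> ('r, 'm, 'd) module_scheme \<Rightarrow> ('m \<Rightarrow> 'm) \<Rightarrow> bool"
  for R :: "('r, 'c) ring_scheme" and M :: "('r, 'm, 'd) module_scheme" where
  zero: "finite_rank R M (\<lambda>a. \<zero>\<^bsub>M\<^esub>)"
| step: "\<lbrakk>f \<in> module_hom R M (regular R); x \<in> carrier M; finite_rank R M \<phi>\<rbrakk>
    \<Longrightarrow> finite_rank R M (\<lambda>a. f a \<odot>\<^bsub>M\<^esub> x \<oplus>\<^bsub>M\<^esub> \<phi> a)"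
| cong: "\<lbrakk>finite_rank R M \<phi>; \<And>a. a \<in> carrier M \<Longrightarrow> \<phi> a = \<psi> a\<rbrakk> \<Longrightarrow> finite_rank R M \<psi>"

lemma formD:
  assumes "f \<in> module_hom R M (regular R)"
  shows "a \<in> carrier M \<Longrightarrow> f a \<in> carrier R"
    and "\<lbrakk>a \<in> carrier M; b \<in> carrier M\<rbrakk> \<Longrightarrow> f (a \<oplus>\<^bsub>M\<^esub> b) = f a \<oplus>\<^bsub>R\<^esub> f b"
    and "\<lbrakk>r \<in> carrier R; a \<in> carrier M\<rbrakk> \<Longrightarrow> f (r \<odot>\<^bsub>M\<^esub> a) = r \<otimes>\<^bsub>R\<^esub> f a"
  using assms by (auto simp: module_hom_def)

lemma formI:
  assumes "\<And>a. a \<in> carrier M \<Longrightarrow> f a \<in> carrier R"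
    and "\<And>a b. \<lbrakk>a \<in> carrier M; b \<in> carrier M\<rbrakk> \<Longrightarrow> f (a \<oplus>\<^bsub>M\<^esub> b) = f a \<oplus>\<^bsub>R\<^esub> f b"
    and "\<And>r a. \<lbrakk>r \<in> carrier R; a \<in> carrier M\<rbrakk> \<Longrightarrow> f (r \<odot>\<^bsub>M\<^esub> a) = r \<otimes>\<^bsub>R\<^esub> f a"
  shows "f \<in> module_hom R M (regular R)"
  using assms by (auto simp: module_hom_def)

context module
begin

lemma form_zero: "f \<in> module_hom R M (regular R) \<Longrightarrow> f \<zero>\<^bsub>M\<^esub> = \<zero>"
  using formD(3)[of f R M \<zero> "\<zero>\<^bsub>M\<^esub>"] formD(1)[of f R M "\<zero>\<^bsub>M\<^esub>"] by simp

lemma form_finsum: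
  assumes f: "f \<in> module_hom R M (regular R)" and "finite I" "g \<in> I \<rightarrow> carrier M"
  shows "f (\<Oplus>\<^bsub>M\<^esub>i\<in>I. g i) = (\<Oplus>i\<in>I. f (g i))"
  using assms(2,3)
proof (induction I rule: finite_induct)
  case empty
  then show ?case using form_zero[OF f] by simp
next
  case (insert i I)
  then show ?case using formD[OF f] by (simp add: Pi_iff)
qed

lemma finite_rank_closed:
  assumes "finite_rank R M \<phi>" "a \<in> carrier M"
  shows "\<phi> a \<in> carrier M"
  using assms by induction (auto simp: formD(1))

text \<open>Together with \<open>finite_rank_smult\<close>, this makes the scalars \<open>s\<close>
  for which multiplication by \<open>s\<close> has finite rank an ideal of \<open>R\<close>.\<close>

lemma finite_rank_add:
  assumes "finite_rank R M \<phi>" "finite_rank R M \<psi>"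
  shows "finite_rank R M (\<lambda>a. \<phi> a \<oplus>\<^bsub>M\<^esub> \<psi> a)"
  using assms(1)
proof induction
  case zero
  show ?case by (rule cong[OF assms(2)]) (simp add: finite_rank_closed[OF assms(2)])
next
  case (step f x \<phi>)
  show ?case
    by (rule cong[OF finite_rank.step[OF step(1,2,4)]])
      (use step(1-3) assms(2) in \<open>simp add: formD(1) finite_rank_closed M.a_assoc\<close>)
next
  case (cong \<phi> \<phi>')
  show ?case by (rule finite_rank.cong[OF cong(3)]) (simp add: cong(2))
qed

lemma finite_rank_smult:
  assumes "finite_rank R M \<phi>" "r \<in> carrier R"
  shows "finite_rank R M (\<lambda>a. r \<odot>\<^bsub>M\<^esub> \<phi> a)"
  using assms(1)
proof induction
  case zero
  show ?case by (rule cong[OF finite_rank.zero]) (simp add: assms(2))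
next
  case (step f x \<phi>)
  have "(\<lambda>a. r \<otimes> f a) \<in> module_hom R M (regular R)"
    by (rule formI) (use assms(2) in \<open>simp_all add: formD[OF step(1)] r_distr m_lcomm\<close>)
  from finite_rank.step[OF this step(2,4)] show ?case
    by (rule cong)
      (use step(1-3) assms(2) in \<open>simp add: formD(1) finite_rank_closed smult_r_distr smult_assoc1\<close>)
next
  case (cong \<phi> \<phi>')
  show ?case by (rule finite_rank.cong[OF cong(3)]) (simp add: cong(2))
qed

lemma finite_rank_finsum:
  assumes "finite I" "\<And>i. i \<in> I \<Longrightarrow> f i \<in> module_hom R M (regular R)" "\<And>i. i \<in> I \<Longrightarrow> x i \<in> carrier M"
  shows "finite_rank R M (\<lambda>a. \<Oplus>\<^bsub>M\<^esub>i\<in>I. f i a \<odot>\<^bsub>M\<^esub> x i)"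
  using assms
proof (induction I rule: finite_induct)
  case empty
  show ?case by (rule cong[OF finite_rank.zero]) simp
next
  case (insert i I)
  have "finite_rank R M (\<lambda>a. f i a \<odot>\<^bsub>M\<^esub> x i \<oplus>\<^bsub>M\<^esub> (\<Oplus>\<^bsub>M\<^esub>i\<in>I. f i a \<odot>\<^bsub>M\<^esub> x i))"
    by (rule finite_rank.step) (use insert in auto)
  then show ?case
    by (rule cong) (use insert.hyps insert.prems formD(1)[OF insert.prems(1)] in \<open>simp add: Pi_iff\<close>)
qed

text \<open>Serves to extend an inclusion \<open>r \<odot> g \<in> N\<close> from generators
  \<open>g\<close> to the whole module; commutativity of \<open>R\<close> makes the preimage stable
  under scalars.\<close>

lemma submodule_vimage_smult:
  assumes "submodule R N M" "r \<in> carrier R"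
  shows "submodule R {a \<in> carrier M. r \<odot>\<^bsub>M\<^esub> a \<in> N} M"
proof -
  have "r \<odot>\<^bsub>M\<^esub> (c \<odot>\<^bsub>M\<^esub> v) = c \<odot>\<^bsub>M\<^esub> (r \<odot>\<^bsub>M\<^esub> v)" if "c \<in> carrier R" "v \<in> carrier M" for c v
    using that assms(2) by (simp add: smult_assoc1[symmetric] m_comm)
  then show ?thesis using assms by (auto simp: submodule_def smult_r_distr)
qed

text \<open>Independence is stated for the finite set \<open>X\<close> alone, as vanishing of
  coefficients, which is the shape in which the arguments on relations deliver it.\<close>

lemma lincomb_unique:
  assumes X: "finite X" "X \<subseteq> carrier M"
    and indep: "\<And>c. \<lbrakk>c \<in> X \<rightarrow> carrier R; lincomb c X = \<zero>\<^bsub>M\<^esub>\<rbrakk> \<Longrightarrow> \<forall>x\<in>X. c x = \<zero>"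
    and c: "c \<in> X \<rightarrow> carrier R" "d \<in> X \<rightarrow> carrier R" "lincomb c X = lincomb d X" and x: "x \<in> X"
  shows "c x = d x"
proof -
  have "lincomb (\<lambda>x. c x \<ominus> d x) X = \<zero>\<^bsub>M\<^esub>"
    using lincomb_diff[OF X c(1,2)] c lincomb_closed[OF X(2) c(2)] by simp
  moreover have "(\<lambda>x. c x \<ominus> d x) \<in> X \<rightarrow> carrier R" using c by auto
  ultimately have "c x \<ominus> d x = \<zero>" using indep x by auto
  then show ?thesis using c x by (auto simp: Pi_iff)
qed

text \<open>Independence makes the coefficients of \<open>s \<odot> a\<close> over \<open>X\<close>
  unique. Uniqueness forces them to be linear in \<open>a\<close>, so the coefficient functions are
  the linear forms of an expression of finite rank.\<close>

lemma finite_rank_smult_of_independent: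
  assumes X: "finite X" "X \<subseteq> carrier M" and s: "s \<in> carrier R"
    and indep: "\<And>c. \<lbrakk>c \<in> X \<rightarrow> carrier R; lincomb c X = \<zero>\<^bsub>M\<^esub>\<rbrakk> \<Longrightarrow> \<forall>x\<in>X. c x = \<zero>"
    and span: "\<And>a. a \<in> carrier M \<Longrightarrow> s \<odot>\<^bsub>M\<^esub> a \<in> span X"
  shows "finite_rank R M (\<lambda>a. s \<odot>\<^bsub>M\<^esub> a)"
proof -
  have "\<forall>a\<in>carrier M. \<exists>c. c \<in> X \<rightarrow> carrier R \<and> lincomb c X = s \<odot>\<^bsub>M\<^esub> a"
    using finite_in_span[OF X span] by blast
  then obtain C where C: "\<And>a. a \<in> carrier M \<Longrightarrow> C a \<in> X \<rightarrow> carrier R"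
    and LC: "\<And>a. a \<in> carrier M \<Longrightarrow> lincomb (C a) X = s \<odot>\<^bsub>M\<^esub> a" by metis
  have Cc: "C a x \<in> carrier R" if "a \<in> carrier M" "x \<in> X" for a x using C that by auto
  have "(\<lambda>a. C a x) \<in> module_hom R M (regular R)" if x: "x \<in> X" for x
  proof (rule formI)
    fix a b assume ab: "a \<in> carrier M" "b \<in> carrier M"
    show "C (a \<oplus>\<^bsub>M\<^esub> b) x = C a x \<oplus> C b x"
    proof (rule lincomb_unique[OF X indep _ _ _ x])
      show "lincomb (C (a \<oplus>\<^bsub>M\<^esub> b)) X = lincomb (\<lambda>x. C a x \<oplus> C b x) X"
        using ab lincomb_sum[OF X C C] by (simp add: LC smult_r_distr s)
    qed (use ab Cc in auto)
  next
    fix r a assume ra: "r \<in> carrier R" "a \<in> carrier M"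
    show "C (r \<odot>\<^bsub>M\<^esub> a) x = r \<otimes> C a x"
    proof (rule lincomb_unique[OF X indep _ _ _ x])
      show "lincomb (C (r \<odot>\<^bsub>M\<^esub> a)) X = lincomb (\<lambda>x. r \<otimes> C a x) X"
        using ra lincomb_smult[OF X(2) C, of a r]
        by (simp add: LC smult_assoc1[symmetric] s m_comm)
    qed (use ra Cc in auto)
  qed (use x Cc in auto)
  then have "finite_rank R M (\<lambda>a. \<Oplus>\<^bsub>M\<^esub>x\<in>X. C a x \<odot>\<^bsub>M\<^esub> x)"
    by (intro finite_rank_finsum) (use X in auto)
  then show ?thesis by (rule cong) (use LC in \<open>simp add: lincomb_def\<close>)
qed

end

section \<open>Descent of a basis from a localisation\<close>

context fraction_module
begin

lemma frac_finsum:
  assumes "finite I" "h \<in> I \<rightarrow> carrier M" "s \<in> S"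
  shows "(\<Oplus>\<^bsub>L\<^esub>i\<in>I. fr (h i) s) = fr (\<Oplus>\<^bsub>M\<^esub>i\<in>I. h i) s"
proof -
  interpret LL: abelian_group L by (rule localisation_abelian_group)
  from assms show ?thesis
  proof (induction I rule: finite_induct)
    case empty
    then show ?case by (simp add: frac_zero)
  next
    case (insert i I)
    then show ?case by (simp add: frac_add frac_in Pi_iff)
  qed
qed

text \<open>The generators \<open>G\<close> involve only finitely many basis elements. Their
  numerators \<open>X\<close> are independent over \<open>R\<close>, and since \<open>G\<close> is
  finite a single denominator \<open>s\<close> brings all of \<open>s M\<close> into the span of
  \<open>X\<close>.\<close>

lemma finite_rank_of_free_localisation:
  assumes "domain R" "\<zero> \<notin> S" and G: "finite G" "G \<subseteq> carrier M" "span G = carrier M"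
    and "free_module (localisation R S (regular R)) L"
  shows "\<exists>s\<in>S. finite_rank R M (\<lambda>a. s \<odot>\<^bsub>M\<^esub> a)"
proof -
  interpret domain R by fact
  interpret LL: module RR.L L by (rule localised_module)
  obtain B where B: "B \<subseteq> carrier L" "\<not> LL.lin_dep B" "LL.span B = carrier L"
    using assms(6) by (auto simp: free_module_def is_basis_def)
  have "\<forall>g\<in>G. \<exists>A. finite A \<and> A \<subseteq> B \<and> fr g \<one> \<in> LL.span A"
  proof
    fix g assume "g \<in> G"
    then have "fr g \<one> \<in> LL.span B" using B(3) frac_in one_in G by auto
    then obtain A a where "finite A" "A \<subseteq> B" "a \<in> A \<rightarrow> carrier RR.L" "fr g \<one> = LL.lincomb a A"
      unfolding LL.span_def by auto
    then show "\<exists>A. finite A \<and> A \<subseteq> B \<and> fr g \<one> \<in> LL.span A" unfolding LL.span_def by blast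
  qed
  then obtain A where A: "\<And>g. g \<in> G \<Longrightarrow> finite (A g) \<and> A g \<subseteq> B \<and> fr g \<one> \<in> LL.span (A g)" by metis
  \<comment> \<open>The basis \<open>B\<close> is not known to be finite; only the part that
    expresses the generators is kept.\<close>
  define B' where "B' = (\<Union>g\<in>G. A g)"
  have B': "finite B'" "B' \<subseteq> B" "\<And>g. g \<in> G \<Longrightarrow> fr g \<one> \<in> LL.span B'"
    using A G(1) LL.span_is_monotone[of "A _" B'] unfolding B'_def by blast+
  have "\<forall>b\<in>B'. \<exists>m s. m \<in> carrier M \<and> s \<in> S \<and> b = fr m s" using B'(2) B(1) by (auto elim!: fracE)
  then obtain num den where nd: "\<And>b. b \<in> B' \<Longrightarrow> num b \<in> carrier M \<and> den b \<in> S \<and> b = fr (num b) (den b)"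
    by metis
  define X where "X = num ` B'"
  have X: "finite X" "X \<subseteq> carrier M" using B' nd by (auto simp: X_def)
  interpret SX: submodule R "span X" M using span_is_submodule[OF X(2)] .
  \<comment> \<open>The fractions with numerator in \<open>span X\<close> form a submodule
    containing \<open>B'\<close>, hence the images of all generators. A multiple of each generator
    by an element of \<open>S\<close> therefore lies in \<open>span X\<close>.\<close>
  define W where "W = {fr m s | m s. m \<in> span X \<and> s \<in> S}"
  have WI: "fr m s \<in> W" if "m \<in> span X" "s \<in> S" for m s using that unfolding W_def by blast
  have WE: "\<exists>m s. m \<in> span X \<and> m \<in> carrier M \<and> s \<in> S \<and> v = fr m s" if "v \<in> W" for v
    using that SX.subset unfolding W_def by blast
  have "submodule RR.L W L"
  proof (rule submodule.intro)
    show "module RR.L L" by (rule localised_module)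
    show "W \<subseteq> carrier L" using SX.subset frac_in unfolding W_def by blast
    show "\<zero>\<^bsub>L\<^esub> \<in> W" unfolding frac_zero[OF one_in] by (rule WI) (simp_all add: one_in)
  next
    fix v w assume "v \<in> W" "w \<in> W"
    with WE obtain m s n t where m: "m \<in> span X" "m \<in> carrier M" "s \<in> S"
      and n: "n \<in> span X" "n \<in> carrier M" "t \<in> S" and vw: "v = fr m s" "w = fr n t"
      by metis
    show "v \<oplus>\<^bsub>L\<^esub> w \<in> W"
      unfolding vw frac_add_gen[OF m(2,3) n(2,3)]
      by (rule WI) (use m n in_carrier mult_in in \<open>auto intro: SX.m_closed SX.smult_closed\<close>)
  next
    fix c v assume "c \<in> carrier RR.L" "v \<in> W"
    with WE obtain m t where m: "m \<in> span X" "m \<in> carrier M" "t \<in> S" and v: "v = fr m t" by metis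
    obtain r s where r: "r \<in> carrier R" "s \<in> S" and c: "c = RR.fr r s"
      using \<open>c \<in> carrier RR.L\<close> by (auto elim!: RR.fracE)
    show "c \<odot>\<^bsub>L\<^esub> v \<in> W"
      unfolding v c frac_smult[OF r m(2,3)] by (rule WI) (use m r mult_in in auto)
  qed
  moreover have "B' \<subseteq> W"
  proof
    fix b assume b: "b \<in> B'"
    then have "num b \<in> span X" using in_own_span[OF X(2)] by (auto simp: X_def)
    then show "b \<in> W" using WI nd[OF b] by metis
  qed
  ultimately have "LL.span B' \<subseteq> W" by (rule LL.span_is_subset[rotated])
  then have W: "fr g \<one> \<in> W" if "g \<in> G" for g using B'(3) that by auto
  have "\<forall>g\<in>G. \<exists>t\<in>S. t \<odot>\<^bsub>M\<^esub> g \<in> span X"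
  proof
    fix g assume g: "g \<in> G"
    then obtain m s where m: "m \<in> span X" "m \<in> carrier M" "s \<in> S" "fr g \<one> = fr m s" using W WE by metis
    then obtain u where u: "u \<in> S" "(u \<otimes> s) \<odot>\<^bsub>M\<^esub> g = (u \<otimes> \<one>) \<odot>\<^bsub>M\<^esub> m"
      using frac_eqD[of g \<one> m s] g G one_in by auto
    moreover have "(u \<otimes> \<one>) \<odot>\<^bsub>M\<^esub> m \<in> span X" using u m in_carrier by auto
    ultimately show "\<exists>t\<in>S. t \<odot>\<^bsub>M\<^esub> g \<in> span X" using mult_in m by metis
  qed
  then obtain t where t: "\<And>g. g \<in> G \<Longrightarrow> t g \<in> S \<and> t g \<odot>\<^bsub>M\<^esub> g \<in> span X" by metis
  obtain s where s: "s \<in> S" "\<forall>g\<in>G. \<exists>u\<in>S. s = u \<otimes> t g"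
    using common_multiple[OF G(1), of t] t by auto
  have "s \<odot>\<^bsub>M\<^esub> g \<in> span X" if g: "g \<in> G" for g
  proof -
    obtain u where u: "u \<in> S" "s = u \<otimes> t g" using s g by auto
    then have "s \<odot>\<^bsub>M\<^esub> g = u \<odot>\<^bsub>M\<^esub> (t g \<odot>\<^bsub>M\<^esub> g)" using g G t in_carrier by (auto simp: smult_assoc1)
    then show ?thesis using t g u in_carrier by auto
  qed
  then have "span G \<subseteq> {a \<in> carrier M. s \<odot>\<^bsub>M\<^esub> a \<in> span X}"
    by (intro span_is_subset submodule_vimage_smult SX.submodule_axioms) (use G s in_carrier in auto)
  then have spanX: "s \<odot>\<^bsub>M\<^esub> a \<in> span X" if "a \<in> carrier M" for a using G(3) that by auto
  have indep: "\<forall>x\<in>X. c x = \<zero>" if c: "c \<in> X \<rightarrow> carrier R" "lincomb c X = \<zero>\<^bsub>M\<^esub>" for c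
  proof (rule ccontr)
    assume "\<not> (\<forall>x\<in>X. c x = \<zero>)"
    then obtain x where x: "x \<in> X" "c x \<noteq> \<zero>" by auto
    \<comment> \<open>Several basis elements may share a numerator; \<open>b\<close> selects one for
      each numerator and is therefore injective on \<open>X\<close>.\<close>
    define b where "b = inv_into B' num"
    have b: "b y \<in> B'" "num (b y) = y" if "y \<in> X" for y
      using that unfolding b_def X_def by (auto intro: inv_into_into f_inv_into_f)
    have den: "den (b y) \<in> S" "b y = fr y (den (b y))" "b y \<in> carrier L" if "y \<in> X" for y
      using nd[OF b(1)[OF that]] b(2)[OF that] b(1)[OF that] B' B by auto
    have inj: "inj_on b X" using b(2) by (metis inj_onI)
    \<comment> \<open>The factor \<open>den v\<close> cancels the denominator of the basis element
      \<open>v\<close>, so that the relation \<open>c\<close> among the numerators becomes a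
      relation among basis elements.\<close>
    define a where "a v = RR.fr (c (num v) \<otimes> den v) \<one>" for v
    have ac: "a \<in> b ` X \<rightarrow> carrier RR.L"
    proof -
      have "c y \<otimes> den (b y) \<in> carrier R" if "y \<in> X" for y
        using that c in_carrier[OF den(1)[OF that]] by auto
      then show ?thesis using b one_in by (auto simp: a_def intro!: RR.frac_in)
    qed
    have "LL.lincomb a (b ` X) = (\<Oplus>\<^bsub>L\<^esub>y\<in>X. a (b y) \<odot>\<^bsub>L\<^esub> b y)"
      unfolding LL.lincomb_def using inj den(3) ac
      by (subst LL.M.finsum_reindex) (auto simp: Pi_iff)
    also have "\<dots> = (\<Oplus>\<^bsub>L\<^esub>y\<in>X. fr (c y \<odot>\<^bsub>M\<^esub> y) \<one>)"
    proof (rule LL.M.finsum_cong')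
      fix y assume y: "y \<in> X"
      note cs = in_carrier[OF den(1)[OF y]] subsetD[OF X(2) y]
      have cy: "c y \<in> carrier R" using c y by auto
      have "a (b y) \<odot>\<^bsub>L\<^esub> b y = fr ((c y \<otimes> den (b y)) \<odot>\<^bsub>M\<^esub> y) (\<one> \<otimes> den (b y))"
        unfolding a_def b(2)[OF y] by (subst (2) den(2)[OF y], rule frac_smult)
          (use cs cy y den one_in in auto)
      also have "\<dots> = fr (c y \<odot>\<^bsub>M\<^esub> y) \<one>"
        by (rule frac_eqI') (use cs cy y den one_in in \<open>auto simp: smult_assoc1[symmetric] m_comm\<close>)
      finally show "a (b y) \<odot>\<^bsub>L\<^esub> b y = fr (c y \<odot>\<^bsub>M\<^esub> y) \<one>" .
    qed (use X c one_in in \<open>auto intro!: frac_in\<close>)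
    also have "\<dots> = fr (lincomb c X) \<one>"
      unfolding lincomb_def by (rule frac_finsum) (use X c one_in in auto)
    also have "\<dots> = \<zero>\<^bsub>L\<^esub>" using c frac_zero[OF one_in] by simp
    finally have "LL.lincomb a (b ` X) = \<zero>\<^bsub>L\<^esub>" .
    moreover have "a (b x) \<noteq> \<zero>\<^bsub>RR.L\<^esub>"
    proof
      assume "a (b x) = \<zero>\<^bsub>RR.L\<^esub>"
      then have eq: "RR.fr (c x \<otimes> den (b x)) \<one> = RR.fr \<zero> \<one>"
        using RR.frac_zero[OF one_in] b(2)[OF x(1)] by (simp add: a_def)
      have cx: "c x \<in> carrier R" "den (b x) \<noteq> \<zero>" "den (b x) \<in> carrier R"
        using c x den(1)[OF x(1)] in_carrier assms(2) by auto
      then obtain u where "u \<in> S" "u \<in> carrier R" "u \<otimes> (c x \<otimes> den (b x)) = \<zero>"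
        using RR.frac_eqD[OF _ one_in _ one_in eq] in_carrier by auto
      then show False using cx x assms(2) by (auto simp: integral_iff)
    qed
    moreover have "b ` X \<subseteq> B" using b(1) B'(2) by auto
    ultimately show False
      using LL.lin_dep_crit[of "b ` X" B a "b x"] X(1) ac x B(2) by auto
  qed
  show ?thesis
    using finite_rank_smult_of_independent[OF X in_carrier[OF s(1)] indep spanX] s by auto
qed

end

section \<open>From local to global finite rank\<close>

lemma (in noetherian_ring) exists_maximalideal:
  assumes "ideal I R" "\<one> \<notin> I"
  shows "\<exists>P. maximalideal P R \<and> I \<subseteq> P"
proof -
  define C where "C = {J. ideal J R \<and> I \<subseteq> J \<and> \<one> \<notin> J}"
  have "\<exists>P\<in>C. \<forall>J\<in>C. P \<subseteq> J \<longrightarrow> J = P"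
  proof (rule subset_Zorn_nonempty)
    show "C \<noteq> {}" using assms by (auto simp: C_def)
    fix D assume D: "D \<noteq> {}" "subset.chain C D"
    then have "subset.chain {I. ideal I R} D" by (auto simp: subset.chain_def C_def)
    \<comment> \<open>In a noetherian ring a nonempty chain of ideals contains its union, so the
      upper bound demanded by Zorn's lemma is a member of the chain.\<close>
    then have "\<Union>D \<in> D" using D(1) by (intro ideal_chain_is_trivial)
    then show "\<Union>D \<in> C" using D(2) by (auto simp: subset.chain_def)
  qed
  then obtain P where P: "P \<in> C" "\<And>J. J \<in> C \<Longrightarrow> P \<subseteq> J \<Longrightarrow> J = P" by auto
  have "maximalideal P R"
  proof (rule maximalidealI)
    show "ideal P R" "carrier R \<noteq> P" using P(1) by (auto simp: C_def)
    fix J assume J: "ideal J R" "P \<subseteq> J" "J \<subseteq> carrier R"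
    show "J = P \<or> J = carrier R"
    proof (cases "\<one> \<in> J")
      case True
      then show ?thesis using ideal.one_imp_carrier[OF J(1)] by auto
    next
      case False
      then show ?thesis using P J by (auto simp: C_def)
    qed
  qed
  then show ?thesis using P(1) by (auto simp: C_def)
qed

lemma (in primeideal) complement_multiplicative_subset:
  assumes "cring R"
  shows "multiplicative_subset R (carrier R - I)"
proof -
  interpret cring R by fact
  show ?thesis
  proof unfold_locales
    show "\<one> \<in> carrier R - I" using one_imp_carrier I_notcarr by auto
  qed (use I_prime in auto)
qed

text \<open>The scalars \<open>s\<close> for which multiplication by \<open>s\<close> has finite
  rank form an ideal \<open>J\<close>. At a maximal ideal, the free localisation produces an element
  of \<open>J\<close> outside it; so \<open>J\<close> lies in no maximal ideal and contains
  \<open>\<one>\<close>.\<close>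

lemma finite_rank_id_of_fg_locally_free:
  fixes R (structure)
  assumes "noetherian_domain R" "fg_locally_free R M"
  shows "finite_rank R M (\<lambda>a. a)"
proof -
  interpret noetherian_domain R by fact
  have add_group: "group (add_monoid R)" by (rule a_group)
  interpret module R M using assms(2) by (simp add: fg_locally_free_def)
  obtain G where G: "finite G" "G \<subseteq> carrier M" "span G = carrier M"
    using assms(2) by (auto simp: fg_locally_free_def finitely_generated_def)
  define J where "J = {s \<in> carrier R. finite_rank R M (\<lambda>a. s \<odot>\<^bsub>M\<^esub> a)}"
  have J: "ideal J R"
  proof (rule idealI)
    show "ring R" ..
    show "subgroup J (add_monoid R)"
    proof (rule group.subgroupI[OF add_group])
      show "J \<noteq> {}" using finite_rank.cong[OF finite_rank.zero, of M "\<lambda>a. \<zero> \<odot>\<^bsub>M\<^esub> a" R] by (auto simp: J_def)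
    next
      fix s assume s: "s \<in> J"
      then have "finite_rank R M (\<lambda>a. (\<ominus> \<one>) \<odot>\<^bsub>M\<^esub> (s \<odot>\<^bsub>M\<^esub> a))"
        by (simp add: J_def finite_rank_smult)
      then have "finite_rank R M (\<lambda>a. (\<ominus> s) \<odot>\<^bsub>M\<^esub> a)"
        by (rule finite_rank.cong) (use s in \<open>auto simp: J_def smult_assoc1[symmetric] l_minus\<close>)
      then show "inv\<^bsub>add_monoid R\<^esub> s \<in> J" using s by (auto simp: J_def a_inv_def[symmetric])
    next
      fix s t assume st: "s \<in> J" "t \<in> J"
      then have "finite_rank R M (\<lambda>a. s \<odot>\<^bsub>M\<^esub> a \<oplus>\<^bsub>M\<^esub> t \<odot>\<^bsub>M\<^esub> a)"
        by (intro finite_rank_add) (auto simp: J_def)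
      then have "finite_rank R M (\<lambda>a. (s \<oplus> t) \<odot>\<^bsub>M\<^esub> a)"
        by (rule finite_rank.cong) (use st in \<open>auto simp: J_def smult_l_distr\<close>)
      then show "s \<otimes>\<^bsub>add_monoid R\<^esub> t \<in> J" using st by (auto simp: J_def)
    qed (auto simp: J_def)
    fix s r assume s: "s \<in> J" "r \<in> carrier R"
    then have "finite_rank R M (\<lambda>a. r \<odot>\<^bsub>M\<^esub> (s \<odot>\<^bsub>M\<^esub> a))"
      by (simp add: J_def finite_rank_smult)
    then have "finite_rank R M (\<lambda>a. (r \<otimes> s) \<odot>\<^bsub>M\<^esub> a)"
      by (rule finite_rank.cong) (use s in \<open>auto simp: J_def smult_assoc1\<close>)
    then show "r \<otimes> s \<in> J" "s \<otimes> r \<in> J" using s by (auto simp: J_def m_comm)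
  qed
  have "\<one> \<in> J"
  proof (rule ccontr)
    assume "\<one> \<notin> J"
    then obtain P where "maximalideal P R" and JP: "J \<subseteq> P" using exists_maximalideal[OF J] by auto
    then have P: "primeideal P R" by (intro maximalideal_prime)
    interpret P: primeideal P R by (rule P)
    interpret S: multiplicative_subset R "carrier R - P"
      by (rule P.complement_multiplicative_subset) (rule is_cring)
    interpret F: fraction_module R "carrier R - P" M
      by (intro fraction_module.intro S.multiplicative_subset_axioms module_axioms)
    have "\<exists>s\<in>carrier R - P. finite_rank R M (\<lambda>a. s \<odot>\<^bsub>M\<^esub> a)"
      by (rule F.finite_rank_of_free_localisation[OF _ _ G])
        (use assms(2) P domain_axioms P.zero_closed in
          \<open>auto simp: fg_locally_free_def locally_free_def additive_subgroup.zero_closed P.additive_subgroup_axioms\<close>)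
    then show False using JP by (auto simp: J_def)
  qed
  then have "finite_rank R M (\<lambda>a. \<one> \<odot>\<^bsub>M\<^esub> a)" by (simp add: J_def)
  then show ?thesis by (rule finite_rank.cong) simp
qed

section \<open>Projective modules over a domain are locally free\<close>

text \<open>A Nakayama argument: the matrix with diagonal \<open>s\<close> minus
  \<open>\<epsilon>\<close> has a determinant congruent to the product of the \<open>s i\<close>
  modulo \<open>P\<close>, hence nonzero. Gaussian elimination replaces the determinant. The
  diagonal and the errors vary in the induction because eliminating one unknown changes
  both.\<close>

lemma (in domain) elimination:
  assumes "primeideal P R" "finite I"
    and "\<And>i. i \<in> I \<Longrightarrow> s i \<in> carrier R - P" "\<And>i. i \<in> I \<Longrightarrow> r i \<in> carrier R"
    and "\<And>i j. \<lbrakk>i \<in> I; j \<in> I\<rbrakk> \<Longrightarrow> \<epsilon> i j \<in> P"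
    and "\<And>i. i \<in> I \<Longrightarrow> s i \<otimes> r i = (\<Oplus>j\<in>I. \<epsilon> i j \<otimes> r j)"
  shows "\<forall>i\<in>I. r i = \<zero>"
  using assms(2-)
proof (induction I arbitrary: s \<epsilon> rule: finite_induct)
  case empty
  then show ?case by simp
next
  case (insert k I)
  interpret P: primeideal P R by fact
  have PR: "x \<in> carrier R" if "x \<in> P" for x using that P.a_subset by auto
  note eps = insert.prems(3) and epsR = PR[OF insert.prems(3)]
  have rR: "r i \<in> carrier R" if "i \<in> insert k I" for i using insert.prems(2) that by auto
  have sR: "s i \<in> carrier R" if "i \<in> insert k I" for i using insert.prems(1) that by auto
  define T where "T i = (\<Oplus>j\<in>I. \<epsilon> i j \<otimes> r j)" for i
  have T: "T i \<in> carrier R" if "i \<in> insert k I" for i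
    unfolding T_def using epsR rR that by (intro finsum_closed) auto
  have eq: "s i \<otimes> r i = \<epsilon> i k \<otimes> r k \<oplus> T i" if i: "i \<in> insert k I" for i
    unfolding insert.prems(4)[OF i] T_def
    using epsR rR i insert.hyps by (subst finsum_insert) auto
  \<comment> \<open>The pivot: the coefficient of \<open>r k\<close> in equation \<open>k\<close>
    once \<open>\<epsilon> k k\<close> has been moved to the left. It stays outside
    \<open>P\<close>, hence is nonzero.\<close>
  define t where "t = s k \<ominus> \<epsilon> k k"
  have tR: "t \<in> carrier R" using sR epsR by (auto simp: t_def)
  have tP: "t \<in> carrier R - P"
  proof -
    have "t \<notin> P"
    proof
      assume "t \<in> P"
      then have "t \<oplus> \<epsilon> k k \<in> P" using eps by (intro P.a_closed) auto
      moreover have "t \<oplus> \<epsilon> k k = s k" unfolding t_def using sR[OF insertI1] epsR[OF insertI1 insertI1] by algebra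
      ultimately show False using insert.prems(1)[of k] by auto
    qed
    then show ?thesis using tR by auto
  qed
  have tk: "t \<otimes> r k = T k"
  proof -
    have "t \<otimes> r k = s k \<otimes> r k \<ominus> \<epsilon> k k \<otimes> r k"
      unfolding t_def using sR[OF insertI1] epsR[OF insertI1 insertI1] rR[OF insertI1] by algebra
    also have "\<dots> = T k"
      unfolding eq[OF insertI1] using T[OF insertI1] epsR[OF insertI1 insertI1] rR[OF insertI1] by algebra
    finally show ?thesis .
  qed
  \<comment> \<open>Equation \<open>i\<close> is multiplied by the pivot and
    \<open>t \<otimes> r k\<close> is replaced by \<open>T k\<close>. The new diagonal remains
    outside the prime \<open>P\<close>, and the new errors remain in \<open>P\<close>.\<close>
  have "\<forall>i\<in>I. r i = \<zero>"
  proof (rule insert.IH[of "\<lambda>i. t \<otimes> s i" "\<lambda>i j. \<epsilon> i k \<otimes> \<epsilon> k j \<oplus> t \<otimes> \<epsilon> i j"])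
    fix i assume i: "i \<in> I"
    show "t \<otimes> s i \<in> carrier R - P"
      using P.I_prime[of t "s i"] tP insert.prems(1)[of i] i by auto
    show "r i \<in> carrier R" using rR i by auto
  next
    fix i j assume ij: "i \<in> I" "j \<in> I"
    show "\<epsilon> i k \<otimes> \<epsilon> k j \<oplus> t \<otimes> \<epsilon> i j \<in> P"
      using ij eps epsR tR by (intro P.a_closed P.I_l_closed) auto
  next
    fix i assume i: "i \<in> I"
    have "t \<otimes> s i \<otimes> r i = t \<otimes> (s i \<otimes> r i)" using tR sR[of i] rR[of i] i by (simp add: m_assoc)
    also have "\<dots> = \<epsilon> i k \<otimes> (t \<otimes> r k) \<oplus> t \<otimes> T i"
      unfolding eq[OF insertI2[OF i]] using tR rR[of k] epsR[of i k] T[of i] i by (simp add: r_distr m_lcomm)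
    also have "\<dots> = (\<Oplus>j\<in>I. \<epsilon> i k \<otimes> (\<epsilon> k j \<otimes> r j)) \<oplus> (\<Oplus>j\<in>I. t \<otimes> (\<epsilon> i j \<otimes> r j))"
      unfolding tk T_def using epsR rR tR i insert.hyps(1) by (simp add: finsum_rdistr)
    also have "\<dots> = (\<Oplus>j\<in>I. \<epsilon> i k \<otimes> (\<epsilon> k j \<otimes> r j) \<oplus> t \<otimes> (\<epsilon> i j \<otimes> r j))"
      using epsR rR tR i by (intro finsum_addf[symmetric]) auto
    also have "\<dots> = (\<Oplus>j\<in>I. (\<epsilon> i k \<otimes> \<epsilon> k j \<oplus> t \<otimes> \<epsilon> i j) \<otimes> r j)"
      using epsR rR tR i by (intro finsum_cong') (auto simp: l_distr m_assoc)
    finally show "t \<otimes> s i \<otimes> r i = \<dots>" .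
  qed
  moreover from this have "T k = \<zero>"
    unfolding T_def using epsR by (intro add.finprod_one_eqI) auto
  with tk have "r k = \<zero>"
    using integral_iff[OF tR rR[of k]] tP P.zero_closed by auto
  ultimately show ?case by auto
qed

section \<open>Consequences of a finite dual basis\<close>

context module
begin

lemma finite_rank_finite_span:
  assumes "finite_rank R M \<phi>"
  shows "\<exists>G. finite G \<and> G \<subseteq> carrier M \<and> (\<forall>a\<in>carrier M. \<phi> a \<in> span G)"
  using assms
proof induction
  case zero
  have "\<zero>\<^bsub>M\<^esub> \<in> span {}" using span_is_submodule[of "{}"] by (auto simp: submodule_def)
  then show ?case by (intro exI[of _ "{}"]) auto
next
  case (step f x \<phi>)
  then obtain G where G: "finite G" "G \<subseteq> carrier M" "\<And>a. a \<in> carrier M \<Longrightarrow> \<phi> a \<in> span G" by auto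
  interpret N: submodule R "span (insert x G)" M by (rule span_is_submodule) (use G step in auto)
  have x: "x \<in> span (insert x G)" using in_own_span[of "insert x G"] G step by auto
  have sub: "span G \<subseteq> span (insert x G)" by (rule span_is_monotone) auto
  show ?case
  proof (intro exI[of _ "insert x G"] conjI ballI)
    fix a assume a: "a \<in> carrier M"
    show "f a \<odot>\<^bsub>M\<^esub> x \<oplus>\<^bsub>M\<^esub> \<phi> a \<in> span (insert x G)"
      by (rule N.m_closed[OF N.smult_closed[OF formD(1)[OF step(1) a] x] subsetD[OF sub G(3)[OF a]]])
  qed (use G step(2) in auto)
next
  case (cong \<phi> \<psi>)
  then show ?case by auto
qed

text \<open>The value \<open>\<phi> a\<close> is a combination of fixed vectors with coefficients
  \<open>f a\<close>. For \<open>\<phi>\<close> the identity this says that linear forms separate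
  the points of \<open>M\<close>.\<close>

lemma finite_rank_vanish:
  assumes "finite_rank R M \<phi>" "a \<in> carrier M" "\<And>f. f \<in> module_hom R M (regular R) \<Longrightarrow> f a = \<zero>"
  shows "\<phi> a = \<zero>\<^bsub>M\<^esub>"
  using assms(1)
proof induction
  case (step f x \<phi>)
  then show ?case using assms(3)[OF step(1)] by simp
qed (use assms(2) in auto)

text \<open>Linear forms separate points, and in a domain \<open>r \<otimes> f a = \<zero>\<close>
  forces \<open>f a = \<zero>\<close>.\<close>

lemma torsion_free_of_finite_rank_id:
  assumes "domain R" "finite_rank R M (\<lambda>a. a)"
    and "r \<in> carrier R" "a \<in> carrier M" "r \<odot>\<^bsub>M\<^esub> a = \<zero>\<^bsub>M\<^esub>" "r \<noteq> \<zero>"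
  shows "a = \<zero>\<^bsub>M\<^esub>"
proof (rule finite_rank_vanish[OF assms(2,4)])
  interpret domain R by fact
  fix f assume f: "f \<in> module_hom R M (regular R)"
  then have "r \<otimes> f a = \<zero>" using assms(3-5) form_zero by (simp add: formD(3)[OF f, symmetric])
  then show "f a = \<zero>" using assms(3,4,6) formD(1)[OF f] by (auto simp: integral_iff)
qed

text \<open>As \<open>X\<close> may be dependent, linear coordinates cannot come from uniqueness.
  They come from \<open>\<phi>\<close>: for each vector \<open>z\<close> in its expression one
  combination of \<open>X\<close> equal to \<open>s \<odot> z\<close> is fixed, and the linear forms
  of \<open>\<phi>\<close> supply the dependence on \<open>a\<close>.\<close>

lemma finite_rank_coordinates:
  assumes "finite_rank R M \<phi>"
    and X: "finite X" "X \<subseteq> carrier M" and s: "s \<in> carrier R"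
    and span: "\<And>a. a \<in> carrier M \<Longrightarrow> s \<odot>\<^bsub>M\<^esub> a \<in> span X"
  shows "\<exists>f. (\<forall>x\<in>X. f x \<in> module_hom R M (regular R)) \<and>
    (\<forall>a\<in>carrier M. s \<odot>\<^bsub>M\<^esub> \<phi> a = lincomb (\<lambda>x. f x a) X)"
  using assms(1)
proof induction
  case zero
  have "(\<lambda>a. \<zero>) \<in> module_hom R M (regular R)" by (rule formI) auto
  moreover have "lincomb (\<lambda>x. \<zero>) X = \<zero>\<^bsub>M\<^esub>"
    unfolding lincomb_def using X by (intro M.add.finprod_one_eqI) auto
  ultimately show ?case using s by (intro exI[of _ "\<lambda>x a. \<zero>"]) auto
next
  case (step g z \<phi>)
  then obtain f where f: "\<And>x. x \<in> X \<Longrightarrow> f x \<in> module_hom R M (regular R)"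
    and sf: "\<And>a. a \<in> carrier M \<Longrightarrow> s \<odot>\<^bsub>M\<^esub> \<phi> a = lincomb (\<lambda>x. f x a) X" by auto
  obtain d where d: "d \<in> X \<rightarrow> carrier R" "lincomb d X = s \<odot>\<^bsub>M\<^esub> z"
    using finite_in_span[OF X span[OF step(2)]] by auto
  note g = formD[OF step(1)]
  show ?case
  proof (intro exI[of _ "\<lambda>x a. g a \<otimes> d x \<oplus> f x a"] conjI ballI)
    fix x assume x: "x \<in> X"
    note fx = formD[OF f[OF x]]
    have "d x \<in> carrier R" using d x by auto
    then show "(\<lambda>a. g a \<otimes> d x \<oplus> f x a) \<in> module_hom R M (regular R)"
      by (intro formI) (auto simp: g fx l_distr r_distr R.a_ac m_assoc)
  next
    fix a assume a: "a \<in> carrier M"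
    have fa: "(\<lambda>x. f x a) \<in> X \<rightarrow> carrier R" using formD(1)[OF f a] by auto
    have gd: "(\<lambda>x. g a \<otimes> d x) \<in> X \<rightarrow> carrier R" using g(1)[OF a] d by auto
    have "s \<odot>\<^bsub>M\<^esub> (g a \<odot>\<^bsub>M\<^esub> z \<oplus>\<^bsub>M\<^esub> \<phi> a) = g a \<odot>\<^bsub>M\<^esub> (s \<odot>\<^bsub>M\<^esub> z) \<oplus>\<^bsub>M\<^esub> s \<odot>\<^bsub>M\<^esub> \<phi> a"
      using a step(2,3) g(1) s
      by (simp add: smult_r_distr finite_rank_closed smult_assoc1[symmetric] m_comm)
    also have "\<dots> = lincomb (\<lambda>x. g a \<otimes> d x) X \<oplus>\<^bsub>M\<^esub> lincomb (\<lambda>x. f x a) X"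
      using sf[OF a] lincomb_smult[OF X(2) d(1) g(1)[OF a]] d(2) by simp
    also have "\<dots> = lincomb (\<lambda>x. g a \<otimes> d x \<oplus> f x a) X"
      by (rule lincomb_sum[symmetric]) (use X fa gd in auto)
    finally show "s \<odot>\<^bsub>M\<^esub> (g a \<odot>\<^bsub>M\<^esub> z \<oplus>\<^bsub>M\<^esub> \<phi> a) = \<dots>" .
  qed
next
  case (cong \<phi> \<psi>)
  then show ?case by auto
qed

end

text \<open>Torsion-freeness makes the passage from \<open>a\<close> to \<open>a/1\<close>
  injective, so a relation among the images of \<open>X\<close>, brought to a common denominator, is
  a relation in \<open>M\<close>. As \<open>s\<close> becomes invertible, the images also
  span.\<close>

lemma (in fraction_module) free_localisation_of_independent:
  assumes "domain R" "\<zero> \<notin> S"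
    and tf: "\<And>r a. \<lbrakk>r \<in> carrier R; a \<in> carrier M; r \<odot>\<^bsub>M\<^esub> a = \<zero>\<^bsub>M\<^esub>; r \<noteq> \<zero>\<rbrakk> \<Longrightarrow> a = \<zero>\<^bsub>M\<^esub>"
    and X: "finite X" "X \<subseteq> carrier M" and s: "s \<in> S"
    and indep: "\<And>c. \<lbrakk>c \<in> X \<rightarrow> carrier R; lincomb c X = \<zero>\<^bsub>M\<^esub>\<rbrakk> \<Longrightarrow> \<forall>x\<in>X. c x = \<zero>"
    and span: "\<And>a. a \<in> carrier M \<Longrightarrow> s \<odot>\<^bsub>M\<^esub> a \<in> span X"
  shows "free_module (localisation R S (regular R)) L"
proof -
  interpret domain R by fact
  interpret LL: module RR.L L by (rule localised_module)
  define j where "j x = fr x \<one>" for x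
  have jL: "j x \<in> carrier L" if "x \<in> carrier M" for x using that one_in frac_in by (auto simp: j_def)
  have zeroD: "a = \<zero>\<^bsub>M\<^esub>" if a: "a \<in> carrier M" "t \<in> S" "fr a t = \<zero>\<^bsub>L\<^esub>" for a t
  proof -
    have "fr a t = fr \<zero>\<^bsub>M\<^esub> \<one>" using a frac_zero[OF one_in] by simp
    then obtain u where u: "u \<in> S" "(u \<otimes> \<one>) \<odot>\<^bsub>M\<^esub> a = (u \<otimes> t) \<odot>\<^bsub>M\<^esub> \<zero>\<^bsub>M\<^esub>"
      using frac_eqD[of a t "\<zero>\<^bsub>M\<^esub>" \<one>] a one_in by auto
    then have "u \<odot>\<^bsub>M\<^esub> a = \<zero>\<^bsub>M\<^esub>" using in_carrier[OF u(1)] in_carrier[OF a(2)] by simp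
    then show ?thesis using tf[of u a] u in_carrier assms(2) a by auto
  qed
  have smul: "RR.fr r t \<odot>\<^bsub>L\<^esub> j x = fr (r \<odot>\<^bsub>M\<^esub> x) t" if "r \<in> carrier R" "t \<in> S" "x \<in> carrier M" for r t x
    unfolding j_def using frac_smult[OF that(1,2,3) one_in] in_carrier[OF that(2)] by simp
  have inj: "inj_on j X"
  proof (rule inj_onI)
    fix x y assume xy: "x \<in> X" "y \<in> X" "j x = j y"
    then obtain u where u: "u \<in> S" "u \<odot>\<^bsub>M\<^esub> x = u \<odot>\<^bsub>M\<^esub> y"
      using frac_eqD[of x \<one> y \<one>] X one_in in_carrier by (auto simp: j_def)
    have xyM: "x \<in> carrier M" "y \<in> carrier M" using xy X by auto
    have "u \<odot>\<^bsub>M\<^esub> (x \<ominus>\<^bsub>M\<^esub> y) = u \<odot>\<^bsub>M\<^esub> x \<ominus>\<^bsub>M\<^esub> u \<odot>\<^bsub>M\<^esub> y"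
      using xyM in_carrier[OF u(1)] by (simp add: M.minus_eq smult_r_distr smult_r_minus)
    also have "\<dots> = \<zero>\<^bsub>M\<^esub>" using u xyM in_carrier[OF u(1)] by simp
    finally have "x \<ominus>\<^bsub>M\<^esub> y = \<zero>\<^bsub>M\<^esub>"
      using tf[of u "x \<ominus>\<^bsub>M\<^esub> y"] u(1) xyM in_carrier assms(2) by auto
    then show "x = y" using xyM by simp
  qed
  have "\<not> LL.lin_dep (j ` X)"
  proof (rule LL.finite_lin_indpt2)
    show "finite (j ` X)" "j ` X \<subseteq> carrier L" using X jL by auto
    fix a assume a: "a \<in> j ` X \<rightarrow> carrier RR.L" "LL.lincomb a (j ` X) = \<zero>\<^bsub>L\<^esub>"
    then have "\<exists>r t. r \<in> carrier R \<and> t \<in> S \<and> a (j x) = RR.fr r t" if "x \<in> X" for x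
      using RR.fracE[of "a (j x)"] that by (metis Pi_mem imageI regular_simps(1))
    then obtain r t where rt: "\<And>x. x \<in> X \<Longrightarrow> r x \<in> carrier R \<and> t x \<in> S \<and> a (j x) = RR.fr (r x) (t x)"
      by metis
    obtain v where v: "v \<in> S" "\<forall>x\<in>X. \<exists>u\<in>S. v = u \<otimes> t x"
      using common_multiple[OF X(1), of t] rt by auto
    then obtain u where u: "\<And>x. x \<in> X \<Longrightarrow> u x \<in> S \<and> v = u x \<otimes> t x" by metis
    define c where "c x = u x \<otimes> r x" for x
    have c: "c \<in> X \<rightarrow> carrier R" using rt u in_carrier by (auto simp: c_def)
    have ac: "a (j x) = RR.fr (c x) v" if "x \<in> X" for x
      using RR.frac_expand[of "r x" "t x" "u x"] rt[OF that] u[OF that] by (simp add: c_def)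
    have "LL.lincomb a (j ` X) = (\<Oplus>\<^bsub>L\<^esub>x\<in>X. a (j x) \<odot>\<^bsub>L\<^esub> j x)"
      unfolding LL.lincomb_def using inj jL a X
      by (subst LL.M.finsum_reindex) (auto simp: Pi_iff)
    also have "\<dots> = (\<Oplus>\<^bsub>L\<^esub>x\<in>X. fr (c x \<odot>\<^bsub>M\<^esub> x) v)"
    proof (rule LL.M.finsum_cong')
      have cx: "c x \<in> carrier R" "x \<in> carrier M" if "x \<in> X" for x using c X that by auto
      show "(\<lambda>x. fr (c x \<odot>\<^bsub>M\<^esub> x) v) \<in> X \<rightarrow> carrier L" using cx v(1) by (auto intro!: frac_in)
      show "a (j x) \<odot>\<^bsub>L\<^esub> j x = fr (c x \<odot>\<^bsub>M\<^esub> x) v" if "x \<in> X" for x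
        unfolding ac[OF that] by (rule smul[OF cx(1)[OF that] v(1) cx(2)[OF that]])
    qed simp
    also have "\<dots> = fr (lincomb c X) v"
      unfolding lincomb_def by (rule frac_finsum) (use X c v in auto)
    finally have "lincomb c X = \<zero>\<^bsub>M\<^esub>" using a(2) zeroD[OF lincomb_closed[OF X(2) c] v(1)] by simp
    then have "\<forall>x\<in>X. c x = \<zero>" by (rule indep[OF c])
    then show "\<forall>w\<in>j ` X. a w = \<zero>\<^bsub>RR.L\<^esub>" using ac RR.frac_zero[OF v(1)] by auto
  qed
  moreover have "LL.span (j ` X) = carrier L"
  proof
    have jX: "j ` X \<subseteq> carrier L" using X jL by auto
    interpret N: submodule RR.L "LL.span (j ` X)" L by (rule LL.span_is_submodule[OF jX])
    show "LL.span (j ` X) \<subseteq> carrier L" by (rule N.subset)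
    have "submodule R {a \<in> carrier M. j a \<in> LL.span (j ` X)} M"
    proof (rule submodule.intro)
      show "module R M" by (rule module_axioms)
      show "\<zero>\<^bsub>M\<^esub> \<in> {a \<in> carrier M. j a \<in> LL.span (j ` X)}"
        using N.zero_closed frac_zero[OF one_in] by (simp add: j_def)
    next
      fix v w assume "v \<in> {a \<in> carrier M. j a \<in> LL.span (j ` X)}" "w \<in> {a \<in> carrier M. j a \<in> LL.span (j ` X)}"
      then show "v \<oplus>\<^bsub>M\<^esub> w \<in> {a \<in> carrier M. j a \<in> LL.span (j ` X)}"
        using N.m_closed[of "j v" "j w"] one_in by (auto simp: j_def frac_add)
    next
      fix c v assume "c \<in> carrier R" "v \<in> {a \<in> carrier M. j a \<in> LL.span (j ` X)}"
      then show "c \<odot>\<^bsub>M\<^esub> v \<in> {a \<in> carrier M. j a \<in> LL.span (j ` X)}"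
        using N.smult_closed[of "RR.fr c \<one>" "j v"] RR.frac_in[of c \<one>] smul[of c \<one> v] one_in
        by (auto simp: j_def)
    qed auto
    then have "span X \<subseteq> {a \<in> carrier M. j a \<in> LL.span (j ` X)}"
      by (rule span_is_subset[rotated]) (use X LL.in_own_span[OF jX] in auto)
    then have jspan: "j a \<in> LL.span (j ` X)" if "a \<in> span X" for a using that by auto
    show "carrier L \<subseteq> LL.span (j ` X)"
    proof
      fix Y assume "Y \<in> carrier L"
      then obtain m t where m: "m \<in> carrier M" "t \<in> S" "Y = fr m t" by (rule fracE)
      \<comment> \<open>The fraction \<open>m/t\<close> is \<open>1/(s t)\<close> times the image of
        \<open>s m\<close>, and \<open>s m\<close> lies in the span of \<open>X\<close>.\<close>
      have "RR.fr \<one> (s \<otimes> t) \<odot>\<^bsub>L\<^esub> j (s \<odot>\<^bsub>M\<^esub> m) = fr (s \<odot>\<^bsub>M\<^esub> m) (s \<otimes> t)"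
        using smul[of \<one> "s \<otimes> t" "s \<odot>\<^bsub>M\<^esub> m"] m s mult_in in_carrier by simp
      also have "\<dots> = Y" using frac_expand[OF m(1,2) s] m(3) by simp
      finally show "Y \<in> LL.span (j ` X)"
        using N.smult_closed[OF _ jspan[OF span[OF m(1)]], of "RR.fr \<one> (s \<otimes> t)"]
          RR.frac_in[of \<one> "s \<otimes> t"] mult_in s m by simp
    qed
  qed
  ultimately have "is_basis RR.L L (j ` X)" using X jL by (auto simp: is_basis_def)
  then show ?thesis using localised_module by (auto simp: free_module_def)
qed

text \<open>
  At the prime \<open>P\<close>, take \<open>X\<close> of least size among the finite sets that span \<open>M\<close> up to a denominator
  \<open>s\<close> outside \<open>P\<close>, and write \<open>s a = \<Sum> f\<^sub>x(a) x\<close>. By minimality, relations on \<open>X\<close> have coefficients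
  in \<open>P\<close>; hence the matrix of the \<open>f\<^sub>x(y)\<close> is \<open>s\<close> times the identity modulo \<open>P\<close>. It annihilates
  every relation, so all relations vanish and \<open>X\<close> is a basis of the localisation.
\<close>

lemma locally_free_of_finite_rank_id:
  fixes R (structure) and M :: "('r, 'm, 'd) module_scheme"
  assumes "domain R" "module R M" and id: "finite_rank R M (\<lambda>a. a)"
  shows "locally_free R M"
  unfolding locally_free_def
proof (intro allI impI)
  fix P assume "primeideal P R"
  interpret domain R by fact
  note R_finsum_cong' = finsum_cong' and R_finsum_addf = finsum_addf
    and R_finsum_singleton = finsum_singleton and R_finsum_closed = finsum_closed
  interpret module R M by fact
  interpret P: primeideal P R by fact
  interpret S: multiplicative_subset R "carrier R - P"
    by (rule P.complement_multiplicative_subset) (rule is_cring)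
  interpret F: fraction_module R "carrier R - P" M
    by (intro fraction_module.intro S.multiplicative_subset_axioms module_axioms)
  define spanning where "spanning X s \<longleftrightarrow> finite X \<and> X \<subseteq> carrier M \<and> s \<in> carrier R - P \<and>
    (\<forall>a\<in>carrier M. s \<odot>\<^bsub>M\<^esub> a \<in> span X)" for X s
  obtain G where "finite G" "G \<subseteq> carrier M" "\<forall>a\<in>carrier M. a \<in> span G"
    using finite_rank_finite_span[OF id] by auto
  then have "spanning G \<one>" using S.one_in by (auto simp: spanning_def)
  then have ex: "\<exists>X s. card X = card G \<and> spanning X s" by auto
  define k where "k = (LEAST k. \<exists>X s. card X = k \<and> spanning X s)"
  obtain X s where X: "card X = k" "spanning X s"
    using LeastI[of "\<lambda>k. \<exists>X s. card X = k \<and> spanning X s", OF ex] unfolding k_def by auto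
  have min: "k \<le> card Y" if "spanning Y t" for Y t unfolding k_def by (rule Least_le) (use that in auto)
  note fin = X(2)[unfolded spanning_def, THEN conjunct1]
  have XM: "X \<subseteq> carrier M" and s: "s \<in> carrier R - P" "s \<in> carrier R"
    and span: "\<And>a. a \<in> carrier M \<Longrightarrow> s \<odot>\<^bsub>M\<^esub> a \<in> span X" using X(2) by (auto simp: spanning_def)
  have rel: "c x \<in> P" if c: "c \<in> X \<rightarrow> carrier R" "lincomb c X = \<zero>\<^bsub>M\<^esub>" and x: "x \<in> X" for c x
  proof (rule ccontr)
    assume cx: "c x \<notin> P"
    have cxR: "c x \<in> carrier R" using c x by auto
    have XxM: "X - {x} \<subseteq> carrier M" using XM by auto
    interpret N: submodule R "span (X - {x})" M by (rule span_is_submodule[OF XxM])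
    have l: "lincomb c (X - {x}) \<in> span (X - {x})" using fin c by (auto simp: span_def)
    have "c x \<odot>\<^bsub>M\<^esub> x \<oplus>\<^bsub>M\<^esub> lincomb c (X - {x}) = \<zero>\<^bsub>M\<^esub>"
      using lincomb_del2[OF fin XM c(1) x] c(2) by simp
    then have "c x \<odot>\<^bsub>M\<^esub> x = \<ominus>\<^bsub>M\<^esub> lincomb c (X - {x})"
      using XM x cxR l N.subset by (intro M.minus_equality[symmetric]) auto
    also have "\<dots> = (\<ominus> \<one>) \<odot>\<^bsub>M\<^esub> lincomb c (X - {x})" using subsetD[OF N.subset l] by (simp add: smult_minus_1)
    also have "\<dots> \<in> span (X - {x})" using l by simp
    finally have cxx: "c x \<odot>\<^bsub>M\<^esub> x \<in> span (X - {x})" .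
    have "X \<subseteq> {a \<in> carrier M. c x \<odot>\<^bsub>M\<^esub> a \<in> span (X - {x})}"
    proof
      fix y assume y: "y \<in> X"
      have "c x \<odot>\<^bsub>M\<^esub> y \<in> span (X - {x})" if "y \<noteq> x"
        using in_own_span[OF XxM] y that by (intro N.smult_closed[OF cxR]) auto
      then show "y \<in> {a \<in> carrier M. c x \<odot>\<^bsub>M\<^esub> a \<in> span (X - {x})}" using cxx y XM by blast
    qed
    then have "span X \<subseteq> {a \<in> carrier M. c x \<odot>\<^bsub>M\<^esub> a \<in> span (X - {x})}"
      by (rule span_is_subset[OF _ submodule_vimage_smult[OF N.submodule_axioms cxR]])
    \<comment> \<open>The scalar \<open>c x\<close> moves every element of \<open>X\<close> into the
      span of the others, so \<open>c x \<otimes> s\<close> is a denominator for a smaller set; it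
      is outside \<open>P\<close> because \<open>P\<close> is prime.\<close>
    then have "spanning (X - {x}) (c x \<otimes> s)"
      using span cxR s fin XxM cx S.mult_in[of "c x" s] by (auto simp: spanning_def smult_assoc1)
    then have "k \<le> card (X - {x})" by (rule min)
    then show False using X(1) fin x by (metis card_Diff1_less not_le)
  qed
  obtain f where f: "\<And>x. x \<in> X \<Longrightarrow> f x \<in> module_hom R M (regular R)"
    and sf: "\<And>a. a \<in> carrier M \<Longrightarrow> s \<odot>\<^bsub>M\<^esub> a = lincomb (\<lambda>x. f x a) X"
    using finite_rank_coordinates[OF id fin XM s(2) span] by auto
  define \<delta> where "\<delta> x y = (if x = y then s else \<zero>)" for x y :: 'm
  have \<delta>R: "\<delta> x y \<in> carrier R" for x y using s by (auto simp: \<delta>_def)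
  have fR: "f x a \<in> carrier R" if "x \<in> X" "a \<in> carrier M" for x a using formD(1)[OF f] that by auto
  \<comment> \<open>Two expressions of \<open>s \<odot> y\<close> over \<open>X\<close> are
    compared: the one with coefficients \<open>f x y\<close> and the trivial one with coefficient
    \<open>s\<close> at \<open>y\<close>. Their difference is a relation, to which
    \<open>rel\<close> applies.\<close>
  have diag: "f x y \<ominus> \<delta> x y \<in> P" if xy: "x \<in> X" "y \<in> X" for x y
  proof (rule rel[OF _ _ xy(1)])
    have yM: "y \<in> carrier M" using xy XM by auto
    show "(\<lambda>x. f x y \<ominus> \<delta> x y) \<in> X \<rightarrow> carrier R" using fR yM \<delta>R by auto
    have "lincomb (\<lambda>x. \<delta> x y) X = \<delta> y y \<odot>\<^bsub>M\<^esub> y \<oplus>\<^bsub>M\<^esub> lincomb (\<lambda>x. \<delta> x y) (X - {y})"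
      by (rule lincomb_del2) (use fin XM \<delta>R xy in auto)
    also have "lincomb (\<lambda>x. \<delta> x y) (X - {y}) = \<zero>\<^bsub>M\<^esub>"
      unfolding lincomb_def using XM by (intro M.add.finprod_one_eqI) (auto simp: \<delta>_def)
    finally have "lincomb (\<lambda>x. \<delta> x y) X = s \<odot>\<^bsub>M\<^esub> y" using yM s by (simp add: \<delta>_def)
    then have "lincomb (\<lambda>x. f x y \<ominus> \<delta> x y) X = s \<odot>\<^bsub>M\<^esub> y \<ominus>\<^bsub>M\<^esub> s \<odot>\<^bsub>M\<^esub> y"
      using lincomb_diff[OF fin XM, of "\<lambda>x. f x y" "\<lambda>x. \<delta> x y"] sf[OF yM] fR yM \<delta>R
      by (simp add: Pi_iff)
    then show "lincomb (\<lambda>x. f x y \<ominus> \<delta> x y) X = \<zero>\<^bsub>M\<^esub>" using yM s(2) by simp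
  qed
  \<comment> \<open>Applying \<open>f x\<close> to the relation gives a vanishing sum of the
    products \<open>f x y \<otimes> c y\<close>. With \<open>f = \<delta> - \<epsilon>\<close> this
    takes the shape required by \<open>elimination\<close>, with constant diagonal
    \<open>s\<close>.\<close>
  have indep: "\<forall>x\<in>X. c x = \<zero>" if c: "c \<in> X \<rightarrow> carrier R" "lincomb c X = \<zero>\<^bsub>M\<^esub>" for c
  proof (rule elimination[OF P.primeideal_axioms fin, where s = "\<lambda>_. s" and r = c
        and \<epsilon> = "\<lambda>x y. \<ominus> (f x y \<ominus> \<delta> x y)"])
    have cR: "c x \<in> carrier R" if "x \<in> X" for x using c that by auto
    fix x assume x: "x \<in> X"
    show "s \<in> carrier R - P" "c x \<in> carrier R" using s cR x by auto
    have "(\<Oplus>y\<in>X. f x y \<otimes> c y) = (\<Oplus>y\<in>X. f x (c y \<odot>\<^bsub>M\<^esub> y))"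
    proof (rule R_finsum_cong')
      fix y assume y: "y \<in> X"
      then show "f x y \<otimes> c y = f x (c y \<odot>\<^bsub>M\<^esub> y)"
        using XM x fR cR by (simp add: formD(3)[OF f] subset_iff m_comm)
    qed (use XM x fR cR in auto)
    also have "\<dots> = f x (lincomb c X)"
      unfolding lincomb_def using XM cR by (subst form_finsum[OF f[OF x] fin]) auto
    also have "\<dots> = \<zero>" using c(2) form_zero[OF f[OF x]] by simp
    finally have fc: "(\<Oplus>y\<in>X. f x y \<otimes> c y) = \<zero>" .
    have "(\<Oplus>y\<in>X. \<ominus> (f x y \<ominus> \<delta> x y) \<otimes> c y) \<oplus> (\<Oplus>y\<in>X. f x y \<otimes> c y) =
        (\<Oplus>y\<in>X. \<ominus> (f x y \<ominus> \<delta> x y) \<otimes> c y \<oplus> f x y \<otimes> c y)"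
      using XM x fR cR \<delta>R by (intro R_finsum_addf[symmetric]) auto
    also have "\<dots> = (\<Oplus>y\<in>X. if x = y then s \<otimes> c y else \<zero>)"
    proof (rule R_finsum_cong')
      fix y assume y: "y \<in> X"
      have "f x y \<in> carrier R" "c y \<in> carrier R" "\<delta> x y \<in> carrier R" using fR cR \<delta>R x y XM by auto
      then have "\<ominus> (f x y \<ominus> \<delta> x y) \<otimes> c y \<oplus> f x y \<otimes> c y = \<delta> x y \<otimes> c y" by algebra
      then show "\<ominus> (f x y \<ominus> \<delta> x y) \<otimes> c y \<oplus> f x y \<otimes> c y = (if x = y then s \<otimes> c y else \<zero>)"
        using cR y by (simp add: \<delta>_def)
    qed (use cR s in auto)
    also have "\<dots> = s \<otimes> c x"
      using R_finsum_singleton[of x X "\<lambda>y. s \<otimes> c y"] x fin cR s by auto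
    finally show "s \<otimes> c x = (\<Oplus>y\<in>X. \<ominus> (f x y \<ominus> \<delta> x y) \<otimes> c y)"
      using fc R_finsum_closed[of "\<lambda>y. \<ominus> (f x y \<ominus> \<delta> x y) \<otimes> c y" X] XM x fR cR \<delta>R
      by (auto simp: Pi_iff subset_iff)
  next
    fix x y assume "x \<in> X" "y \<in> X"
    then show "\<ominus> (f x y \<ominus> \<delta> x y) \<in> P" using diag P.a_inv_closed by blast
  qed
  show "free_module (localisation R (carrier R - P) (regular R)) (localisation R (carrier R - P) M)"
    by (rule F.free_localisation_of_independent[OF domain_axioms _
          torsion_free_of_finite_rank_id[OF domain_axioms id] fin XM s(1) indep span])
      (use P.zero_closed in auto)
qed

lemma fg_locally_free_of_finite_rank_id:
  assumes "domain R" "module R M" "finite_rank R M (\<lambda>a. a)"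
  shows "fg_locally_free R M"
proof -
  interpret module R M by fact
  obtain G where G: "finite G" "G \<subseteq> carrier M" "\<forall>a\<in>carrier M. a \<in> span G"
    using finite_rank_finite_span[OF assms(3)] by auto
  then have "span G = carrier M" using span_is_subset2[OF G(2)] by auto
  then have "finitely_generated R M" using G(1,2) by (auto simp: finitely_generated_def)
  then show ?thesis
    using assms locally_free_of_finite_rank_id[OF assms] by (simp add: fg_locally_free_def)
qed

section \<open>Tensor products\<close>

lemma free_on_simps [simp]:
  "zero (free_on B I) = (\<lambda>i. \<zero>\<^bsub>B\<^esub>)"
  "f \<oplus>\<^bsub>free_on B I\<^esub> g = (\<lambda>i. f i \<oplus>\<^bsub>B\<^esub> g i)"
  "b \<odot>\<^bsub>free_on B I\<^esub> f = (\<lambda>i. b \<otimes>\<^bsub>B\<^esub> f i)"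
  by (simp_all add: free_on_def)

lemma free_on_carrier:
  "f \<in> carrier (free_on B I) \<longleftrightarrow>
    (\<forall>i\<in>I. f i \<in> carrier B) \<and> (\<forall>i. i \<notin> I \<longrightarrow> f i = \<zero>\<^bsub>B\<^esub>) \<and> finite {i. f i \<noteq> \<zero>\<^bsub>B\<^esub>}"
  by (simp add: free_on_def)

lemma (in ring) free_onD:
  assumes "f \<in> carrier (free_on R I)"
  shows "f i \<in> carrier R" "finite {i. f i \<noteq> \<zero>}" "{i. f i \<noteq> \<zero>} \<subseteq> I"
  using assms by (cases "i \<in> I"; auto simp: free_on_carrier)+

lemma (in ring) free_on_add_closed:
  assumes f: "f \<in> carrier (free_on R I)" and g: "g \<in> carrier (free_on R I)"
  shows "(\<lambda>i. f i \<oplus> g i) \<in> carrier (free_on R I)"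
proof -
  have "{i. f i \<oplus> g i \<noteq> \<zero>} \<subseteq> {i. f i \<noteq> \<zero>} \<union> {i. g i \<noteq> \<zero>}" by auto
  then have "finite {i. f i \<oplus> g i \<noteq> \<zero>}"
    by (rule finite_subset) (simp add: free_onD(2)[OF f] free_onD(2)[OF g])
  then show ?thesis using f g by (simp add: free_on_carrier)
qed

lemma (in ring) free_on_smult_closed:
  assumes f: "f \<in> carrier (free_on R I)" and b: "b \<in> carrier R"
  shows "(\<lambda>i. b \<otimes> f i) \<in> carrier (free_on R I)"
proof -
  have "{i. b \<otimes> f i \<noteq> \<zero>} \<subseteq> {i. f i \<noteq> \<zero>}" using b by auto
  then have "finite {i. b \<otimes> f i \<noteq> \<zero>}" by (rule finite_subset) (rule free_onD(2)[OF f])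
  then show ?thesis using f b by (simp add: free_on_carrier)
qed

lemma (in cring) free_on_module: "module R (free_on R I)"
proof (rule moduleI)
  show "abelian_group (free_on R I)"
  proof (rule abelian_groupI)
    fix f assume f: "f \<in> carrier (free_on R I)"
    have "(\<lambda>i. \<ominus> \<one> \<otimes> f i) \<in> carrier (free_on R I)" by (rule free_on_smult_closed[OF f]) simp
    then show "\<exists>g\<in>carrier (free_on R I). g \<oplus>\<^bsub>free_on R I\<^esub> f = \<zero>\<^bsub>free_on R I\<^esub>"
      using free_onD(1)[OF f] by (intro bexI[of _ "\<lambda>i. \<ominus> \<one> \<otimes> f i"]) (auto simp: l_minus l_neg)
  next
    show "\<zero>\<^bsub>free_on R I\<^esub> \<in> carrier (free_on R I)" by (simp add: free_on_carrier)
  qed (auto simp: free_on_add_closed free_onD(1) a_ac fun_eq_iff)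
qed (auto simp: is_cring free_on_smult_closed free_onD(1) l_distr r_distr m_assoc fun_eq_iff)

text \<open>The part of \<open>tensor_lift\<close> that does not involve the choice of a
  representative. It is linear in the formal sum for every \<open>\<beta>\<close> with values in
  \<open>P\<close>; bilinearity of \<open>\<beta>\<close> is what lets it descend to the
  quotient.\<close>

definition formal_sum_value ::
  "('r, 'c) ring_scheme \<Rightarrow> ('r, 'p, 'd) module_scheme \<Rightarrow> ('m \<Rightarrow> 'n \<Rightarrow> 'p) \<Rightarrow> ('m \<times> 'n \<Rightarrow> 'r) \<Rightarrow> 'p" where
  "formal_sum_value R P \<beta> c =
     (\<Oplus>\<^bsub>P\<^esub>z\<in>{z. c z \<noteq> \<zero>\<^bsub>R\<^esub>}. c z \<odot>\<^bsub>P\<^esub> \<beta> (fst z) (snd z))"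

lemma tensor_lift_eq: "tensor_lift R P \<beta> t = formal_sum_value R P \<beta> (SOME c. c \<in> t)"
  by (simp add: tensor_lift_def formal_sum_value_def Let_def)

locale tensor_pair = M: module R M + N: module R N
  for R :: "('r, 'c) ring_scheme" (structure)
    and M :: "('r, 'm, 'd) module_scheme" and N :: "('r, 'n, 'e) module_scheme"
begin

abbreviation F :: "('r, 'm \<times> 'n \<Rightarrow> 'r) module" where
  "F \<equiv> tensor_free R M N"

abbreviation K :: "('m \<times> 'n \<Rightarrow> 'r) set" where
  "K \<equiv> tensor_kernel R M N"

abbreviation \<delta> :: "'m \<Rightarrow> 'n \<Rightarrow> 'm \<times> 'n \<Rightarrow> 'r" where
  "\<delta> x y \<equiv> point R (x, y)"

sublocale F: module R F
  unfolding tensor_free_def by (rule M.R.free_on_module)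

lemma point_in: "\<lbrakk>x \<in> carrier M; y \<in> carrier N\<rbrakk> \<Longrightarrow> \<delta> x y \<in> carrier F"
  by (auto simp: tensor_free_def free_on_carrier point_def)

lemma tensor_freeD:
  assumes "c \<in> carrier F"
  shows "c z \<in> carrier R" "finite {z. c z \<noteq> \<zero>}"
    "c z \<noteq> \<zero> \<Longrightarrow> fst z \<in> carrier M \<and> snd z \<in> carrier N"
  using M.R.free_onD[OF assms[unfolded tensor_free_def]] by auto

lemma relations_in: "tensor_relations R M N \<subseteq> carrier F"
  unfolding tensor_relations_def Let_def
  by (auto intro!: F.M.minus_closed F.M.a_closed F.smult_closed point_in)

lemma kernel_submodule: "submodule R K F"
  unfolding tensor_kernel_def by (rule F.span_is_submodule[OF relations_in])

lemma relations_in_kernel: "tensor_relations R M N \<subseteq> K"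
  unfolding tensor_kernel_def by (rule F.in_own_span[OF relations_in])

sublocale K: submodule R K F
  by (rule kernel_submodule)

lemma kernel_in: "k \<in> K \<Longrightarrow> k \<in> carrier F"
  using K.subset by auto

lemma kernel_minus: "k \<in> K \<Longrightarrow> \<ominus>\<^bsub>F\<^esub> k \<in> K"
  using K.smult_closed[of "\<ominus> \<one>" k] F.smult_minus_1[OF kernel_in] by simp

text \<open>Identities between tensors are proved as congruences of formal sums modulo
  \<open>K\<close> and turned into equalities of cosets at the end by
  \<open>equiv_coset_eq\<close>.\<close>

definition equiv_mod :: "('m \<times> 'n \<Rightarrow> 'r) \<Rightarrow> ('m \<times> 'n \<Rightarrow> 'r) \<Rightarrow> bool" (infix \<open>\<approx>\<close> 50) where
  "c \<approx> d \<longleftrightarrow> c \<in> carrier F \<and> d \<in> carrier F \<and> c \<ominus>\<^bsub>F\<^esub> d \<in> K"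

lemma equiv_refl: "c \<in> carrier F \<Longrightarrow> c \<approx> c"
  using K.zero_closed by (simp add: equiv_mod_def F.M.minus_eq F.M.r_neg)

lemma equiv_sym: "c \<approx> d \<Longrightarrow> d \<approx> c"
  using kernel_minus[of "c \<ominus>\<^bsub>F\<^esub> d"]
  by (auto simp: equiv_mod_def F.M.minus_eq F.M.minus_add F.M.a_comm)

lemma equiv_add:
  assumes "c \<approx> d" "c' \<approx> d'"
  shows "c \<oplus>\<^bsub>F\<^esub> c' \<approx> d \<oplus>\<^bsub>F\<^esub> d'"
proof -
  have "(c \<oplus>\<^bsub>F\<^esub> c') \<ominus>\<^bsub>F\<^esub> (d \<oplus>\<^bsub>F\<^esub> d') = (c \<ominus>\<^bsub>F\<^esub> d) \<oplus>\<^bsub>F\<^esub> (c' \<ominus>\<^bsub>F\<^esub> d')"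
    using assms by (simp add: equiv_mod_def F.M.minus_eq F.M.minus_add F.M.a_ac)
  then show ?thesis using assms by (simp add: equiv_mod_def)
qed

lemma equiv_trans [trans]:
  assumes "c \<approx> d" "d \<approx> e"
  shows "c \<approx> e"
proof -
  have "c \<ominus>\<^bsub>F\<^esub> e = (c \<ominus>\<^bsub>F\<^esub> d) \<oplus>\<^bsub>F\<^esub> (d \<ominus>\<^bsub>F\<^esub> e)"
    using assms by (simp add: equiv_mod_def F.M.minus_eq F.M.a_assoc F.M.r_neg1)
  then show ?thesis using assms by (simp add: equiv_mod_def)
qed

lemma eq_equiv_trans [trans]: "c = d \<Longrightarrow> d \<approx> e \<Longrightarrow> c \<approx> e"
  by simp

lemma equiv_eq_trans [trans]: "c \<approx> d \<Longrightarrow> d = e \<Longrightarrow> c \<approx> e"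
  by simp

lemma equiv_smult:
  assumes "c \<approx> d" "r \<in> carrier R"
  shows "r \<odot>\<^bsub>F\<^esub> c \<approx> r \<odot>\<^bsub>F\<^esub> d"
proof -
  have "r \<odot>\<^bsub>F\<^esub> c \<ominus>\<^bsub>F\<^esub> r \<odot>\<^bsub>F\<^esub> d = r \<odot>\<^bsub>F\<^esub> (c \<ominus>\<^bsub>F\<^esub> d)"
    using assms by (simp add: equiv_mod_def F.M.minus_eq F.smult_r_distr F.smult_r_minus)
  then show ?thesis using assms by (simp add: equiv_mod_def)
qed

lemma equiv_finsum:
  assumes "finite I" "\<And>i. i \<in> I \<Longrightarrow> c i \<approx> d i"
  shows "(\<Oplus>\<^bsub>F\<^esub>i\<in>I. c i) \<approx> (\<Oplus>\<^bsub>F\<^esub>i\<in>I. d i)"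
  using assms
proof (induction I rule: finite_induct)
  case empty
  show ?case using equiv_refl[of "\<zero>\<^bsub>F\<^esub>"] by simp
next
  case (insert i I)
  have "c j \<in> carrier F" "d j \<in> carrier F" if "j \<in> insert i I" for j
    using insert.prems[OF that] by (auto simp: equiv_mod_def)
  then have "(\<Oplus>\<^bsub>F\<^esub>i\<in>insert i I. c i) = c i \<oplus>\<^bsub>F\<^esub> (\<Oplus>\<^bsub>F\<^esub>i\<in>I. c i)"
    "(\<Oplus>\<^bsub>F\<^esub>i\<in>insert i I. d i) = d i \<oplus>\<^bsub>F\<^esub> (\<Oplus>\<^bsub>F\<^esub>i\<in>I. d i)"
    using insert.hyps by (auto simp del: free_on_simps intro!: F.M.finsum_insert)
  then show ?case using equiv_add[OF insert.prems[of i] insert.IH] insert.prems by simp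
qed

lemma equiv_add_left:
  assumes "x \<in> carrier M" "x' \<in> carrier M" "y \<in> carrier N"
  shows "\<delta> (x \<oplus>\<^bsub>M\<^esub> x') y \<approx> \<delta> x y \<oplus>\<^bsub>F\<^esub> \<delta> x' y"
proof -
  have "\<delta> (x \<oplus>\<^bsub>M\<^esub> x') y \<ominus>\<^bsub>F\<^esub> (\<delta> x y \<oplus>\<^bsub>F\<^esub> \<delta> x' y) \<in> tensor_relations R M N"
    unfolding tensor_relations_def Let_def using assms by blast
  then show ?thesis using assms relations_in_kernel by (auto simp: equiv_mod_def point_in)
qed

lemma equiv_add_right:
  assumes "x \<in> carrier M" "y \<in> carrier N" "y' \<in> carrier N"
  shows "\<delta> x (y \<oplus>\<^bsub>N\<^esub> y') \<approx> \<delta> x y \<oplus>\<^bsub>F\<^esub> \<delta> x y'"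
proof -
  have "\<delta> x (y \<oplus>\<^bsub>N\<^esub> y') \<ominus>\<^bsub>F\<^esub> (\<delta> x y \<oplus>\<^bsub>F\<^esub> \<delta> x y') \<in> tensor_relations R M N"
    unfolding tensor_relations_def Let_def using assms by blast
  then show ?thesis using assms relations_in_kernel by (auto simp: equiv_mod_def point_in)
qed

lemma equiv_smult_left:
  assumes "r \<in> carrier R" "x \<in> carrier M" "y \<in> carrier N"
  shows "\<delta> (r \<odot>\<^bsub>M\<^esub> x) y \<approx> r \<odot>\<^bsub>F\<^esub> \<delta> x y"
proof -
  have "\<delta> (r \<odot>\<^bsub>M\<^esub> x) y \<ominus>\<^bsub>F\<^esub> (r \<odot>\<^bsub>F\<^esub> \<delta> x y) \<in> tensor_relations R M N"
    unfolding tensor_relations_def Let_def using assms by blast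
  then show ?thesis using assms relations_in_kernel by (auto simp: equiv_mod_def point_in)
qed

lemma equiv_smult_right:
  assumes "r \<in> carrier R" "x \<in> carrier M" "y \<in> carrier N"
  shows "\<delta> x (r \<odot>\<^bsub>N\<^esub> y) \<approx> r \<odot>\<^bsub>F\<^esub> \<delta> x y"
proof -
  have "\<delta> x (r \<odot>\<^bsub>N\<^esub> y) \<ominus>\<^bsub>F\<^esub> (r \<odot>\<^bsub>F\<^esub> \<delta> x y) \<in> tensor_relations R M N"
    unfolding tensor_relations_def Let_def using assms by blast
  then show ?thesis using assms relations_in_kernel by (auto simp: equiv_mod_def point_in)
qed

lemma equiv_zero_left:
  assumes "y \<in> carrier N"
  shows "\<delta> \<zero>\<^bsub>M\<^esub> y \<approx> \<zero>\<^bsub>F\<^esub>"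
  using equiv_smult_left[of \<zero> "\<zero>\<^bsub>M\<^esub>" y] assms by (simp add: point_in)

lemma equiv_zero_right:
  assumes "x \<in> carrier M"
  shows "\<delta> x \<zero>\<^bsub>N\<^esub> \<approx> \<zero>\<^bsub>F\<^esub>"
  using equiv_smult_right[of \<zero> x "\<zero>\<^bsub>N\<^esub>"] assms by (simp add: point_in)

lemma equiv_finsum_left:
  assumes "finite I" "\<And>i. i \<in> I \<Longrightarrow> x i \<in> carrier M" "y \<in> carrier N"
  shows "\<delta> (\<Oplus>\<^bsub>M\<^esub>i\<in>I. x i) y \<approx> (\<Oplus>\<^bsub>F\<^esub>i\<in>I. \<delta> (x i) y)"
  using assms(1,2)
proof (induction I rule: finite_induct)
  case empty
  show ?case using equiv_zero_left[OF assms(3)] by simp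
next
  case (insert i I)
  have "\<delta> (\<Oplus>\<^bsub>M\<^esub>i\<in>insert i I. x i) y = \<delta> (x i \<oplus>\<^bsub>M\<^esub> (\<Oplus>\<^bsub>M\<^esub>i\<in>I. x i)) y"
    using insert by (simp add: Pi_iff)
  also have "\<dots> \<approx> \<delta> (x i) y \<oplus>\<^bsub>F\<^esub> \<delta> (\<Oplus>\<^bsub>M\<^esub>i\<in>I. x i) y"
    using insert.prems assms(3) by (intro equiv_add_left) auto
  also have "\<dots> \<approx> \<delta> (x i) y \<oplus>\<^bsub>F\<^esub> (\<Oplus>\<^bsub>F\<^esub>i\<in>I. \<delta> (x i) y)"
    using insert assms(3) by (intro equiv_add equiv_refl point_in) auto
  also have "\<dots> = (\<Oplus>\<^bsub>F\<^esub>i\<in>insert i I. \<delta> (x i) y)"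
    using insert assms(3) by (intro F.M.finsum_insert[symmetric]) (auto simp: point_in)
  finally show ?case .
qed

lemma coset_iff: "d \<in> K +>\<^bsub>F\<^esub> c \<longleftrightarrow> (\<exists>k\<in>K. d = k \<oplus>\<^bsub>F\<^esub> c)"
  by (auto simp: a_r_coset_def')

lemma coset_self: "c \<in> carrier F \<Longrightarrow> c \<in> K +>\<^bsub>F\<^esub> c"
  unfolding coset_iff by (rule bexI[OF _ K.zero_closed]) simp

lemma coset_equiv:
  assumes "c \<in> carrier F" "d \<in> K +>\<^bsub>F\<^esub> c"
  shows "d \<approx> c"
proof -
  obtain k where k: "k \<in> K" "d = k \<oplus>\<^bsub>F\<^esub> c" using assms by (auto simp: coset_iff)
  then have "d \<ominus>\<^bsub>F\<^esub> c = k" using assms(1) kernel_in by (simp add: F.M.minus_eq F.M.a_assoc F.M.r_neg)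
  then show ?thesis using k assms(1) kernel_in by (simp add: equiv_mod_def)
qed

lemma equiv_coset_eq:
  assumes "c \<approx> d"
  shows "K +>\<^bsub>F\<^esub> c = K +>\<^bsub>F\<^esub> d"
proof -
  have "K +>\<^bsub>F\<^esub> c \<subseteq> K +>\<^bsub>F\<^esub> d" if "c \<approx> d" for c d
  proof
    fix e assume "e \<in> K +>\<^bsub>F\<^esub> c"
    then obtain k where k: "k \<in> K" "e = k \<oplus>\<^bsub>F\<^esub> c" by (auto simp: coset_iff)
    have cd: "c \<in> carrier F" "d \<in> carrier F" "c \<ominus>\<^bsub>F\<^esub> d \<in> K" using that by (auto simp: equiv_mod_def)
    then have "c = (c \<ominus>\<^bsub>F\<^esub> d) \<oplus>\<^bsub>F\<^esub> d" by (simp add: F.M.minus_eq F.M.a_assoc F.M.l_neg)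
    then have "e = (k \<oplus>\<^bsub>F\<^esub> (c \<ominus>\<^bsub>F\<^esub> d)) \<oplus>\<^bsub>F\<^esub> d"
      using k cd kernel_in by (simp add: F.M.a_assoc)
    then show "e \<in> K +>\<^bsub>F\<^esub> d" using k cd by (auto simp: coset_iff)
  qed
  from this[OF assms] this[OF equiv_sym[OF assms]] show ?thesis by auto
qed

text \<open>The choice made in \<open>tensor_lift\<close> yields a genuine formal sum in the coset,
  so facts on \<open>formal_sum_value\<close> apply to it.\<close>

lemma representative:
  assumes "t \<in> carrier (tensor_module R M N)"
  shows "(SOME c. c \<in> t) \<in> carrier F" "K +>\<^bsub>F\<^esub> (SOME c. c \<in> t) = t"
proof -
  obtain d where d: "d \<in> carrier F" "t = K +>\<^bsub>F\<^esub> d"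
    using assms by (auto simp: tensor_module_def Let_def A_RCOSETS_def')
  then have "(SOME c. c \<in> t) \<in> K +>\<^bsub>F\<^esub> d" using coset_self[OF d(1)] by (metis someI)
  then have eq: "(SOME c. c \<in> t) \<approx> d" by (rule coset_equiv[OF d(1)])
  then show "(SOME c. c \<in> t) \<in> carrier F" by (simp add: equiv_mod_def)
  show "K +>\<^bsub>F\<^esub> (SOME c. c \<in> t) = t" using equiv_coset_eq[OF eq] d(2) by simp
qed

text \<open>Formal sums with different supports can be compared term by term over a common finite
  set, as additivity in the formal sum requires.\<close>

lemma formal_sum_value_superset:
  assumes "module R P" "c \<in> carrier F"
    and \<beta>: "\<And>x y. \<lbrakk>x \<in> carrier M; y \<in> carrier N\<rbrakk> \<Longrightarrow> \<beta> x y \<in> carrier P"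
    and Z: "finite Z" "{z. c z \<noteq> \<zero>} \<subseteq> Z" "Z \<subseteq> carrier M \<times> carrier N"
  shows "formal_sum_value R P \<beta> c = (\<Oplus>\<^bsub>P\<^esub>z\<in>Z. c z \<odot>\<^bsub>P\<^esub> \<beta> (fst z) (snd z))"
proof -
  interpret P: module R P by fact
  have "\<beta> (fst z) (snd z) \<in> carrier P" if "z \<in> Z" for z using \<beta> Z that by auto
  then show ?thesis
    unfolding formal_sum_value_def using Z tensor_freeD(1)[OF assms(2)]
    by (intro P.M.add.finprod_mono_neutral_cong_left) auto
qed

lemma formal_sum_value_closed:
  assumes "module R P" "c \<in> carrier F"
    and \<beta>: "\<And>x y. \<lbrakk>x \<in> carrier M; y \<in> carrier N\<rbrakk> \<Longrightarrow> \<beta> x y \<in> carrier P"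
  shows "formal_sum_value R P \<beta> c \<in> carrier P"
proof -
  interpret P: module R P by fact
  show ?thesis
    unfolding formal_sum_value_def using tensor_freeD[OF assms(2)] \<beta>
    by (intro P.M.finsum_closed) auto
qed

text \<open>Pulls scalars out of the convolution product and out of the dual action. The condition
  on \<open>\<gamma>\<close> concerns arguments in the carriers only, so \<open>r = \<one>\<close>
  identifies maps that differ elsewhere.\<close>

lemma formal_sum_value_smult:
  assumes "module R P" "c \<in> carrier F" "r \<in> carrier R"
    and \<beta>: "\<And>x y. \<lbrakk>x \<in> carrier M; y \<in> carrier N\<rbrakk> \<Longrightarrow> \<beta> x y \<in> carrier P"
    and \<gamma>: "\<And>x y. \<lbrakk>x \<in> carrier M; y \<in> carrier N\<rbrakk> \<Longrightarrow> \<gamma> x y = r \<odot>\<^bsub>P\<^esub> \<beta> x y"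
  shows "formal_sum_value R P \<gamma> c = r \<odot>\<^bsub>P\<^esub> formal_sum_value R P \<beta> c"
proof -
  interpret P: module R P by fact
  note c = tensor_freeD[OF assms(2)]
  have "formal_sum_value R P \<gamma> c = (\<Oplus>\<^bsub>P\<^esub>z\<in>{z. c z \<noteq> \<zero>}. r \<odot>\<^bsub>P\<^esub> (c z \<odot>\<^bsub>P\<^esub> \<beta> (fst z) (snd z)))"
    unfolding formal_sum_value_def
  proof (rule P.M.finsum_cong')
    fix z assume "z \<in> {z. c z \<noteq> \<zero>}"
    then have z: "fst z \<in> carrier M" "snd z \<in> carrier N" using c(3) by auto
    show "c z \<odot>\<^bsub>P\<^esub> \<gamma> (fst z) (snd z) = r \<odot>\<^bsub>P\<^esub> (c z \<odot>\<^bsub>P\<^esub> \<beta> (fst z) (snd z))"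
      using \<gamma>[OF z] \<beta>[OF z] c(1)[of z] assms(3) by (simp add: P.smult_assoc1[symmetric] M.R.m_comm)
  qed (use c \<beta> assms(3) in auto)
  also have "\<dots> = r \<odot>\<^bsub>P\<^esub> formal_sum_value R P \<beta> c"
    unfolding formal_sum_value_def using c \<beta> assms(3)
    by (intro P.finsum_smult_ldistr[symmetric]) auto
  finally show ?thesis .
qed

lemma formal_sum_value_hom:
  assumes "module R P" and \<beta>: "\<And>x y. \<lbrakk>x \<in> carrier M; y \<in> carrier N\<rbrakk> \<Longrightarrow> \<beta> x y \<in> carrier P"
  shows "formal_sum_value R P \<beta> \<in> module_hom R F P"
proof -
  interpret P: module R P by fact
  note sup = formal_sum_value_superset[OF assms(1) _ \<beta>]
  have "formal_sum_value R P \<beta> (c \<oplus>\<^bsub>F\<^esub> d) = formal_sum_value R P \<beta> c \<oplus>\<^bsub>P\<^esub> formal_sum_value R P \<beta> d"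
    if cd: "c \<in> carrier F" "d \<in> carrier F" for c d
  proof -
    define Z where "Z = {z. c z \<noteq> \<zero>} \<union> {z. d z \<noteq> \<zero>}"
    note c = tensor_freeD[OF cd(1)] and d = tensor_freeD[OF cd(2)]
    have Z: "finite Z" "Z \<subseteq> carrier M \<times> carrier N"
      using c d unfolding Z_def by (auto simp: mem_Times_iff)
    have cdz: "(c \<oplus>\<^bsub>F\<^esub> d) z = c z \<oplus> d z" for z by (simp add: tensor_free_def)
    have bZ: "\<beta> (fst z) (snd z) \<in> carrier P" if "z \<in> Z" for z using \<beta> Z that by auto
    have "formal_sum_value R P \<beta> (c \<oplus>\<^bsub>F\<^esub> d) = (\<Oplus>\<^bsub>P\<^esub>z\<in>Z. (c z \<oplus> d z) \<odot>\<^bsub>P\<^esub> \<beta> (fst z) (snd z))"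
      unfolding cdz[symmetric] by (rule sup) (use cd Z cdz in \<open>auto simp: Z_def\<close>)
    also have "\<dots> = (\<Oplus>\<^bsub>P\<^esub>z\<in>Z. c z \<odot>\<^bsub>P\<^esub> \<beta> (fst z) (snd z) \<oplus>\<^bsub>P\<^esub> d z \<odot>\<^bsub>P\<^esub> \<beta> (fst z) (snd z))"
      using bZ c(1) d(1) by (intro P.M.finsum_cong') (auto simp: P.smult_l_distr)
    also have "\<dots> = (\<Oplus>\<^bsub>P\<^esub>z\<in>Z. c z \<odot>\<^bsub>P\<^esub> \<beta> (fst z) (snd z)) \<oplus>\<^bsub>P\<^esub>
        (\<Oplus>\<^bsub>P\<^esub>z\<in>Z. d z \<odot>\<^bsub>P\<^esub> \<beta> (fst z) (snd z))"
      using bZ c(1) d(1) by (intro P.M.finsum_addf) auto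
    also have "\<dots> = formal_sum_value R P \<beta> c \<oplus>\<^bsub>P\<^esub> formal_sum_value R P \<beta> d"
      using sup[OF cd(1), where Z = Z] sup[OF cd(2), where Z = Z] Z by (simp add: Z_def)
    finally show ?thesis .
  qed
  moreover have "formal_sum_value R P \<beta> (r \<odot>\<^bsub>F\<^esub> c) = r \<odot>\<^bsub>P\<^esub> formal_sum_value R P \<beta> c"
    if rc: "r \<in> carrier R" "c \<in> carrier F" for r c
  proof -
    note c = tensor_freeD[OF rc(2)]
    define Z where "Z = {z. c z \<noteq> \<zero>}"
    have Z: "finite Z" "Z \<subseteq> carrier M \<times> carrier N"
      using c unfolding Z_def by (auto simp: mem_Times_iff)
    have rcz: "(r \<odot>\<^bsub>F\<^esub> c) z = r \<otimes> c z" for z by (simp add: tensor_free_def)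
    have bZ: "\<beta> (fst z) (snd z) \<in> carrier P" if "z \<in> Z" for z using \<beta> Z that by auto
    have "formal_sum_value R P \<beta> (r \<odot>\<^bsub>F\<^esub> c) = (\<Oplus>\<^bsub>P\<^esub>z\<in>Z. (r \<otimes> c z) \<odot>\<^bsub>P\<^esub> \<beta> (fst z) (snd z))"
      unfolding rcz[symmetric] by (rule sup) (use rc Z rcz in \<open>auto simp: Z_def\<close>)
    also have "\<dots> = (\<Oplus>\<^bsub>P\<^esub>z\<in>Z. r \<odot>\<^bsub>P\<^esub> (c z \<odot>\<^bsub>P\<^esub> \<beta> (fst z) (snd z)))"
      using bZ c(1) rc(1) by (intro P.M.finsum_cong') (auto simp: P.smult_assoc1)
    also have "\<dots> = r \<odot>\<^bsub>P\<^esub> formal_sum_value R P \<beta> c"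
      unfolding formal_sum_value_def Z_def[symmetric] using bZ c(1) rc(1) Z
      by (intro P.finsum_smult_ldistr[symmetric]) auto
    finally show ?thesis .
  qed
  ultimately show ?thesis
    using formal_sum_value_closed[OF assms(1) _ \<beta>] by (auto simp: module_hom_def)
qed

lemma formal_sum_value_point:
  assumes "module R P" and \<beta>: "\<And>x y. \<lbrakk>x \<in> carrier M; y \<in> carrier N\<rbrakk> \<Longrightarrow> \<beta> x y \<in> carrier P"
    and xy: "x \<in> carrier M" "y \<in> carrier N"
  shows "formal_sum_value R P \<beta> (\<delta> x y) = \<beta> x y"
proof -
  interpret P: module R P by fact
  have "formal_sum_value R P \<beta> (\<delta> x y) = (\<Oplus>\<^bsub>P\<^esub>z\<in>{(x, y)}. \<delta> x y z \<odot>\<^bsub>P\<^esub> \<beta> (fst z) (snd z))"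
    by (rule formal_sum_value_superset[OF assms(1) point_in[OF xy] \<beta>])
      (use xy in \<open>auto simp: point_def split: if_splits\<close>)
  then show ?thesis using \<beta>[OF xy] by (simp add: point_def)
qed

text \<open>Bilinearity makes the linear extension of \<open>\<beta>\<close> annihilate
  \<open>tensor_relations\<close>, hence their span \<open>K\<close>.\<close>

lemma formal_sum_value_equiv:
  assumes "module R P" and \<beta>: "\<And>x y. \<lbrakk>x \<in> carrier M; y \<in> carrier N\<rbrakk> \<Longrightarrow> \<beta> x y \<in> carrier P"
    and left: "\<And>y. y \<in> carrier N \<Longrightarrow> (\<lambda>x. \<beta> x y) \<in> module_hom R M P"
    and right: "\<And>x. x \<in> carrier M \<Longrightarrow> \<beta> x \<in> module_hom R N P"
    and "c \<approx> d"
  shows "formal_sum_value R P \<beta> c = formal_sum_value R P \<beta> d"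
proof -
  interpret P: module R P by fact
  let ?v = "formal_sum_value R P \<beta>"
  interpret v: mod_hom R F P ?v
    by (intro mod_hom.intro F.module_axioms assms(1) mod_hom_axioms.intro
        formal_sum_value_hom[OF assms(1) \<beta>])
  note pt = formal_sum_value_point[OF assms(1) \<beta>]
  note l = module_hom_add[OF left] module_hom_smult[OF left]
  note r = module_hom_add[OF right] module_hom_smult[OF right]
  have "tensor_relations R M N \<subseteq> v.ker"
    using relations_in unfolding tensor_relations_def Let_def v.ker_def
    by (auto simp: pt l r \<beta> point_in)
  then have "K \<subseteq> v.ker"
    unfolding tensor_kernel_def by (rule F.span_is_subset[OF _ v.ker_is_submodule])
  then have "?v (c \<ominus>\<^bsub>F\<^esub> d) = \<zero>\<^bsub>P\<^esub>" using assms(5) by (auto simp: equiv_mod_def v.ker_def)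
  then show ?thesis using assms(5) by (simp add: equiv_mod_def)
qed

lemma tensor_lift_tens:
  assumes "module R P" and \<beta>: "\<And>x y. \<lbrakk>x \<in> carrier M; y \<in> carrier N\<rbrakk> \<Longrightarrow> \<beta> x y \<in> carrier P"
    and "\<And>y. y \<in> carrier N \<Longrightarrow> (\<lambda>x. \<beta> x y) \<in> module_hom R M P"
    and "\<And>x. x \<in> carrier M \<Longrightarrow> \<beta> x \<in> module_hom R N P"
    and xy: "x \<in> carrier M" "y \<in> carrier N"
  shows "tensor_lift R P \<beta> (tens R M N x y) = \<beta> x y"
proof -
  have "(SOME c. c \<in> tens R M N x y) \<in> K +>\<^bsub>F\<^esub> \<delta> x y"
    using someI[of "\<lambda>c. c \<in> tens R M N x y", OF coset_self[OF point_in[OF xy], folded tens_def]]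
    by (simp add: tens_def)
  then have "(SOME c. c \<in> tens R M N x y) \<approx> \<delta> x y" by (rule coset_equiv[OF point_in[OF xy]])
  then show ?thesis
    unfolding tensor_lift_eq
    using formal_sum_value_equiv[OF assms(1-4)] formal_sum_value_point[OF assms(1) \<beta> xy] by simp
qed

text \<open>A formal sum is the combination of its points, as evaluation at each index shows. It
  turns \<open>contractions_determine\<close> at the identity into a statement on \<open>c\<close>
  itself.\<close>

lemma formal_sum_eq:
  assumes "c \<in> carrier F"
  shows "formal_sum_value R F \<delta> c = c"
proof
  fix w
  note c = tensor_freeD[OF assms]
  have ev: "(\<lambda>f. f w) \<in> module_hom R F (regular R)"
    by (rule formI) (auto simp: tensor_freeD(1), simp_all add: tensor_free_def)
  have "formal_sum_value R F \<delta> c w = (\<Oplus>z\<in>{z. c z \<noteq> \<zero>}. (c z \<odot>\<^bsub>F\<^esub> \<delta> (fst z) (snd z)) w)"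
    unfolding formal_sum_value_def using c
    by (intro F.form_finsum[OF ev]) (auto intro!: F.smult_closed point_in)
  also have "\<dots> = (\<Oplus>z\<in>{z. c z \<noteq> \<zero>}. if w = z then c z else \<zero>)"
    by (rule M.R.finsum_cong') (use c(1) in \<open>auto simp: tensor_free_def point_def\<close>)
  also have "\<dots> = c w"
  proof (cases "c w = \<zero>")
    case True
    then have "(\<Oplus>z\<in>{z. c z \<noteq> \<zero>}. if w = z then c z else \<zero>) = (\<Oplus>z\<in>{z. c z \<noteq> \<zero>}. \<zero>)"
      by (intro M.R.finsum_cong') auto
    then show ?thesis using True by simp
  next
    case False
    then show ?thesis using c by (intro M.R.finsum_singleton) auto
  qed
  finally show "formal_sum_value R F \<delta> c w = c w" .
qed

text \<open>
  Induction on the rank of \<open>\<phi>\<close>; for \<open>\<phi> = id\<close> this says that a tensor is determined by its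
  contractions with the linear forms of \<open>N\<close>.
\<close>

lemma contractions_determine:
  assumes "finite_rank R N \<phi>" and c: "c \<in> carrier F" and m: "m \<in> carrier M" and e: "e \<in> carrier N"
    and contr: "\<And>f. f \<in> module_hom R N (regular R) \<Longrightarrow>
      formal_sum_value R M (\<lambda>x y. f y \<odot>\<^bsub>M\<^esub> x) c = f e \<odot>\<^bsub>M\<^esub> m"
  shows "formal_sum_value R F (\<lambda>x y. \<delta> x (\<phi> y)) c \<approx> \<delta> m (\<phi> e)"
  using assms(1)
proof induction
  case zero
  note cD = tensor_freeD[OF c]
  have "formal_sum_value R F (\<lambda>x y. \<delta> x \<zero>\<^bsub>N\<^esub>) c \<approx> (\<Oplus>\<^bsub>F\<^esub>z\<in>{z. c z \<noteq> \<zero>}. c z \<odot>\<^bsub>F\<^esub> \<zero>\<^bsub>F\<^esub>)"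
    unfolding formal_sum_value_def using cD
    by (intro equiv_finsum equiv_smult equiv_zero_right) auto
  also have "\<dots> = \<zero>\<^bsub>F\<^esub>" using cD(1) by (simp del: free_on_simps)
  also have "\<zero>\<^bsub>F\<^esub> \<approx> \<delta> m \<zero>\<^bsub>N\<^esub>" by (rule equiv_sym[OF equiv_zero_right[OF m]])
  finally show ?case .
next
  case (step f w \<phi>)
  note cD = tensor_freeD[OF c]
  let ?Z = "{z. c z \<noteq> \<zero>}"
  have z: "c z \<in> carrier R" "fst z \<in> carrier M" "snd z \<in> carrier N" "f (snd z) \<in> carrier R"
    "\<phi> (snd z) \<in> carrier N" if "z \<in> ?Z" for z
    using cD that formD(1)[OF step(1)] N.finite_rank_closed[OF step(3)] by auto
  have fe: "f e \<in> carrier R" "\<phi> e \<in> carrier N"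
    using formD(1)[OF step(1) e] N.finite_rank_closed[OF step(3) e] .
  \<comment> \<open>The scalar \<open>f y\<close> crosses the tensor sign from \<open>w\<close> to
    \<open>x\<close>; the terms with second factor \<open>w\<close> can then be gathered.\<close>
  have pt: "\<delta> x (f y \<odot>\<^bsub>N\<^esub> w \<oplus>\<^bsub>N\<^esub> \<phi> y) \<approx> \<delta> (f y \<odot>\<^bsub>M\<^esub> x) w \<oplus>\<^bsub>F\<^esub> \<delta> x (\<phi> y)"
    if "x \<in> carrier M" "f y \<in> carrier R" "\<phi> y \<in> carrier N" for x y
  proof -
    have "\<delta> x (f y \<odot>\<^bsub>N\<^esub> w \<oplus>\<^bsub>N\<^esub> \<phi> y) \<approx> \<delta> x (f y \<odot>\<^bsub>N\<^esub> w) \<oplus>\<^bsub>F\<^esub> \<delta> x (\<phi> y)"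
      by (rule equiv_add_right) (use that step(2) in auto)
    also have "\<dots> \<approx> \<delta> (f y \<odot>\<^bsub>M\<^esub> x) w \<oplus>\<^bsub>F\<^esub> \<delta> x (\<phi> y)"
      by (intro equiv_add equiv_refl point_in
          equiv_trans[OF equiv_smult_right equiv_sym[OF equiv_smult_left]]) (use that step(2) in auto)
    finally show ?thesis .
  qed
  have "formal_sum_value R F (\<lambda>x y. \<delta> x (f y \<odot>\<^bsub>N\<^esub> w \<oplus>\<^bsub>N\<^esub> \<phi> y)) c \<approx>
      (\<Oplus>\<^bsub>F\<^esub>z\<in>?Z. \<delta> (c z \<odot>\<^bsub>M\<^esub> (f (snd z) \<odot>\<^bsub>M\<^esub> fst z)) w \<oplus>\<^bsub>F\<^esub> c z \<odot>\<^bsub>F\<^esub> \<delta> (fst z) (\<phi> (snd z)))"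
    unfolding formal_sum_value_def
  proof (rule equiv_finsum[OF cD(2)])
    fix v assume v: "v \<in> ?Z"
    have "c v \<odot>\<^bsub>F\<^esub> \<delta> (fst v) (f (snd v) \<odot>\<^bsub>N\<^esub> w \<oplus>\<^bsub>N\<^esub> \<phi> (snd v)) \<approx>
        c v \<odot>\<^bsub>F\<^esub> (\<delta> (f (snd v) \<odot>\<^bsub>M\<^esub> fst v) w \<oplus>\<^bsub>F\<^esub> \<delta> (fst v) (\<phi> (snd v)))"
      by (intro equiv_smult pt) (use z[OF v] in auto)
    also have "\<dots> = c v \<odot>\<^bsub>F\<^esub> \<delta> (f (snd v) \<odot>\<^bsub>M\<^esub> fst v) w \<oplus>\<^bsub>F\<^esub> c v \<odot>\<^bsub>F\<^esub> \<delta> (fst v) (\<phi> (snd v))"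
      by (rule F.smult_r_distr) (use z[OF v] step(2) in \<open>auto intro!: point_in\<close>)
    also have "\<dots> \<approx> \<delta> (c v \<odot>\<^bsub>M\<^esub> (f (snd v) \<odot>\<^bsub>M\<^esub> fst v)) w \<oplus>\<^bsub>F\<^esub> c v \<odot>\<^bsub>F\<^esub> \<delta> (fst v) (\<phi> (snd v))"
      by (intro equiv_add equiv_refl F.smult_closed point_in equiv_sym[OF equiv_smult_left])
        (use z[OF v] step(2) in auto)
    finally show "c v \<odot>\<^bsub>F\<^esub> \<delta> (fst v) (f (snd v) \<odot>\<^bsub>N\<^esub> w \<oplus>\<^bsub>N\<^esub> \<phi> (snd v)) \<approx> \<dots>" .
  qed
  also have "\<dots> = (\<Oplus>\<^bsub>F\<^esub>z\<in>?Z. \<delta> (c z \<odot>\<^bsub>M\<^esub> (f (snd z) \<odot>\<^bsub>M\<^esub> fst z)) w) \<oplus>\<^bsub>F\<^esub>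
      formal_sum_value R F (\<lambda>x y. \<delta> x (\<phi> y)) c"
    unfolding formal_sum_value_def
    by (rule F.M.finsum_addf) (use z step(2) in \<open>auto intro!: point_in F.smult_closed\<close>)
  \<comment> \<open>Gathering the first factors in front of the fixed \<open>w\<close> produces the
    contraction of \<open>c\<close> with \<open>f\<close>, known by hypothesis; the induction
    hypothesis handles the rest.\<close>
  also have "\<dots> \<approx> \<delta> (\<Oplus>\<^bsub>M\<^esub>z\<in>?Z. c z \<odot>\<^bsub>M\<^esub> (f (snd z) \<odot>\<^bsub>M\<^esub> fst z)) w \<oplus>\<^bsub>F\<^esub> \<delta> m (\<phi> e)"
    by (intro equiv_add step(4) equiv_sym[OF equiv_finsum_left]) (use cD z step(2) in auto)
  also have "(\<Oplus>\<^bsub>M\<^esub>z\<in>?Z. c z \<odot>\<^bsub>M\<^esub> (f (snd z) \<odot>\<^bsub>M\<^esub> fst z)) = f e \<odot>\<^bsub>M\<^esub> m"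
    using contr[OF step(1)] by (simp add: formal_sum_value_def)
  also have "\<delta> (f e \<odot>\<^bsub>M\<^esub> m) w \<oplus>\<^bsub>F\<^esub> \<delta> m (\<phi> e) \<approx> \<delta> m (f e \<odot>\<^bsub>N\<^esub> w \<oplus>\<^bsub>N\<^esub> \<phi> e)"
    by (rule equiv_sym[OF pt[OF m fe]])
  finally show ?case .
next
  case (cong \<phi> \<psi>)
  have "formal_sum_value R F (\<lambda>x y. \<delta> x (\<psi> y)) c = formal_sum_value R F (\<lambda>x y. \<delta> x (\<phi> y)) c"
    unfolding formal_sum_value_def using tensor_freeD[OF c] N.finite_rank_closed[OF cong(1)]
    by (intro F.M.finsum_cong') (auto simp: cong(2)[symmetric] intro!: F.smult_closed point_in)
  then show ?case using cong(3) cong(2)[OF e] by simp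
qed

lemma tensor_eq_tensI:
  assumes "finite_rank R N (\<lambda>y. y)" and t: "t \<in> carrier (tensor_module R M N)"
    and "m \<in> carrier M" "e \<in> carrier N"
    and "\<And>f. f \<in> module_hom R N (regular R) \<Longrightarrow>
      tensor_lift R M (\<lambda>x y. f y \<odot>\<^bsub>M\<^esub> x) t = f e \<odot>\<^bsub>M\<^esub> m"
  shows "t = tens R M N m e"
proof -
  define c where "c = (SOME c. c \<in> t)"
  have c: "c \<in> carrier F" "K +>\<^bsub>F\<^esub> c = t" using representative[OF t] by (simp_all add: c_def)
  have "c \<approx> \<delta> m e"
    using contractions_determine[OF assms(1) c(1) assms(3,4)] assms(5) formal_sum_eq[OF c(1)]
    by (simp add: tensor_lift_eq c_def)
  then show ?thesis using equiv_coset_eq c(2) by (simp add: tens_def)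
qed

end

section \<open>The action of the dual algebra\<close>

lemma dual_hopf_simps [simp]:
  "carrier (dual_hopf R A) = linear_forms R A"
  "zero (dual_hopf R A) = (\<lambda>a\<in>carrier A. \<zero>\<^bsub>R\<^esub>)"
  "one (dual_hopf R A) = (\<lambda>a\<in>carrier A. counit A a)"
  "f \<oplus>\<^bsub>dual_hopf R A\<^esub> h = (\<lambda>a\<in>carrier A. f a \<oplus>\<^bsub>R\<^esub> h a)"
  "r \<odot>\<^bsub>dual_hopf R A\<^esub> f = (\<lambda>a\<in>carrier A. r \<otimes>\<^bsub>R\<^esub> f a)"
  "counit (dual_hopf R A) f = f \<one>\<^bsub>A\<^esub>"
  "antipode (dual_hopf R A) f = (\<lambda>a\<in>carrier A. f (antipode A a))"
  by (simp_all add: dual_hopf_def dual_algebra_def module.defs hopf.defs)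

lemma dual_hopf_mult:
  "f \<otimes>\<^bsub>dual_hopf R A\<^esub> h =
    (\<lambda>a\<in>carrier A. tensor_lift R (regular R) (\<lambda>x y. f x \<otimes>\<^bsub>R\<^esub> h y) (comult A a))"
  by (simp add: dual_hopf_def dual_algebra_def module.defs hopf.defs)

lemma tensor_algebra_carrier [simp]: "carrier (tensor_algebra R M N) = carrier (tensor_module R M N)"
  by (simp add: tensor_algebra_def Let_def)

lemma as_dual_module_simps [simp]:
  "carrier (as_dual_module R M \<alpha>) = carrier M"
  "zero (as_dual_module R M \<alpha>) = zero M"
  "add (as_dual_module R M \<alpha>) = add M"
  "smult (as_dual_module R M \<alpha>) = dual_action R M \<alpha>"
  by (simp_all add: as_dual_module_def)

lemma linear_formsD: "f \<in> linear_forms R M \<Longrightarrow> f \<in> module_hom R M (regular R)"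
  by (simp add: linear_forms_def)

text \<open>Members of \<open>linear_forms\<close> are extensional, so a linear map has to be cut
  off outside the carrier before it counts as an element of the dual.\<close>

lemma restrict_linear_form:
  assumes "module R M" "f \<in> module_hom R M (regular R)"
  shows "restrict f (carrier M) \<in> linear_forms R M"
proof -
  interpret module R M by fact
  show ?thesis using formD[OF assms(2)] by (auto simp: linear_forms_def intro!: formI)
qed

text \<open>The ring axioms of the dual algebra and the associativity of its action are contained in
  the notion of projective module, whence the parent \<open>left_module\<close>. Of the local
  freeness of \<open>A\<close>, the finite dual basis is retained.\<close>

locale dual_action_module = hopf_algebra R A + C: comodule R A M \<alpha> +
    D: left_module "dual_hopf R A" "as_dual_module R M \<alpha>"
  for R :: "('r, 'c) ring_scheme" and A :: "('r, 'a, 'd) hopf_scheme"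
    and M :: "('r, 'm, 'e) module_scheme" and \<alpha> :: "'m \<Rightarrow> ('m \<times> 'a \<Rightarrow> 'r) set" +
  assumes finite_rank_id: "finite_rank R A (\<lambda>a. a)"
begin

abbreviation H :: "('r, 'a \<Rightarrow> 'r) hopf" where
  "H \<equiv> dual_hopf R A"

abbreviation act :: "('a \<Rightarrow> 'r) \<Rightarrow> 'm \<Rightarrow> 'm" where
  "act \<equiv> dual_action R M \<alpha>"

lemma module_A: "module R A"
  by (rule module_axioms)

lemma module_M: "module R M"
  by (rule C.module_axioms)

lemma tensor_pair_A: "tensor_pair R A A"
  by (intro tensor_pair.intro module_A)

lemma tensor_pair_M: "tensor_pair R M A"
  by (intro tensor_pair.intro module_A module_M)

lemma comult_in: "a \<in> carrier A \<Longrightarrow> comult A a \<in> carrier (tensor_module R A A)"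
  using module_hom_closed[OF comult_linear] by auto

lemma coaction_in: "m \<in> carrier M \<Longrightarrow> \<alpha> m \<in> carrier (tensor_module R M A)"
  using module_hom_closed[OF C.coaction_linear] by auto

lemma dual_smult_closed:
  assumes "r \<in> carrier R" "f \<in> carrier H"
  shows "r \<odot>\<^bsub>H\<^esub> f \<in> carrier H"
proof -
  note f = formD[OF linear_formsD[OF assms(2)[unfolded dual_hopf_simps]]]
  have "(\<lambda>a. r \<otimes>\<^bsub>R\<^esub> f a) \<in> module_hom R A (regular R)"
    by (rule formI) (use assms(1) in \<open>auto simp: f R.r_distr R.m_lcomm\<close>)
  then show ?thesis by (simp add: restrict_linear_form[OF module_A])
qed

text \<open>Scalars are central in the dual algebra. The ring structure supplied by
  \<open>left_module\<close> does not mention \<open>R\<close>, so this is read off from the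
  convolution formula.\<close>

lemma dual_mult_smult:
  assumes "r \<in> carrier R" "f \<in> carrier H" "h \<in> carrier H"
  shows "f \<otimes>\<^bsub>H\<^esub> (r \<odot>\<^bsub>H\<^esub> h) = r \<odot>\<^bsub>H\<^esub> (f \<otimes>\<^bsub>H\<^esub> h)"
    and "(r \<odot>\<^bsub>H\<^esub> f) \<otimes>\<^bsub>H\<^esub> h = r \<odot>\<^bsub>H\<^esub> (f \<otimes>\<^bsub>H\<^esub> h)"
proof -
  note f = formD(1)[OF linear_formsD[OF assms(2)[unfolded dual_hopf_simps]]]
  note h = formD(1)[OF linear_formsD[OF assms(3)[unfolded dual_hopf_simps]]]
  note pull = tensor_pair.formal_sum_value_smult[OF tensor_pair_A R.regular_module
      tensor_pair.representative(1)[OF tensor_pair_A comult_in] assms(1),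
      where \<beta> = "\<lambda>x y. f x \<otimes>\<^bsub>R\<^esub> h y"]
  show "f \<otimes>\<^bsub>H\<^esub> (r \<odot>\<^bsub>H\<^esub> h) = r \<odot>\<^bsub>H\<^esub> (f \<otimes>\<^bsub>H\<^esub> h)"
    unfolding dual_hopf_mult dual_hopf_simps tensor_lift_eq
    by (rule restrict_ext, simp, subst pull) (auto simp: f h assms(1) R.m_lcomm)
  show "(r \<odot>\<^bsub>H\<^esub> f) \<otimes>\<^bsub>H\<^esub> h = r \<odot>\<^bsub>H\<^esub> (f \<otimes>\<^bsub>H\<^esub> h)"
    unfolding dual_hopf_mult dual_hopf_simps tensor_lift_eq
    by (rule restrict_ext, simp, subst pull) (auto simp: f h assms(1) R.m_assoc)
qed

lemma act_closed: "\<lbrakk>g \<in> carrier H; m \<in> carrier M\<rbrakk> \<Longrightarrow> act g m \<in> carrier M"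
  using D.smult_closed[of g m] by simp

lemma act_mult: "\<lbrakk>g \<in> carrier H; h \<in> carrier H; m \<in> carrier M\<rbrakk> \<Longrightarrow> act (g \<otimes>\<^bsub>H\<^esub> h) m = act g (act h m)"
  using D.smult_assoc1[of g h m] by simp

lemma act_add_right:
  "\<lbrakk>g \<in> carrier H; m \<in> carrier M; n \<in> carrier M\<rbrakk> \<Longrightarrow> act g (m \<oplus>\<^bsub>M\<^esub> n) = act g m \<oplus>\<^bsub>M\<^esub> act g n"
  using D.smult_r_distr[of g m n] by simp

lemma act_one: "m \<in> carrier M \<Longrightarrow> act \<one>\<^bsub>H\<^esub> m = m"
  using D.smult_one[of m] by simp

lemma one_in: "\<one>\<^bsub>H\<^esub> \<in> carrier H"
  by (rule D.B.one_closed)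

lemma act_smult_left:
  assumes "r \<in> carrier R" "g \<in> carrier H" "m \<in> carrier M"
  shows "act (r \<odot>\<^bsub>H\<^esub> g) m = r \<odot>\<^bsub>M\<^esub> act g m"
  unfolding dual_action_def tensor_lift_eq dual_hopf_simps
  by (rule tensor_pair.formal_sum_value_smult[OF tensor_pair_M module_M
        tensor_pair.representative(1)[OF tensor_pair_M coaction_in[OF assms(3)]] assms(1)])
    (use assms in \<open>auto simp: C.smult_assoc1 formD(1)[OF linear_formsD]\<close>)

text \<open>The multiples of the unit of the dual algebra recover the action of \<open>R\<close> on
  \<open>M\<close>. Maps linear over the dual algebra, such as a splitting of \<open>M\<close> off a
  free module, thereby become linear over \<open>R\<close>.\<close>

lemma scalar_act: "\<lbrakk>r \<in> carrier R; m \<in> carrier M\<rbrakk> \<Longrightarrow> act (r \<odot>\<^bsub>H\<^esub> \<one>\<^bsub>H\<^esub>) m = r \<odot>\<^bsub>M\<^esub> m"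
  using act_smult_left[OF _ one_in] act_one by simp

lemma dual_mult_scalar:
  assumes "r \<in> carrier R" "g \<in> carrier H"
  shows "g \<otimes>\<^bsub>H\<^esub> (r \<odot>\<^bsub>H\<^esub> \<one>\<^bsub>H\<^esub>) = r \<odot>\<^bsub>H\<^esub> g" "(r \<odot>\<^bsub>H\<^esub> \<one>\<^bsub>H\<^esub>) \<otimes>\<^bsub>H\<^esub> g = r \<odot>\<^bsub>H\<^esub> g"
  using dual_mult_smult[OF assms(1) assms(2) one_in] dual_mult_smult[OF assms(1) one_in assms(2)]
    D.B.r_one[OF assms(2)] D.B.l_one[OF assms(2)] by (simp_all del: dual_hopf_simps)

lemma act_smult_right:
  assumes "r \<in> carrier R" "g \<in> carrier H" "m \<in> carrier M"
  shows "act g (r \<odot>\<^bsub>M\<^esub> m) = r \<odot>\<^bsub>M\<^esub> act g m"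
proof -
  have "act g (r \<odot>\<^bsub>M\<^esub> m) = act (g \<otimes>\<^bsub>H\<^esub> (r \<odot>\<^bsub>H\<^esub> \<one>\<^bsub>H\<^esub>)) m"
    using assms scalar_act act_mult[OF assms(2) dual_smult_closed[OF assms(1) one_in] assms(3)]
    by (simp del: dual_hopf_simps)
  then show ?thesis
    using assms act_smult_left by (simp only: dual_mult_scalar)
qed

lemma coinvariants_iff:
  "m \<in> coinvariants R A M \<alpha> \<longleftrightarrow> m \<in> carrier M \<and> (\<forall>g\<in>carrier H. act g m = g \<one>\<^bsub>A\<^esub> \<odot>\<^bsub>M\<^esub> m)"
proof (intro iffI conjI ballI)
  assume m: "m \<in> coinvariants R A M \<alpha>"
  then show "m \<in> carrier M" by (simp add: coinvariants_def)
  fix g assume "g \<in> carrier H"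
  then have g: "g \<in> module_hom R A (regular R)" by (auto dest: linear_formsD)
  show "act g m = g \<one>\<^bsub>A\<^esub> \<odot>\<^bsub>M\<^esub> m"
    using m formD[OF g] unfolding dual_action_def coinvariants_def
    by (auto simp: module_hom_def C.smult_r_distr C.smult_l_distr C.smult_assoc1[symmetric] R.m_comm
        intro!: tensor_pair.tensor_lift_tens[OF tensor_pair_M module_M])
next
  assume "m \<in> carrier M \<and> (\<forall>g\<in>carrier H. act g m = g \<one>\<^bsub>A\<^esub> \<odot>\<^bsub>M\<^esub> m)"
  then have m: "m \<in> carrier M" and inv: "\<And>g. g \<in> carrier H \<Longrightarrow> act g m = g \<one>\<^bsub>A\<^esub> \<odot>\<^bsub>M\<^esub> m" by auto
  have "\<alpha> m = tens R M A m \<one>\<^bsub>A\<^esub>"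
  proof (rule tensor_pair.tensor_eq_tensI[OF tensor_pair_M finite_rank_id coaction_in[OF m] m])
    fix f assume f: "f \<in> module_hom R A (regular R)"
    let ?f = "restrict f (carrier A)"
    \<comment> \<open>Contraction with \<open>f\<close> is the action of its restriction to
      \<open>carrier A\<close>; the factor \<open>\<one>\<close> lets
      \<open>formal_sum_value_smult\<close> identify the two.\<close>
    have "tensor_lift R M (\<lambda>x y. f y \<odot>\<^bsub>M\<^esub> x) (\<alpha> m) = \<one>\<^bsub>R\<^esub> \<odot>\<^bsub>M\<^esub> act ?f m"
      unfolding dual_action_def tensor_lift_eq
      by (rule tensor_pair.formal_sum_value_smult[OF tensor_pair_M module_M
            tensor_pair.representative(1)[OF tensor_pair_M coaction_in[OF m]]])
        (use formD(1)[OF f] in auto)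
    also have "\<dots> = act ?f m"
      using act_closed[of ?f m] restrict_linear_form[OF module_A f] m by simp
    also have "\<dots> = f \<one>\<^bsub>A\<^esub> \<odot>\<^bsub>M\<^esub> m"
      using inv[of ?f] restrict_linear_form[OF module_A f] by simp
    finally show "tensor_lift R M (\<lambda>x y. f y \<odot>\<^bsub>M\<^esub> x) (\<alpha> m) = f \<one>\<^bsub>A\<^esub> \<odot>\<^bsub>M\<^esub> m" .
  qed simp
  then show "m \<in> coinvariants R A M \<alpha>" using m by (simp add: coinvariants_def)
qed

lemma antipode_closed: "a \<in> carrier A \<Longrightarrow> antipode A a \<in> carrier A"
  using module_hom_closed[OF antipode_linear] by auto

text \<open>The antipode axiom evaluated at the unit, whose comultiplication is the tensor of the
  unit with itself. Consequently the antipode of the dual preserves the value at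
  \<open>\<one>\<close>, that is, the counit of the dual.\<close>

lemma antipode_one: "antipode A \<one>\<^bsub>A\<^esub> = \<one>\<^bsub>A\<^esub>"
proof -
  have "comult A \<one>\<^bsub>A\<^esub> = tens R A A \<one>\<^bsub>A\<^esub> \<one>\<^bsub>A\<^esub>"
    using ring_hom_one[OF comult_ring_hom] by (simp add: tensor_algebra_def Let_def)
  moreover have "tensor_lift R A (\<lambda>x y. antipode A x \<otimes>\<^bsub>A\<^esub> y) (tens R A A \<one>\<^bsub>A\<^esub> \<one>\<^bsub>A\<^esub>)
      = antipode A \<one>\<^bsub>A\<^esub> \<otimes>\<^bsub>A\<^esub> \<one>\<^bsub>A\<^esub>"
    by (rule tensor_pair.tensor_lift_tens[OF tensor_pair_A module_A])
      (auto simp: module_hom_def antipode_closed module_hom_add[OF antipode_linear]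
        module_hom_smult[OF antipode_linear] A.l_distr A.r_distr smult_mult_left smult_mult_right)
  moreover have "counit A \<one>\<^bsub>A\<^esub> = \<one>\<^bsub>R\<^esub>" using ring_hom_one[OF counit_ring_hom] .
  ultimately show ?thesis using antipode_left[of "\<one>\<^bsub>A\<^esub>"] antipode_closed[of "\<one>\<^bsub>A\<^esub>"] by simp
qed

lemma dual_antipode_closed:
  assumes "g \<in> carrier H"
  shows "antipode H g \<in> carrier H"
proof -
  note g = formD[OF linear_formsD[OF assms[unfolded dual_hopf_simps]]]
  have "(\<lambda>a. g (antipode A a)) \<in> module_hom R A (regular R)"
    by (rule formI) (simp_all add: g antipode_closed module_hom_add[OF antipode_linear]
        module_hom_smult[OF antipode_linear])
  then show ?thesis by (simp add: restrict_linear_form[OF module_A])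
qed

lemma coinvariants_submodule: "submodule R (coinvariants R A M \<alpha>) M"
proof (rule submodule.intro[OF module_M])
  have g1: "g \<one>\<^bsub>A\<^esub> \<in> carrier R" if "g \<in> carrier H" for g
    using that by (simp add: formD(1)[OF linear_formsD])
  show "coinvariants R A M \<alpha> \<subseteq> carrier M" by (auto simp: coinvariants_def)
  have "act g \<zero>\<^bsub>M\<^esub> = \<zero>\<^bsub>M\<^esub>" if "g \<in> carrier H" for g
    using act_smult_right[of "\<zero>\<^bsub>R\<^esub>" g "\<zero>\<^bsub>M\<^esub>"] act_closed[of g "\<zero>\<^bsub>M\<^esub>"] that by simp
  then show "\<zero>\<^bsub>M\<^esub> \<in> coinvariants R A M \<alpha>" using g1 by (simp add: coinvariants_iff)
  show "v \<oplus>\<^bsub>M\<^esub> w \<in> coinvariants R A M \<alpha>"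
    if "v \<in> coinvariants R A M \<alpha>" "w \<in> coinvariants R A M \<alpha>" for v w
    using that g1 by (simp add: coinvariants_iff act_add_right C.smult_r_distr)
  show "c \<odot>\<^bsub>M\<^esub> v \<in> coinvariants R A M \<alpha>" if "c \<in> carrier R" "v \<in> coinvariants R A M \<alpha>" for c v
    using that g1 by (simp add: coinvariants_iff act_smult_right C.smult_assoc1[symmetric] R.m_comm)
qed

end

section \<open>Integrals and coinvariants\<close>

lemma (in module) lincomb_singleton:
  assumes "x \<in> carrier M" "a x \<in> carrier R"
  shows "lincomb a {x} = a x \<odot>\<^bsub>M\<^esub> x"
  using assms by (simp add: lincomb_def)

locale projective_dual_module = dual_action_module R A M \<alpha>
  for R :: "('r, 'c) ring_scheme" and A :: "('r, 'a, 'd) hopf_scheme"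
    and M :: "('r, 'm, 'e) module_scheme" and \<alpha> :: "'m \<Rightarrow> ('m \<times> 'a \<Rightarrow> 'r) set" +
  fixes \<theta> :: "'a \<Rightarrow> 'r" and I :: "'m set" and i :: "'m \<Rightarrow> 'm \<Rightarrow> 'a \<Rightarrow> 'r" and p :: "('m \<Rightarrow> 'a \<Rightarrow> 'r) \<Rightarrow> 'm"
  assumes integral_module: "module R (integral_module H)"
    and basis: "is_basis R (integral_module H) {\<theta>}"
    and unimodular: "unimodular H"
    and section_hom: "i \<in> module_hom H (as_dual_module R M \<alpha>) (free_on H I)"
    and retraction_hom: "p \<in> module_hom H (free_on H I) (as_dual_module R M \<alpha>)"
    and retraction_section: "x \<in> carrier M \<Longrightarrow> p (i x) = x"
begin

abbreviation MA :: "('r, 'm, 'e) module_scheme" where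
  "MA \<equiv> M\<lparr>carrier := coinvariants R A M \<alpha>\<rparr>"

lemma theta_integral: "\<theta> \<in> left_integrals H"
  using basis by (simp add: is_basis_def integral_module_def)

lemma theta_in: "\<theta> \<in> carrier H"
  using theta_integral by (simp add: left_integrals_def)

lemma left_mult_theta: "g \<in> carrier H \<Longrightarrow> g \<otimes>\<^bsub>H\<^esub> \<theta> = g \<one>\<^bsub>A\<^esub> \<odot>\<^bsub>H\<^esub> \<theta>"
  using theta_integral by (simp add: left_integrals_def del: dual_hopf_simps(5))

lemma right_mult_theta: "g \<in> carrier H \<Longrightarrow> \<theta> \<otimes>\<^bsub>H\<^esub> g = g \<one>\<^bsub>A\<^esub> \<odot>\<^bsub>H\<^esub> \<theta>"
  using theta_integral unimodular
  by (simp add: unimodular_def right_integrals_def del: dual_hopf_simps(5))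

lemma integral_multiple:
  assumes "f \<in> left_integrals H"
  shows "\<exists>r\<in>carrier R. f = r \<odot>\<^bsub>H\<^esub> \<theta>"
proof -
  interpret J: module R "integral_module H" by (rule integral_module)
  have "f \<in> J.span {\<theta>}" "{\<theta>} \<subseteq> carrier (integral_module H)"
    using assms basis by (auto simp: is_basis_def integral_module_def)
  then obtain a where a: "a \<in> {\<theta>} \<rightarrow> carrier R" "J.lincomb a {\<theta>} = f"
    using J.finite_in_span[of "{\<theta>}" f] by auto
  moreover have "\<theta> \<in> carrier (integral_module H)"
    using theta_integral by (simp add: integral_module_def)
  ultimately have "f = a \<theta> \<odot>\<^bsub>integral_module H\<^esub> \<theta>"
    using J.lincomb_singleton[of \<theta> a] by simp
  then show ?thesis using a(1) by (auto simp: integral_module_def)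
qed

text \<open>Independence of the single element \<open>\<theta>\<close>: the coefficient of an
  integral is unique, and linearity of \<open>coord\<close> follows from this.\<close>

lemma theta_cancel:
  assumes "r \<in> carrier R" "s \<in> carrier R" "r \<odot>\<^bsub>H\<^esub> \<theta> = s \<odot>\<^bsub>H\<^esub> \<theta>"
  shows "r = s"
proof -
  interpret J: module R "integral_module H" by (rule integral_module)
  have th: "{\<theta>} \<subseteq> carrier (integral_module H)" "\<not> J.lin_dep {\<theta>}"
    using basis by (auto simp: is_basis_def)
  have indep: "\<forall>x\<in>{\<theta>}. c x = \<zero>\<^bsub>R\<^esub>"
    if "c \<in> {\<theta>} \<rightarrow> carrier R" "J.lincomb c {\<theta>} = \<zero>\<^bsub>integral_module H\<^esub>" for c
    using J.lin_dep_crit[of "{\<theta>}" "{\<theta>}" c \<theta>] th that by auto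
  have lc: "J.lincomb (\<lambda>_. c) {\<theta>} = c \<odot>\<^bsub>H\<^esub> \<theta>" if "c \<in> carrier R" for c
    using J.lincomb_singleton[of \<theta> "\<lambda>_. c"] th(1) that by (simp add: integral_module_def)
  have eq: "J.lincomb (\<lambda>_. r) {\<theta>} = J.lincomb (\<lambda>_. s) {\<theta>}"
    using assms(3) by (simp only: lc[OF assms(1)] lc[OF assms(2)])
  show ?thesis
    by (rule J.lincomb_unique[where c = "\<lambda>_. r" and d = "\<lambda>_. s" and x = \<theta>, OF _ th(1) indep _ _ eq])
      (use assms(1,2) in simp_all)
qed

section \<open>Coordinates of the splitting\<close>

lemma section_closed:
  assumes "x \<in> carrier M"
  shows "i x \<in> carrier (free_on H I)"
  using section_hom assms by (auto simp: module_hom_def)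

lemma section_coeff: "x \<in> carrier M \<Longrightarrow> i x k \<in> carrier H"
  using D.B.free_onD(1)[OF section_closed] .

lemma section_add: "\<lbrakk>x \<in> carrier M; y \<in> carrier M\<rbrakk> \<Longrightarrow> i (x \<oplus>\<^bsub>M\<^esub> y) k = i x k \<oplus>\<^bsub>H\<^esub> i y k"
  using section_hom by (auto simp: module_hom_def)

lemma section_act: "\<lbrakk>g \<in> carrier H; x \<in> carrier M\<rbrakk> \<Longrightarrow> i (act g x) k = g \<otimes>\<^bsub>H\<^esub> i x k"
  using section_hom by (auto simp: module_hom_def)

lemma section_smult:
  assumes "r \<in> carrier R" "x \<in> carrier M"
  shows "i (r \<odot>\<^bsub>M\<^esub> x) k = r \<odot>\<^bsub>H\<^esub> i x k"
  using section_act[OF dual_smult_closed[OF assms(1) one_in] assms(2), of k]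
  by (simp only: scalar_act[OF assms] dual_mult_scalar[OF assms(1) section_coeff[OF assms(2)]])

lemma retraction_closed: "v \<in> carrier (free_on H I) \<Longrightarrow> p v \<in> carrier M"
  using retraction_hom by (auto simp: module_hom_def)

lemma retraction_add:
  "\<lbrakk>v \<in> carrier (free_on H I); w \<in> carrier (free_on H I)\<rbrakk>
    \<Longrightarrow> p (\<lambda>k. v k \<oplus>\<^bsub>H\<^esub> w k) = p v \<oplus>\<^bsub>M\<^esub> p w"
  using module_hom_add[OF retraction_hom, of v w] by (simp only: free_on_simps as_dual_module_simps)

lemma retraction_act:
  "\<lbrakk>g \<in> carrier H; v \<in> carrier (free_on H I)\<rbrakk> \<Longrightarrow> p (\<lambda>k. g \<otimes>\<^bsub>H\<^esub> v k) = act g (p v)"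
  using module_hom_smult[OF retraction_hom, of g v] by (simp only: free_on_simps as_dual_module_simps)

lemma act_theta_coinvariant:
  assumes "m \<in> carrier M"
  shows "act \<theta> m \<in> coinvariants R A M \<alpha>"
proof -
  have "act g (act \<theta> m) = g \<one>\<^bsub>A\<^esub> \<odot>\<^bsub>M\<^esub> act \<theta> m" if g: "g \<in> carrier H" for g
  proof -
    have "g \<one>\<^bsub>A\<^esub> \<in> carrier R" using g by (simp add: formD(1)[OF linear_formsD])
    then show ?thesis
      using act_mult[OF g theta_in assms] act_smult_left[OF _ theta_in assms]
      by (simp only: left_mult_theta[OF g])
  qed
  then show ?thesis using act_closed[OF theta_in assms] by (simp add: coinvariants_iff)
qed

text \<open>The section is linear over the dual algebra and over \<open>R\<close>, so the equations
  \<open>g m = g(\<one>) m\<close> pass to every entry of \<open>i m\<close>, where they are the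
  equations of a left integral.\<close>

lemma section_coinvariant:
  assumes "m \<in> coinvariants R A M \<alpha>"
  shows "\<exists>r\<in>carrier R. i m k = r \<odot>\<^bsub>H\<^esub> \<theta>"
proof (rule integral_multiple)
  have m: "m \<in> carrier M" "\<And>g. g \<in> carrier H \<Longrightarrow> act g m = g \<one>\<^bsub>A\<^esub> \<odot>\<^bsub>M\<^esub> m"
    using assms by (auto simp: coinvariants_iff)
  have "g \<otimes>\<^bsub>H\<^esub> i m k = g \<one>\<^bsub>A\<^esub> \<odot>\<^bsub>H\<^esub> i m k" if g: "g \<in> carrier H" for g
  proof -
    have "g \<one>\<^bsub>A\<^esub> \<in> carrier R" using g by (simp add: formD(1)[OF linear_formsD])
    then show ?thesis using section_act[OF g m(1), of k] section_smult[OF _ m(1), of _ k] m(2)[OF g] by simp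
  qed
  then show "i m k \<in> left_integrals H"
    using section_coeff[OF m(1)] by (simp add: left_integrals_def del: dual_hopf_simps(5))
qed

text \<open>Meaningful for coinvariant \<open>m\<close>, where the entries of the section are
  multiples of \<open>\<theta>\<close>; the choice is then unique by
  \<open>theta_cancel\<close>.\<close>

definition coord :: "'m \<Rightarrow> 'm \<Rightarrow> 'r" where
  "coord k m = (SOME r. r \<in> carrier R \<and> i m k = r \<odot>\<^bsub>H\<^esub> \<theta>)"

lemma coord:
  assumes "m \<in> coinvariants R A M \<alpha>"
  shows "coord k m \<in> carrier R" "i m k = coord k m \<odot>\<^bsub>H\<^esub> \<theta>"
  using someI_ex[of "\<lambda>r. r \<in> carrier R \<and> i m k = r \<odot>\<^bsub>H\<^esub> \<theta>"] section_coinvariant[OF assms, of k]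
  unfolding coord_def by blast+

lemma dual_zero_smult: "h \<in> carrier H \<Longrightarrow> \<zero>\<^bsub>R\<^esub> \<odot>\<^bsub>H\<^esub> h = \<zero>\<^bsub>H\<^esub>"
  by (auto intro!: restrict_ext simp: formD(1)[OF linear_formsD])

lemma coinvariants_eq: "coinvariants R A M \<alpha> = act \<theta> ` carrier M"
proof
  show "act \<theta> ` carrier M \<subseteq> coinvariants R A M \<alpha>" using act_theta_coinvariant by auto
  show "coinvariants R A M \<alpha> \<subseteq> act \<theta> ` carrier M"
  proof
    fix m assume m: "m \<in> coinvariants R A M \<alpha>"
    then have mM: "m \<in> carrier M" by (simp add: coinvariants_iff)
    \<comment> \<open>A preimage under \<open>\<theta>\<close> in the free module: the entry
      \<open>r \<theta>\<close> of \<open>i m\<close> is \<open>\<theta>\<close> times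
      \<open>r \<one>\<close>, so each integral is replaced by its scalar.\<close>
    define v where "v k = coord k m \<odot>\<^bsub>H\<^esub> \<one>\<^bsub>H\<^esub>" for k
    have vH: "v k \<in> carrier H" for k
      unfolding v_def by (rule dual_smult_closed[OF coord(1)[OF m] one_in])
    \<comment> \<open>The finite support of \<open>i m\<close> passes to \<open>v\<close>, since a
      vanishing multiple of \<open>\<theta>\<close> has coefficient zero.\<close>
    have v0: "v k = \<zero>\<^bsub>H\<^esub>" if "i m k = \<zero>\<^bsub>H\<^esub>" for k
    proof -
      have "coord k m = \<zero>\<^bsub>R\<^esub>"
        by (rule theta_cancel[OF coord(1)[OF m] R.zero_closed])
          (simp only: coord(2)[OF m, symmetric] that dual_zero_smult[OF theta_in])
      then show ?thesis unfolding v_def by (simp only: dual_zero_smult[OF one_in])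
    qed
    have "{k. v k \<noteq> \<zero>\<^bsub>H\<^esub>} \<subseteq> {k. i m k \<noteq> \<zero>\<^bsub>H\<^esub>}" using v0 by blast
    then have v: "v \<in> carrier (free_on H I)"
      using D.B.free_onD(2,3)[OF section_closed[OF mM]] vH finite_subset
      unfolding free_on_carrier by blast
    have "(\<lambda>k. \<theta> \<otimes>\<^bsub>H\<^esub> v k) = i m"
      unfolding v_def by (simp only: dual_mult_scalar(1)[OF coord(1)[OF m] theta_in] coord(2)[OF m, symmetric])
    then have "m = act \<theta> (p v)"
      using retraction_act[OF theta_in v] retraction_section[OF mM] by simp
    then show "m \<in> act \<theta> ` carrier M" using retraction_closed[OF v] by auto
  qed
qed

lemma module_MA: "module R MA"
  by (rule C.submodule_is_module[OF coinvariants_submodule])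

lemma coord_hom: "coord k \<in> module_hom R MA (regular R)"
proof (rule formI)
  interpret N: submodule R "coinvariants R A M \<alpha>" M by (rule coinvariants_submodule)
  have M: "x \<in> carrier M" if "x \<in> coinvariants R A M \<alpha>" for x using that by (simp add: coinvariants_iff)
  fix a assume "a \<in> carrier MA"
  then have a: "a \<in> coinvariants R A M \<alpha>" by simp
  show "coord k a \<in> carrier R" by (rule coord(1)[OF a])
  show "coord k (a \<oplus>\<^bsub>MA\<^esub> b) = coord k a \<oplus>\<^bsub>R\<^esub> coord k b" if "b \<in> carrier MA" for b
  proof -
    have b: "b \<in> coinvariants R A M \<alpha>" using that by simp
    have "coord k (a \<oplus>\<^bsub>M\<^esub> b) \<odot>\<^bsub>H\<^esub> \<theta> = coord k a \<odot>\<^bsub>H\<^esub> \<theta> \<oplus>\<^bsub>H\<^esub> coord k b \<odot>\<^bsub>H\<^esub> \<theta>"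
      using section_add[OF M[OF a] M[OF b], of k]
      by (simp only: coord(2)[OF a, symmetric] coord(2)[OF b, symmetric] coord(2)[OF N.m_closed[OF a b], symmetric])
    also have "\<dots> = (coord k a \<oplus>\<^bsub>R\<^esub> coord k b) \<odot>\<^bsub>H\<^esub> \<theta>"
      using coord(1)[OF a] coord(1)[OF b] theta_in
      by (auto intro!: restrict_ext simp: formD(1)[OF linear_formsD] R.l_distr)
    finally show ?thesis
      using theta_cancel[OF coord(1)[OF N.m_closed[OF a b]]] coord(1)[OF a] coord(1)[OF b]
      by (simp del: dual_hopf_simps)
  qed
  show "coord k (r \<odot>\<^bsub>MA\<^esub> a) = r \<otimes>\<^bsub>R\<^esub> coord k a" if r: "r \<in> carrier R" for r
  proof -
    have "coord k (r \<odot>\<^bsub>M\<^esub> a) \<odot>\<^bsub>H\<^esub> \<theta> = r \<odot>\<^bsub>H\<^esub> (coord k a \<odot>\<^bsub>H\<^esub> \<theta>)"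
      using section_smult[OF r M[OF a], of k]
      by (simp only: coord(2)[OF a, symmetric] coord(2)[OF N.smult_closed[OF r a], symmetric])
    also have "\<dots> = (r \<otimes>\<^bsub>R\<^esub> coord k a) \<odot>\<^bsub>H\<^esub> \<theta>"
      using coord(1)[OF a] r theta_in
      by (auto intro!: restrict_ext simp: formD(1)[OF linear_formsD] R.m_assoc)
    finally show ?thesis
      using theta_cancel[OF coord(1)[OF N.smult_closed[OF r a]]] coord(1)[OF a] r
      by (simp del: dual_hopf_simps)
  qed
qed

text \<open>The free module may have infinite rank. Finitely many generators of \<open>M\<close>
  over \<open>R\<close> have only finitely many nonzero entries together, and vanishing of an entry
  passes to linear combinations.\<close>

lemma section_support:
  "\<exists>J. finite J \<and> J \<subseteq> I \<and> (\<forall>x\<in>carrier M. \<forall>k. k \<notin> J \<longrightarrow> i x k = \<zero>\<^bsub>H\<^esub>)"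
proof -
  obtain G where G: "finite G" "G \<subseteq> carrier M" "C.span G = carrier M"
    using C.fg_locally_free by (auto simp: fg_locally_free_def finitely_generated_def)
  define J where "J = (\<Union>g\<in>G. {k. i g k \<noteq> \<zero>\<^bsub>H\<^esub>})"
  have J: "finite J" "J \<subseteq> I"
    using G(1,2) D.B.free_onD(2,3)[OF section_closed] unfolding J_def by blast+
  have "submodule R {x \<in> carrier M. \<forall>k. k \<notin> J \<longrightarrow> i x k = \<zero>\<^bsub>H\<^esub>} M"
  proof (rule submodule.intro[OF module_M])
    have "i \<zero>\<^bsub>M\<^esub> k = \<zero>\<^bsub>H\<^esub>" for k
      using section_smult[of "\<zero>\<^bsub>R\<^esub>" "\<zero>\<^bsub>M\<^esub>" k] dual_zero_smult[OF section_coeff[of "\<zero>\<^bsub>M\<^esub>" k]]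
      by (simp del: dual_hopf_simps)
    then show "\<zero>\<^bsub>M\<^esub> \<in> {x \<in> carrier M. \<forall>k. k \<notin> J \<longrightarrow> i x k = \<zero>\<^bsub>H\<^esub>}" by simp
  qed (auto simp: section_add section_smult intro!: restrict_ext)
  then have "C.span G \<subseteq> {x \<in> carrier M. \<forall>k. k \<notin> J \<longrightarrow> i x k = \<zero>\<^bsub>H\<^esub>}"
    by (rule C.span_is_subset[rotated]) (use G in \<open>auto simp: J_def\<close>)
  then show ?thesis using J G(3) by blast
qed

text \<open>The entry at \<open>k\<close> is \<open>coord k y\<close> times \<open>\<theta>\<close>.
  Through \<open>p\<close> it contributes the linear form \<open>coord k\<close> and the coinvariant
  vector obtained by letting \<open>\<theta>\<close> act on the image of the \<open>k\<close>-th
  basis vector; these pairs form the dual basis.\<close>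

lemma finite_rank_truncation:
  assumes "finite J" "J \<subseteq> I"
  shows "finite_rank R MA (\<lambda>y. p (\<lambda>k. if k \<in> J then i y k else \<zero>\<^bsub>H\<^esub>))"
  using assms
proof (induction J rule: finite_induct)
  case empty
  have z: "(\<lambda>k. \<zero>\<^bsub>H\<^esub>) \<in> carrier (free_on H I)"
    unfolding free_on_carrier using D.B.zero_closed by (simp del: dual_hopf_simps)
  have "p (\<lambda>k. \<zero>\<^bsub>H\<^esub>) = p (\<lambda>k. \<zero>\<^bsub>H\<^esub>) \<oplus>\<^bsub>M\<^esub> p (\<lambda>k. \<zero>\<^bsub>H\<^esub>)"
    using retraction_add[OF z z] D.B.l_zero[OF D.B.zero_closed] by (simp del: dual_hopf_simps)
  then have "p (\<lambda>k. \<zero>\<^bsub>H\<^esub>) = \<zero>\<^bsub>M\<^esub>"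
    using retraction_closed[OF z] by (metis C.M.add.r_cancel_one')
  then show ?case by (intro finite_rank.cong[OF finite_rank.zero]) (simp del: dual_hopf_simps)
next
  case (insert k J)
  define e where "e = (\<lambda>j. if j = k then \<one>\<^bsub>H\<^esub> else \<zero>\<^bsub>H\<^esub>)"
  have e: "e \<in> carrier (free_on H I)"
    unfolding free_on_carrier e_def using D.B.zero_closed one_in insert.prems
    by (auto simp del: dual_hopf_simps)
  have "finite_rank R MA (\<lambda>y. coord k y \<odot>\<^bsub>MA\<^esub> act \<theta> (p e) \<oplus>\<^bsub>MA\<^esub>
      p (\<lambda>j. if j \<in> J then i y j else \<zero>\<^bsub>H\<^esub>))"
    by (rule finite_rank.step[OF coord_hom])
      (use insert act_theta_coinvariant[OF retraction_closed[OF e]] in auto)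
  then show ?case
  proof (rule finite_rank.cong)
    fix y assume "y \<in> carrier MA"
    then have y: "y \<in> coinvariants R A M \<alpha>" "y \<in> carrier M" by (auto simp: coinvariants_iff)
    let ?t = "\<lambda>j. if j \<in> J then i y j else \<zero>\<^bsub>H\<^esub>"
    have t: "?t \<in> carrier (free_on H I)"
      unfolding free_on_carrier using section_coeff[OF y(2)] D.B.zero_closed insert
      by (auto simp del: dual_hopf_simps)
    have ie: "(\<lambda>j. i y k \<otimes>\<^bsub>H\<^esub> e j) \<in> carrier (free_on H I)"
      by (rule D.B.free_on_smult_closed[OF e section_coeff[OF y(2)]])
    have "(\<lambda>j. if j \<in> insert k J then i y j else \<zero>\<^bsub>H\<^esub>) = (\<lambda>j. i y k \<otimes>\<^bsub>H\<^esub> e j \<oplus>\<^bsub>H\<^esub> ?t j)"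
      using insert.hyps D.B.r_one[OF section_coeff[OF y(2)]] D.B.r_null[OF section_coeff[OF y(2)]]
        D.B.r_zero[OF section_coeff[OF y(2)]] D.B.l_zero[OF section_coeff[OF y(2)]]
        D.B.l_zero[OF D.B.zero_closed]
      by (intro ext) (simp add: e_def del: dual_hopf_simps)
    then have "p (\<lambda>j. if j \<in> insert k J then i y j else \<zero>\<^bsub>H\<^esub>) = act (i y k) (p e) \<oplus>\<^bsub>M\<^esub> p ?t"
      using retraction_add[OF ie t] retraction_act[OF section_coeff[OF y(2)] e] by (simp only:)
    also have "act (i y k) (p e) = coord k y \<odot>\<^bsub>M\<^esub> act \<theta> (p e)"
      by (subst coord(2)[OF y(1)]) (rule act_smult_left[OF coord(1)[OF y(1)] theta_in retraction_closed[OF e]])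
    finally show "coord k y \<odot>\<^bsub>MA\<^esub> act \<theta> (p e) \<oplus>\<^bsub>MA\<^esub> p ?t =
        p (\<lambda>j. if j \<in> insert k J then i y j else \<zero>\<^bsub>H\<^esub>)" by simp
  qed
qed

lemma finite_rank_id_coinvariants: "finite_rank R MA (\<lambda>y. y)"
proof -
  obtain J where J: "finite J" "J \<subseteq> I" "\<And>x k. \<lbrakk>x \<in> carrier M; k \<notin> J\<rbrakk> \<Longrightarrow> i x k = \<zero>\<^bsub>H\<^esub>"
    using section_support by blast
  from finite_rank_truncation[OF J(1,2)] show ?thesis
  proof (rule finite_rank.cong)
    fix y assume "y \<in> carrier MA"
    then have y: "y \<in> carrier M" by (auto simp: coinvariants_iff)
    have "(\<lambda>k. if k \<in> J then i y k else \<zero>\<^bsub>H\<^esub>) = i y"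
      using J(3)[OF y] by (intro ext) (simp del: dual_hopf_simps)
    then show "p (\<lambda>k. if k \<in> J then i y k else \<zero>\<^bsub>H\<^esub>) = y"
      using retraction_section[OF y] by (simp only:)
  qed
qed

end

section \<open>The form on the coinvariants\<close>

locale equivariant_form = projective_dual_module R A M \<alpha> \<theta> I i p
  for R :: "('r, 'c) ring_scheme" and A :: "('r, 'a, 'd) hopf_scheme"
    and M :: "('r, 'm, 'e) module_scheme" and \<alpha> :: "'m \<Rightarrow> ('m \<times> 'a \<Rightarrow> 'r) set"
    and \<theta> :: "'a \<Rightarrow> 'r" and I :: "'m set" and i :: "'m \<Rightarrow> 'm \<Rightarrow> 'a \<Rightarrow> 'r"
    and p :: "('m \<Rightarrow> 'a \<Rightarrow> 'r) \<Rightarrow> 'm" +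
  fixes q :: "'m \<Rightarrow> 'm \<Rightarrow> 'r"
  assumes form_bundle: "symmetric_bundle R M q"
    and equivariant: "\<lbrakk>g \<in> carrier H; m \<in> carrier M; n \<in> carrier M\<rbrakk>
      \<Longrightarrow> q (act g m) n = q m (act (antipode H g) n)"
    and antipode_theta: "antipode H \<theta> = \<theta>"
begin

abbreviation qA :: "'m \<Rightarrow> 'm \<Rightarrow> 'r" where
  "qA \<equiv> coinvariant_form R M \<alpha> \<theta> q"

lemma bilinear: "bilinear_form R M q"
  using form_bundle by (simp add: symmetric_bundle_def)

lemma form_right: "x \<in> carrier M \<Longrightarrow> q x \<in> module_hom R M (regular R)"
  using bilinear_form.linear_right[OF bilinear] .

lemma form_left: "y \<in> carrier M \<Longrightarrow> (\<lambda>x. q x y) \<in> module_hom R M (regular R)"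
  using bilinear_form.linear_left[OF bilinear] .

lemma form_sym: "\<lbrakk>x \<in> carrier M; y \<in> carrier M\<rbrakk> \<Longrightarrow> q x y = q y x"
  using form_bundle by (simp add: symmetric_bundle_def)

lemma adjoint_bij: "bij_betw (\<lambda>x. restrict (q x) (carrier M)) (carrier M) (linear_forms R M)"
  using form_bundle by (simp add: symmetric_bundle_def)

lemma form_separates:
  assumes "x \<in> carrier M" "y \<in> carrier M" "\<And>n. n \<in> carrier M \<Longrightarrow> q x n = q y n"
  shows "x = y"
  using inj_onD[OF bij_betw_imp_inj_on[OF adjoint_bij] restrict_ext] assms by blast

lemma theta_self_adjoint:
  "\<lbrakk>m \<in> carrier M; n \<in> carrier M\<rbrakk> \<Longrightarrow> q (act \<theta> m) n = q m (act \<theta> n)"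
  using equivariant[OF theta_in] antipode_theta by (simp del: dual_hopf_simps)

text \<open>By self-adjointness, \<open>q m' (\<theta> n) = q (\<theta> m') n\<close> depends on
  \<open>m'\<close> only through \<open>\<theta> m'\<close>, so the description in
  \<open>coinvariant_form\<close> is satisfied. The given \<open>m\<close> and \<open>n\<close> are
  themselves admissible, which leaves a single value.\<close>

lemma coinvariant_form_act:
  assumes "m \<in> carrier M" "n \<in> carrier M"
  shows "qA (act \<theta> m) (act \<theta> n) = q m (act \<theta> n)"
  unfolding coinvariant_form_def
proof (rule the_equality)
  show "\<forall>m'\<in>carrier M. \<forall>n'\<in>carrier M. act \<theta> m = act \<theta> m' \<and> act \<theta> n = act \<theta> n' \<longrightarrow>
      q m (act \<theta> n) = q m' (act \<theta> n) \<and> q m (act \<theta> n) = q (act \<theta> m) n'"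
    using theta_self_adjoint assms by metis
qed (use assms in blast)

lemma coinvariantE:
  assumes "x \<in> coinvariants R A M \<alpha>"
  obtains m where "m \<in> carrier M" "x = act \<theta> m"
  using assms by (auto simp: coinvariants_eq)

lemma coinvariant_form_sym:
  assumes "x \<in> coinvariants R A M \<alpha>" "y \<in> coinvariants R A M \<alpha>"
  shows "qA x y = qA y x"
proof -
  obtain m n where mn: "m \<in> carrier M" "x = act \<theta> m" "n \<in> carrier M" "y = act \<theta> n"
    using assms by (metis coinvariantE)
  then show ?thesis
    using coinvariant_form_act theta_self_adjoint[OF mn(1,3)] form_sym[OF act_closed[OF theta_in mn(1)] mn(3)]
    by simp
qed

lemma coinvariant_form_hom:
  assumes "x \<in> coinvariants R A M \<alpha>"
  shows "qA x \<in> module_hom R MA (regular R)"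
proof -
  obtain m where m: "m \<in> carrier M" "x = act \<theta> m" using assms by (rule coinvariantE)
  have eq: "qA x y = q m y" if "y \<in> coinvariants R A M \<alpha>" for y
    using coinvariant_form_act[OF m(1)] m(2) that by (auto simp: coinvariants_eq)
  interpret N: submodule R "coinvariants R A M \<alpha>" M by (rule coinvariants_submodule)
  show ?thesis
    using formD[OF form_right[OF m(1)]] subsetD[OF N.subset] by (intro formI) (auto simp: eq)
qed

lemma coinvariant_form_bilinear: "bilinear_form R MA qA"
proof (intro bilinear_form.intro module_MA bilinear_form_axioms.intro)
  fix y assume "y \<in> carrier MA"
  then have y: "y \<in> coinvariants R A M \<alpha>" by simp
  show hom: "qA y \<in> module_hom R MA (regular R)" by (rule coinvariant_form_hom[OF y])
  interpret N: submodule R "coinvariants R A M \<alpha>" M by (rule coinvariants_submodule)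
  show "(\<lambda>x. qA x y) \<in> module_hom R MA (regular R)"
    using formD[OF hom] by (intro formI) (auto simp: coinvariant_form_sym[OF _ y])
qed

text \<open>At \<open>y = \<theta> n\<close> the value \<open>qA x y\<close> is
  \<open>q x n\<close>. Testing \<open>x\<close> against all coinvariants therefore tests it against
  all of \<open>M\<close>, where \<open>q\<close> is non-degenerate.\<close>

lemma coinvariant_form_inj:
  assumes x: "x \<in> coinvariants R A M \<alpha>" "x' \<in> coinvariants R A M \<alpha>"
    and eq: "\<And>y. y \<in> coinvariants R A M \<alpha> \<Longrightarrow> qA x y = qA x' y"
  shows "x = x'"
proof -
  obtain m m' where m: "m \<in> carrier M" "x = act \<theta> m" "m' \<in> carrier M" "x' = act \<theta> m'"
    using x by (metis coinvariantE)
  show ?thesis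
  proof (rule form_separates)
    fix n assume n: "n \<in> carrier M"
    show "q x n = q x' n"
      using eq[OF act_theta_coinvariant[OF n]] m n by (simp add: coinvariant_form_act theta_self_adjoint)
  qed (use m act_closed[OF theta_in] in auto)
qed

lemma coinvariant_form_surj:
  assumes f: "f \<in> linear_forms R MA"
  shows "\<exists>x\<in>coinvariants R A M \<alpha>. f = restrict (qA x) (coinvariants R A M \<alpha>)"
proof -
  note fD = formD[OF linear_formsD[OF f], simplified]
  note cl = act_closed[OF theta_in] and co = act_theta_coinvariant
  have "(\<lambda>n. f (act \<theta> n)) \<in> module_hom R M (regular R)"
    by (rule formI) (simp_all add: fD co act_add_right[OF theta_in] act_smult_right[OF _ theta_in])
  then have "(\<lambda>n\<in>carrier M. f (act \<theta> n)) \<in> linear_forms R M" by (rule restrict_linear_form[OF module_M])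
  then have "(\<lambda>n\<in>carrier M. f (act \<theta> n)) \<in> (\<lambda>x. restrict (q x) (carrier M)) ` carrier M"
    by (simp only: bij_betw_imp_surj_on[OF adjoint_bij])
  then obtain x where x: "x \<in> carrier M" "(\<lambda>n\<in>carrier M. f (act \<theta> n)) = restrict (q x) (carrier M)"
    by (rule imageE) simp
  have qx: "q x n = f (act \<theta> n)" if "n \<in> carrier M" for n using fun_cong[OF x(2), of n] that by simp
  have "act g x = g \<one>\<^bsub>A\<^esub> \<odot>\<^bsub>M\<^esub> x" if g: "g \<in> carrier H" for g
  proof (rule form_separates)
    have g1: "g \<one>\<^bsub>A\<^esub> \<in> carrier R" using g by (simp add: formD(1)[OF linear_formsD])
    then show "g \<one>\<^bsub>A\<^esub> \<odot>\<^bsub>M\<^esub> x \<in> carrier M" using x by simp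
    show "act g x \<in> carrier M" using act_closed[OF g x(1)] .
    fix n assume n: "n \<in> carrier M"
    note Sg = dual_antipode_closed[OF g]
    \<comment> \<open>As a right integral, \<open>\<theta>\<close> absorbs the antipode of
      \<open>g\<close> at the cost of its value at \<open>\<one>\<close>, which is that of
      \<open>g\<close> because \<open>antipode A\<close> fixes the unit.\<close>
    have "antipode H g \<one>\<^bsub>A\<^esub> = g \<one>\<^bsub>A\<^esub>" by (simp add: antipode_one)
    then have "act \<theta> (act (antipode H g) n) = g \<one>\<^bsub>A\<^esub> \<odot>\<^bsub>M\<^esub> act \<theta> n"
      using act_mult[OF theta_in Sg n] right_mult_theta[OF Sg] act_smult_left[OF g1 theta_in n]
      by (simp del: dual_hopf_simps)
    then have "q (act g x) n = g \<one>\<^bsub>A\<^esub> \<otimes>\<^bsub>R\<^esub> q x n"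
      using equivariant[OF g x(1) n] qx[OF act_closed[OF Sg n]] qx[OF n] fD(3)[OF g1 co[OF n]]
      by (simp del: dual_hopf_simps)
    then show "q (act g x) n = q (g \<one>\<^bsub>A\<^esub> \<odot>\<^bsub>M\<^esub> x) n"
      using formD(3)[OF form_left[OF n] g1 x(1)] by simp
  qed
  then have xA: "x \<in> coinvariants R A M \<alpha>" using x(1) by (simp add: coinvariants_iff)
  obtain m where m: "m \<in> carrier M" "x = act \<theta> m" using xA by (rule coinvariantE)
  \<comment> \<open>For \<open>x = \<theta> m\<close> and \<open>y = \<theta> n\<close>,
    self-adjointness gives \<open>qA x y = q x n\<close>, and this is \<open>f y\<close> by the
    choice of \<open>x\<close>.\<close>
  have "f y = qA x y" if y: "y \<in> coinvariants R A M \<alpha>" for y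
  proof -
    obtain n where n: "n \<in> carrier M" "y = act \<theta> n" using y by (rule coinvariantE)
    then show ?thesis using qx[OF n(1)] m by (simp add: coinvariant_form_act theta_self_adjoint)
  qed
  then have "f = restrict (qA x) (coinvariants R A M \<alpha>)"
    using f by (auto simp: linear_forms_def intro!: extensionalityI[of _ "coinvariants R A M \<alpha>"])
  then show ?thesis using xA by auto
qed

lemma coinvariant_bundle:
  assumes "domain R"
  shows "symmetric_bundle R MA qA"
  unfolding symmetric_bundle_def
proof (intro conjI ballI)
  show "fg_locally_free R MA"
    by (rule fg_locally_free_of_finite_rank_id[OF assms module_MA finite_rank_id_coinvariants])
  show "bilinear_form R MA qA" by (rule coinvariant_form_bilinear)
  show "qA x y = qA y x" if "x \<in> carrier MA" "y \<in> carrier MA" for x y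
    using that by (simp add: coinvariant_form_sym)
  show "bij_betw (\<lambda>x. restrict (qA x) (carrier MA)) (carrier MA) (linear_forms R MA)"
    unfolding bij_betw_def
  proof
    show "inj_on (\<lambda>x. restrict (qA x) (carrier MA)) (carrier MA)"
    proof (rule inj_onI)
      fix x x' assume x: "x \<in> carrier MA" "x' \<in> carrier MA"
        "restrict (qA x) (carrier MA) = restrict (qA x') (carrier MA)"
      have "qA x y = qA x' y" if "y \<in> coinvariants R A M \<alpha>" for y
        using fun_cong[OF x(3), of y] that by simp
      then show "x = x'" using coinvariant_form_inj x(1,2) by simp
    qed
    show "(\<lambda>x. restrict (qA x) (carrier MA)) ` carrier MA = linear_forms R MA"
      using restrict_linear_form[OF module_MA coinvariant_form_hom] coinvariant_form_surj
      by (auto simp: image_iff)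
  qed
qed

end

theorem proposition2p9:
  fixes R :: "('r, 'c) ring_scheme"
    and A :: "('r, 'a, 'd) hopf_scheme"
    and M :: "('r, 'm, 'e) module_scheme"
    and \<alpha> :: "'m \<Rightarrow> ('m \<times> 'a \<Rightarrow> 'r) set"
    and q :: "'m \<Rightarrow> 'm \<Rightarrow> 'r"
    and \<theta> :: "'a \<Rightarrow> 'r"
  assumes "noetherian_domain R"
    and "\<one>\<^bsub>R\<^esub> \<oplus>\<^bsub>R\<^esub> \<one>\<^bsub>R\<^esub> \<in> Units R"
    and "finite_locally_free_hopf_algebra R A"
    and "\<forall>a\<in>carrier A. antipode A (antipode A a) = a"
    and "H1 R (dual_hopf R A)"
    and "is_basis R (integral_module (dual_hopf R A)) {\<theta>}"
    and "projective_equivariant_symmetric_bundle R A M \<alpha> q"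
  shows "symmetric_bundle R (M\<lparr>carrier := coinvariants R A M \<alpha>\<rparr>) (coinvariant_form R M \<alpha> \<theta> q)"
proof -
  have dom: "domain R" using assms(1) by (simp add: noetherian_domain_def)
  have eq: "equivariant_symmetric_bundle R A M \<alpha> q"
    and proj: "projective_module (dual_hopf R A) (as_dual_module R M \<alpha>)"
    using assms(7) by (simp_all add: projective_equivariant_symmetric_bundle_def)
  obtain I :: "'m set" and i p where hom: "i \<in> module_hom (dual_hopf R A) (as_dual_module R M \<alpha>) (free_on (dual_hopf R A) I)"
    "p \<in> module_hom (dual_hopf R A) (free_on (dual_hopf R A) I) (as_dual_module R M \<alpha>)"
    "\<forall>x\<in>carrier (as_dual_module R M \<alpha>). p (i x) = x"
    using proj unfolding projective_module_def by blast
  have fg: "fg_locally_free R A" using assms(3) by (simp add: finite_locally_free_hopf_algebra_def)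
  have theta: "\<theta> \<in> left_integrals (dual_hopf R A)"
    using assms(6) by (simp add: is_basis_def integral_module_def)
  interpret equivariant_form R A M \<alpha> \<theta> I i p q
  proof (intro equivariant_form.intro projective_dual_module.intro dual_action_module.intro
      dual_action_module_axioms.intro projective_dual_module_axioms.intro equivariant_form_axioms.intro)
    show "hopf_algebra R A" using assms(3) by (simp add: finite_locally_free_hopf_algebra_def)
    show "comodule R A M \<alpha>" using eq by (simp add: equivariant_symmetric_bundle_def)
    show "left_module (dual_hopf R A) (as_dual_module R M \<alpha>)" using proj by (simp add: projective_module_def)
    show "finite_rank R A (\<lambda>a. a)" by (rule finite_rank_id_of_fg_locally_free[OF assms(1) fg])
    show "module R (integral_module (dual_hopf R A))" "unimodular (dual_hopf R A)"
      using assms(5) by (simp_all add: H1_def free_module_def)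
    show "antipode (dual_hopf R A) \<theta> = \<theta>"
      using assms(5) theta by (simp add: H1_def del: dual_hopf_simps)
    show "p (i x) = x" if "x \<in> carrier M" for x using hom(3) that by simp
    show "symmetric_bundle R M q" using eq by (simp add: equivariant_symmetric_bundle_def)
    show "q (dual_action R M \<alpha> g m) n = q m (dual_action R M \<alpha> (antipode (dual_hopf R A) g) n)"
      if "g \<in> carrier (dual_hopf R A)" "m \<in> carrier M" "n \<in> carrier M" for g m n
      using eq that unfolding equivariant_symmetric_bundle_def by blast
  qed (fact assms(6) hom(1,2))+
  show ?thesis by (rule coinvariant_bundle[OF dom])
qed

end
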